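(* Let $X$ be a Banach space and let $\Gamma:[0,1]\to cb(X)$. Then $\Gamma$ is McShane integrable in $cb(X)$ (resp. Birkhoff integrable in $cb(X)$) if and only if $\Gamma$ is strongly Pettis integrable in $cb(X)$ and Henstock integrable in $cb(X)$ (resp. strongly Pettis integrable in $cb(X)$ and $\mathcal{H}$-integrable in $cb(X)$).
   Context: $X$ is a (real) Banach space with dual $X^*$; $cb(X)$ is the family of all nonempty closed convex bounded subsets of $X$ with Hausdorff metric $d_H$. For $C\in cb(X)$, $s(x^*,C)=\sup\{\langle x^*,x\rangle: x\in C\}$. The interval $[0,1]$ carries Lebesgue measure $\lambda$ and $\mathcal{L}$ is the family of its Lebesgue measurable subsets. Sums of sets are Minkowski sums. Pettis: $\Gamma$ is Pettis integrable in $cb(X)$ if $s(x^*,\Gamma(\cdot))$ is Lebesgue integrable for every $x^*\in X^*$ and for each $A\in\mathcal{L}$ there is $M_\Gamma(A)\in cb(X)$ with $s(x^*,M_\Gamma(A))=\int_A s(x^*,\Gamma)\,d\lambda$ for all $x^*\in X^*$. It is strongly Pettis integrable in $cb(X)$ if moreover $M_\Gamma:\mathcal{L}\to cb(X)$ is an $h$-multimeasure, i.e. countably additive in the Hausdorff metric: for all pairwise disjoint $E_n\in\mathcal{L}$, $\lim_n d_H\big(\sum_{k=1}^n M_\Gamma(E_k),M_\Gamma(\bigcup_{k=1}^\infty E_k)\big)=0$. Gauge integrals: a partition of $[0,1]$ is a finite collection $\{(I_1,t_1),\dots,(I_p,t_p)\}$ with $I_i$ nonoverlapping closed subintervals of $[0,1]$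 whose union is $[0,1]$ and $t_i\in[0,1]$; it is a Perron partition if $t_i\in I_i$ for all $i$. A gauge is a positive function $\delta$ on $[0,1]$; a partition is $\delta$-fine if $I_i\subset(t_i-\delta(t_i),t_i+\delta(t_i))$ for all $i$. $\Gamma:[0,1]\to cb(X)$ is Henstock (resp. McShane) integrable in $cb(X)$ if there is $\Phi_\Gamma([0,1])\in cb(X)$ such that for every $\varepsilon>0$ there is a gauge $\delta$ such that for every $\delta$-fine Perron partition (resp. partition) of $[0,1]$, $d_H\big(\Phi_\Gamma([0,1]),\sum_{i=1}^p\Gamma(t_i)|I_i|\big)<\varepsilon$. $\Gamma$ is $\mathcal{H}$-integrable (resp. Birkhoff integrable) in $cb(X)$ if it satisfies the definition of Henstock (resp. McShane) integrability with the gauges $\delta$ required to be measurable. *)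

theory Defs
  imports "HOL-Analysis.Analysis"
begin

definition cb :: "'a::real_normed_vector set set" where
  "cb = {C. C \<noteq> {} \<and> closed C \<and> convex C \<and> bounded C}"

text \<open>
  The dual space is the type \<open>'a \<Rightarrow>\<^sub>L real\<close>. For \<open>C\<close> in \<open>cb\<close> the supremum is over a nonempty,
  bounded set of reals.
\<close>

definition support_fun :: "('a::real_normed_vector \<Rightarrow>\<^sub>L real) \<Rightarrow> 'a set \<Rightarrow> real" where
  "support_fun f C = (SUP x\<in>C. blinfun_apply f x)"

text \<open>
  Minkowski sums of members of \<open>cb\<close> need not be closed, so the Hausdorff distance is applied to
  arbitrary nonempty bounded sets; the suprema are bounded there, and replacing a set by its
  closure does not change the value.
\<close>

definition hausdorff_dist :: "'a::metric_space set \<Rightarrow> 'a set \<Rightarrow> real" where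
  "hausdorff_dist A B = max (SUP a\<in>A. infdist a B) (SUP b\<in>B. infdist b A)"


subsection \<open>Pettis integrability\<close>

definition support_integrable :: "(real \<Rightarrow> 'a::banach set) \<Rightarrow> bool" where
  "support_integrable \<Gamma> \<longleftrightarrow>
     (\<forall>f. set_integrable lebesgue {0..1} (\<lambda>t. support_fun f (\<Gamma> t)))"

definition is_pettis_integral ::
    "(real \<Rightarrow> 'a::banach set) \<Rightarrow> (real set \<Rightarrow> 'a set) \<Rightarrow> bool" where
  "is_pettis_integral \<Gamma> M \<longleftrightarrow>
     (\<forall>A\<in>sets (lebesgue_on {0..1}). M A \<in> cb \<and>
        (\<forall>f. support_fun f (M A) = set_lebesgue_integral lebesgue A (\<lambda>t. support_fun f (\<Gamma> t))))"

definition pettis_integrable :: "(real \<Rightarrow> 'a::banach set) \<Rightarrow> bool" where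
  "pettis_integrable \<Gamma> \<longleftrightarrow> support_integrable \<Gamma> \<and> (\<exists>M. is_pettis_integral \<Gamma> M)"

text \<open>The sum of sets is the Minkowski sum of \<open>HOL-Library.Set_Algebras\<close>.\<close>

definition h_multimeasure :: "(real set \<Rightarrow> 'a::banach set) \<Rightarrow> bool" where
  "h_multimeasure M \<longleftrightarrow>
     (\<forall>A\<in>sets (lebesgue_on {0..1}). M A \<in> cb) \<and>
     (\<forall>E::nat \<Rightarrow> real set. range E \<subseteq> sets (lebesgue_on {0..1}) \<and> disjoint_family E \<longrightarrow>
        (\<lambda>n. hausdorff_dist (\<Sum>k<n. M (E k)) (M (\<Union>k. E k))) \<longlonglongrightarrow> 0)"

text \<open>
  On measurable sets \<open>M\<close> is determined by \<open>\<Gamma>\<close>, as closed convex sets are determined by their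
  support functions; so the existential quantifier speaks about the one indefinite integral.
\<close>

definition strongly_pettis_integrable :: "(real \<Rightarrow> 'a::banach set) \<Rightarrow> bool" where
  "strongly_pettis_integrable \<Gamma> \<longleftrightarrow>
     pettis_integrable \<Gamma> \<and> (\<exists>M. is_pettis_integral \<Gamma> M \<and> h_multimeasure M)"


subsection \<open>Gauge integrals\<close>

text \<open>
  As in the library, a partition is a finite set of pairs (tag, interval) and one-point intervals
  are allowed. They do not influence Riemann sums, because \<open>\<Gamma> t\<close> is nonempty and so
  \<open>0 \<cdot> \<Gamma> t = {0}\<close>. Tags need not lie in their intervals.
\<close>

definition partition_01 :: "(real \<times> real set) set \<Rightarrow> bool" where
  "partition_01 P \<longleftrightarrow>
     finite P \<and>
     (\<forall>(t, I)\<in>P. t \<in> {0..1} \<and> I \<subseteq> {0..1} \<and> (\<exists>a b. a \<le> b \<and> I = {a..b})) \<and>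
     (\<forall>(t, I)\<in>P. \<forall>(u, J)\<in>P. (t, I) \<noteq> (u, J) \<longrightarrow> interior I \<inter> interior J = {}) \<and>
     \<Union>(snd ` P) = {0..1}"

definition perron_partition_01 :: "(real \<times> real set) set \<Rightarrow> bool" where
  "perron_partition_01 P \<longleftrightarrow> partition_01 P \<and> (\<forall>(t, I)\<in>P. t \<in> I)"

lemma perron_partition_01_iff_tagged_division:
  "perron_partition_01 P \<longleftrightarrow> P tagged_division_of {0..1}"
proof -
  have *: "(\<Union>{K. \<exists>x. (x, K) \<in> P}) = \<Union>(snd ` P)"
    by force
  have **: "x \<in> K \<Longrightarrow> (\<exists>a b. K = cbox a b) \<longleftrightarrow> (\<exists>a b. a \<le> b \<and> K = {a..b})" for x :: real and K
    by (auto simp: cbox_interval)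
  have dis: "(\<forall>(t, I)\<in>P. \<forall>(u, J)\<in>P. (t, I) \<noteq> (u, J) \<longrightarrow> interior I \<inter> interior J = {})
      \<longleftrightarrow> (\<forall>x1 K1 x2 K2. (x1, K1) \<in> P \<and> (x2, K2) \<in> P \<and> (x1, K1) \<noteq> (x2, K2) \<longrightarrow>
             interior K1 \<inter> interior K2 = {})"
    unfolding Ball_def split_paired_All prod.case by meson
  have ord: "(\<forall>(t, I)\<in>P. t \<in> {0..1} \<and> I \<subseteq> {0..1} \<and> (\<exists>a b. a \<le> b \<and> I = {a..b})) \<and> (\<forall>(t, I)\<in>P. t \<in> I)
      \<longleftrightarrow> (\<forall>x K. (x, K) \<in> P \<longrightarrow> x \<in> K \<and> K \<subseteq> {0..1} \<and> (\<exists>a b. K = cbox a b))"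
    (is "?ord \<and> ?tag \<longleftrightarrow> ?ord'")
  proof
    assume o: "?ord \<and> ?tag"
    show ?ord'
    proof (intro allI impI)
      fix x K assume "(x, K) \<in> P"
      with o have "x \<in> K" "K \<subseteq> {0..1}" "\<exists>a b. a \<le> b \<and> K = {a..b}" by auto
      then show "x \<in> K \<and> K \<subseteq> {0..1} \<and> (\<exists>a b. K = cbox a b)" using ** by blast
    qed
  next
    assume o: ?ord'
    have "x \<in> K \<and> x \<in> {0..1} \<and> K \<subseteq> {0..1} \<and> (\<exists>a b. a \<le> b \<and> K = {a..b})"
      if "(x, K) \<in> P" for x K
    proof -
      from o that have "x \<in> K" "K \<subseteq> {0..1}" "\<exists>a b. K = cbox a b" by simp_all
      with **[of x K] show ?thesis by blast
    qed
    then show "?ord \<and> ?tag" by fast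
  qed
  show ?thesis
    unfolding perron_partition_01_def partition_01_def tagged_division_of_def
      tagged_partial_division_of_def * dis ord[symmetric]
    by argo
qed

definition positive_gauge :: "(real \<Rightarrow> real) \<Rightarrow> bool" where
  "positive_gauge \<delta> \<longleftrightarrow> (\<forall>t\<in>{0..1}. 0 < \<delta> t)"

definition measurable_gauge :: "(real \<Rightarrow> real) \<Rightarrow> bool" where
  "measurable_gauge \<delta> \<longleftrightarrow> positive_gauge \<delta> \<and> \<delta> \<in> borel_measurable (lebesgue_on {0..1})"

definition riemann_sum :: "(real \<Rightarrow> 'a::banach set) \<Rightarrow> (real \<times> real set) set \<Rightarrow> 'a set" where
  "riemann_sum \<Gamma> P = (\<Sum>(t, I)\<in>P. (\<lambda>x. measure lebesgue I *\<^sub>R x) ` \<Gamma> t)"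

text \<open>The common shape of the four integrals: admissible gauges \<open>G\<close> and admissible partitions \<open>Q\<close>.\<close>

definition gauge_integrable ::
    "((real \<Rightarrow> real) \<Rightarrow> bool) \<Rightarrow> ((real \<times> real set) set \<Rightarrow> bool) \<Rightarrow>
     (real \<Rightarrow> 'a::banach set) \<Rightarrow> bool" where
  "gauge_integrable G Q \<Gamma> \<longleftrightarrow>
     (\<exists>\<Phi>\<in>cb. \<forall>\<epsilon>>0. \<exists>\<delta>. G \<delta> \<and>
        (\<forall>P. Q P \<and> (\<lambda>t. {t - \<delta> t<..<t + \<delta> t}) fine P \<longrightarrow>
           hausdorff_dist \<Phi> (riemann_sum \<Gamma> P) < \<epsilon>))"

definition henstock_integrable :: "(real \<Rightarrow> 'a::banach set) \<Rightarrow> bool" where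
  "henstock_integrable = gauge_integrable positive_gauge perron_partition_01"

definition mcshane_integrable :: "(real \<Rightarrow> 'a::banach set) \<Rightarrow> bool" where
  "mcshane_integrable = gauge_integrable positive_gauge partition_01"

definition H_integrable :: "(real \<Rightarrow> 'a::banach set) \<Rightarrow> bool" where
  "H_integrable = gauge_integrable measurable_gauge perron_partition_01"

definition birkhoff_integrable :: "(real \<Rightarrow> 'a::banach set) \<Rightarrow> bool" where
  "birkhoff_integrable = gauge_integrable measurable_gauge partition_01"

end

theory Submission
  imports Defs
begin

text \<open>
  Radstrom's embedding sends \<open>C\<close> to its support function on the dual unit ball and turns the Hausdorff
  distance into the supremum norm (Hahn--Banach), so \<open>\<Gamma>\<close> becomes a function \<open>g\<close> with values in a Banach space
  that is normed by the evaluations at functionals.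

  If \<open>g\<close> is McShane integrable, the step functions taken from \<open>\<delta>\<^sub>n\<close>-fine partitions have indefinite
  integrals converging uniformly on all measurable sets, because retagging a fine family costs at most \<open>2\<epsilon>\<close>;
  the limit is countably additive and is the Pettis integral.

  Conversely, let \<open>\<delta>\<^sub>0\<close> be a Henstock gauge for \<open>\<epsilon> = 1\<close>. On \<open>C\<^sub>k = {t. \<lfloor>1 / \<delta>\<^sub>0 t\<rfloor> = k}\<close> the function \<open>g\<close> is bounded.
  Take a Henstock gauge \<open>\<delta>\<^sub>k\<close> for a tiny error \<open>c\<^sub>k\<close> and a set \<open>A\<^sub>k \<subseteq> C\<^sub>k\<close>, filling \<open>C\<^sub>k\<close> up to small outer measure,
  on which \<open>\<delta>\<^sub>k\<close> is bounded below. A short ball around a tag \<open>t \<in> C\<^sub>k\<close> is fine both for \<open>t\<close> and for every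
  \<open>x \<in> A\<^sub>k\<close> in it, so Vitali's covering lemma and Chebyshev's inequality bound \<open>\<Sum> |f (t\<^sub>i) - f (x\<^sub>i)| |I\<^sub>i|\<close> for each
  coordinate \<open>f\<close> of \<open>g\<close>. Hence \<open>\<Sum> f (t\<^sub>i) |I\<^sub>i|\<close> is close to the integral of \<open>f\<close> over the measurable hull of \<open>A\<^sub>k\<close>, and
  what remains is small by the uniform absolute continuity of the indefinite integral.
\<close>

subsection \<open>Hahn--Banach separation\<close>

text \<open>A McShane tag \<open>t\<close> need not lie in its interval \<open>I\<close>, so
  Henstock's lemma says nothing about the pair \<open>(t, I)\<close> itself. It does apply to a ball
  around \<open>t\<close>, but the balls of a partition overlap without control. Hence the passage
  to disjoint balls and the loss of a Chebyshev estimate, which forces \<open>g\<close> to be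
  bounded on each piece and the Henstock error there to be small compared with that bound. In
  general only the coordinates of \<open>g\<close> are known to be measurable. Pieces, bounds and
  hulls are therefore fixed before any coordinate is named, so that every estimate is uniform and
  passes to the supremum norm. The sets cut out by an arbitrary gauge need not be measurable either,
  which is why measurable hulls and open neighbourhoods stand in for them. Cutting by the integer
  part of \<open>1 / \<delta>0\<close> preserves measurability of gauges, so both equivalences share
  one argument. In the direction from McShane the limit must again be represented by a set; for this
  the range of the embedding has to be a closed convex cone.\<close>

definition sublinear :: "('a::real_vector \<Rightarrow> real) \<Rightarrow> bool" where
  "sublinear p \<longleftrightarrow> (\<forall>x y. p (x + y) \<le> p x + p y) \<and> (\<forall>c x. 0 \<le> c \<longrightarrow> p (c *\<^sub>R x) = c * p x)"

lemma sublinear_add: "sublinear p \<Longrightarrow> p (x + y) \<le> p x + p y"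
  and sublinear_scale: "sublinear p \<Longrightarrow> 0 \<le> c \<Longrightarrow> p (c *\<^sub>R x) = c * p x"
  and sublinear_zero: "sublinear p \<Longrightarrow> p 0 = 0"
  unfolding sublinear_def
  subgoal by blast
  subgoal by blast
  subgoal by (metis mult_zero_left order_refl scaleR_zero_left)
  done

lemma sublinear_ge_minus: "sublinear p \<Longrightarrow> - p (- x) \<le> p x"
  using sublinear_add[of p x "-x"] sublinear_zero[of p] by simp

text \<open>Positive homogeneity is only needed as an inequality, by scaling back with \<open>1/c\<close>.\<close>

lemma sublinearI:
  assumes "\<And>x y. p (x + y) \<le> p x + p y" and le: "\<And>c x. 0 < c \<Longrightarrow> p (c *\<^sub>R x) \<le> c * p x"
  shows "sublinear p"
  unfolding sublinear_def
proof (intro conjI allI impI)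
  show "p (x + y) \<le> p x + p y" for x y by fact
  show "p (c *\<^sub>R x) = c * p x" if "0 \<le> c" for c x
  proof (cases "c = 0")
    case True
    then show ?thesis using le[of 2 0] le[of "1/2" 0] by simp
  next
    case False
    then have c: "0 < c" using that by simp
    have "p ((1/c) *\<^sub>R (c *\<^sub>R x)) \<le> (1/c) * p (c *\<^sub>R x)"
      by (rule le) (use c in simp)
    then have "c * p x \<le> p (c *\<^sub>R x)" using c by (simp add: field_simps)
    then show ?thesis using le[OF c, of x] by simp
  qed
qed

text \<open>Chain bounds, the auxiliary functional for linearity and the separating functional are
  all pointwise infima. Letting the index \<open>k\<close> depend on the points covers chains and
  convex families alike.\<close>

lemma sublinear_INF:
  fixes \<phi> :: "'i \<Rightarrow> 'a::real_vector \<Rightarrow> real"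
  assumes I: "I \<noteq> {}" and bdd: "\<And>x. bdd_below ((\<lambda>i. \<phi> i x) ` I)"
    and add: "\<And>i j x y. i \<in> I \<Longrightarrow> j \<in> I \<Longrightarrow> \<exists>k\<in>I. \<phi> k (x + y) \<le> \<phi> i x + \<phi> j y"
    and scale: "\<And>i c x. i \<in> I \<Longrightarrow> 0 < c \<Longrightarrow> \<exists>k\<in>I. \<phi> k (c *\<^sub>R x) \<le> c * \<phi> i x"
  shows "sublinear (\<lambda>x. INF i\<in>I. \<phi> i x)"
proof (rule sublinearI)
  let ?u = "\<lambda>x. INF i\<in>I. \<phi> i x"
  have le: "?u x \<le> \<phi> i x" if "i \<in> I" for i x by (rule cINF_lower[OF bdd that])
  show "?u (x + y) \<le> ?u x + ?u y" for x y
  proof -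
    have "?u (x + y) - \<phi> j y \<le> ?u x" if j: "j \<in> I" for j
    proof (rule cINF_greatest[OF I])
      fix i assume "i \<in> I"
      then obtain k where "k \<in> I" "\<phi> k (x + y) \<le> \<phi> i x + \<phi> j y" using add j by blast
      then show "?u (x + y) - \<phi> j y \<le> \<phi> i x" using le[of k "x + y"] by linarith
    qed
    then have "?u (x + y) - ?u x \<le> ?u y" by (intro cINF_greatest[OF I]) (simp add: algebra_simps)
    then show ?thesis by simp
  qed
  show "?u (c *\<^sub>R x) \<le> c * ?u x" if c: "0 < c" for c x
  proof -
    have "?u (c *\<^sub>R x) / c \<le> ?u x"
    proof (rule cINF_greatest[OF I])
      fix i assume "i \<in> I"
      then obtain k where "k \<in> I" "\<phi> k (c *\<^sub>R x) \<le> c * \<phi> i x" using scale c by blast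
      then show "?u (c *\<^sub>R x) / c \<le> \<phi> i x" using le[of k "c *\<^sub>R x"] c by (simp add: field_simps)
    qed
    then show ?thesis using c by (simp add: field_simps)
  qed
qed

section \<open>Hahn-Banach through minimal sublinear functionals\<close>

text \<open>Zorn's lemma for the reversed pointwise order. The infimum of a chain is finite because
  every member lies above \<open>- p (- x)\<close>, and it is subadditive because the smaller of two
  members serves both summands. Minimality replaces the usual extension from a subspace.\<close>

lemma minimal_sublinear_exists:
  fixes p :: "'a::real_vector \<Rightarrow> real"
  assumes p: "sublinear p"
  obtains q where "sublinear q" "q \<le> p" "\<And>r. sublinear r \<Longrightarrow> r \<le> q \<Longrightarrow> r = q"
proof -
  define A where "A = {q. sublinear q \<and> q \<le> p}"
  have "\<exists>m\<in>A. \<forall>a\<in>A. a \<le> m \<longrightarrow> a = m"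
  proof (rule predicate_Zorn)
    show "partial_order_on A (relation_of (\<lambda>x y. y \<le> x) A)"
      by (intro partial_order_on_relation_ofI) auto
    fix C assume C: "C \<in> Chains (relation_of (\<lambda>x y. y \<le> x) A)"
    then have CA: "C \<subseteq> A" using Chains_relation_of by blast
    have chain: "q \<le> r \<or> r \<le> q" if "q \<in> C" "r \<in> C" for q r
      using C that unfolding Chains_def relation_of_def by auto
    show "\<exists>u\<in>A. \<forall>a\<in>C. u \<le> a"
    proof (cases "C = {}")
      case True
      then show ?thesis using p by (auto simp: A_def)
    next
      case False
      define u where "u x = (INF q\<in>C. q x)" for x
      have bdd: "bdd_below ((\<lambda>q. q x) ` C)" for x
      proof (rule bdd_belowI2)
        fix q assume "q \<in> C"
        then have "sublinear q" "q \<le> p" using CA by (auto simp: A_def)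
        then show "- p (-x) \<le> q x" using sublinear_ge_minus[of q x] by (smt (verit) le_funD)
      qed
      have le: "u x \<le> q x" if "q \<in> C" for q x
        unfolding u_def by (rule cINF_lower[OF bdd that])
      have sub: "sublinear q" if "q \<in> C" for q using that CA by (auto simp: A_def)
      have "sublinear (\<lambda>x. INF q\<in>C. q x)"
      proof (rule sublinear_INF[OF False bdd])
        fix q r x y assume qr: "q \<in> C" "r \<in> C"
        show "\<exists>k\<in>C. k (x + y) \<le> q x + r y"
        proof (cases "q \<le> r")
          case True
          then show ?thesis using qr(1) sublinear_add[OF sub[OF qr(1)], of x y] le_funD[OF True, of y] by (intro bexI[of _ q]) auto
        next
          case False
          then have "r \<le> q" using chain[OF qr] by blast
          then show ?thesis using qr(2) sublinear_add[OF sub[OF qr(2)], of x y] le_funD[of r q x] by (intro bexI[of _ r]) auto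
        qed
      next
        fix q x and c :: real assume "q \<in> C" "0 < c"
        then show "\<exists>k\<in>C. k (c *\<^sub>R x) \<le> c * q x"
          using sublinear_scale[OF sub, of q c x] by (intro bexI[of _ q]) auto
      qed
      then have "sublinear u" unfolding u_def[abs_def] .
      moreover have "u \<le> p"
      proof (rule le_funI)
        fix x
        obtain q where "q \<in> C" using False by blast
        then have "u x \<le> q x" "q \<le> p" using le CA by (auto simp: A_def)
        then show "u x \<le> p x" using le_funD[of q p x] by simp
      qed
      ultimately show ?thesis using le by (auto simp: A_def le_fun_def)
    qed
  qed
  then obtain m where "m \<in> A" "\<And>a. a \<in> A \<Longrightarrow> a \<le> m \<Longrightarrow> a = m" by blast
  then have "sublinear m" "m \<le> p" "\<And>r. sublinear r \<Longrightarrow> r \<le> m \<Longrightarrow> r = m"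
    by (auto simp: A_def dest: order_trans)
  then show thesis by (rule that)
qed

text \<open>The auxiliary \<open>r\<close> lowers \<open>q\<close> along the direction
  \<open>y\<close> as far as possible and stays sublinear, so minimality gives \<open>r = q\<close>.
  Its term with \<open>t = 1\<close> is then the missing inequality
  \<open>q x + q y \<le> q (x + y)\<close>.\<close>

lemma minimal_sublinear_linear:
  fixes q :: "'a::real_vector \<Rightarrow> real"
  assumes q: "sublinear q" and min: "\<And>r. sublinear r \<Longrightarrow> r \<le> q \<Longrightarrow> r = q"
  shows "linear q"
proof -
  have add: "q (x + y) = q x + q y" for x y
  proof -
    define r where "r x = (INF t\<in>{0..}. q (x + t *\<^sub>R y) - t * q y)" for x
    have bdd: "bdd_below ((\<lambda>t. q (x + t *\<^sub>R y) - t * q y) ` {0..})" for x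
    proof (rule bdd_belowI2)
      fix t :: real assume "t \<in> {0..}"
      then have "t * q y = q (t *\<^sub>R y)" using sublinear_scale[OF q] by simp
      also have "\<dots> \<le> q (x + t *\<^sub>R y) + q (-x)"
        using sublinear_add[OF q, of "x + t *\<^sub>R y" "-x"] by simp
      finally show "- q (-x) \<le> q (x + t *\<^sub>R y) - t * q y" by simp
    qed
    have le: "r x \<le> q (x + t *\<^sub>R y) - t * q y" if "0 \<le> t" for t x
      unfolding r_def by (rule cINF_lower[OF bdd]) (use that in simp)
    have "sublinear r"
      unfolding r_def[abs_def]
    proof (rule sublinear_INF[OF _ bdd])
      fix s t :: real and u v assume st: "s \<in> {0..}" "t \<in> {0..}"
      have "q (u + v + (s + t) *\<^sub>R y) \<le> q (u + s *\<^sub>R y) + q (v + t *\<^sub>R y)"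
        using sublinear_add[OF q, of "u + s *\<^sub>R y" "v + t *\<^sub>R y"] by (simp add: algebra_simps)
      then show "\<exists>k\<in>{0..}. q (u + v + k *\<^sub>R y) - k * q y \<le> q (u + s *\<^sub>R y) - s * q y + (q (v + t *\<^sub>R y) - t * q y)"
        using st by (intro bexI[of _ "s + t"]) (auto simp: algebra_simps)
    next
      fix t c :: real and x assume t: "t \<in> {0..}" "0 < c"
      have "q (c *\<^sub>R x + (c * t) *\<^sub>R y) = c * q (x + t *\<^sub>R y)"
        using sublinear_scale[OF q, of c "x + t *\<^sub>R y"] t by (simp add: algebra_simps)
      then show "\<exists>k\<in>{0..}. q (c *\<^sub>R x + k *\<^sub>R y) - k * q y \<le> c * (q (x + t *\<^sub>R y) - t * q y)"
        using t by (intro bexI[of _ "c * t"]) (auto simp: algebra_simps)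
    qed auto
    moreover have "r \<le> q" using le[of 0] by (simp add: le_fun_def)
    ultimately have "r = q" by (rule min)
    then have "q x \<le> q (x + y) - q y" using le[of 1 x] by simp
    then show ?thesis using sublinear_add[OF q, of x y] by simp
  qed
  have neg: "q (- x) = - q x" for x using add[of x "-x"] sublinear_zero[OF q] by simp
  show ?thesis
  proof (rule linearI)
    show "q (c *\<^sub>R x) = c *\<^sub>R q x" for c x
      using sublinear_scale[OF q, of c x] sublinear_scale[OF q, of "-c" x] neg[of "c *\<^sub>R x"]
      by (cases "0 \<le> c") auto
  qed (rule add)
qed

text \<open>Applied to \<open>a \<mapsto> \<parallel>y + \<lambda> a\<parallel> - \<lambda> d\<close>, whose infimum over \<open>\<lambda> \<ge> 0\<close> and \<open>a\<close> in the convex set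
  \<open>x - B\<close> is sublinear, Hahn--Banach separates \<open>x\<close> from \<open>B\<close> with the best constant.\<close>

lemma separating_functional_infdist:
  fixes B :: "'a::real_normed_vector set"
  assumes B: "B \<noteq> {}" "convex B"
  obtains f :: "'a \<Rightarrow>\<^sub>L real" where "norm f \<le> 1" "\<And>b. b \<in> B \<Longrightarrow> infdist x B \<le> f x - f b"
proof -
  define d where "d = infdist x B"
  define A where "A = (\<lambda>b. x - b) ` B"
  have A: "A \<noteq> {}" "convex A" using B convex_translation[of "uminus ` B" x] convex_negations[of B]
    by (auto simp: A_def image_image)
  have dA: "d \<le> norm a" if "a \<in> A" for a
    using that infdist_le[of _ B x] by (auto simp: A_def d_def dist_norm)
  define T where "T = {0::real..} \<times> A"
  define p where "p y = (INF (t, a)\<in>T. norm (y + t *\<^sub>R a) - t * d)" for y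
  have T: "T \<noteq> {}" using A by (auto simp: T_def)
  have bdd: "bdd_below ((\<lambda>(t, a). norm (y + t *\<^sub>R a) - t * d) ` T)" for y
  proof (rule bdd_belowI2, clarify)
    fix t a assume "(t, a) \<in> T"
    then have t: "0 \<le> t" "a \<in> A" by (auto simp: T_def)
    have "t * d \<le> norm (t *\<^sub>R a)" using t dA[of a] by (simp add: mult_left_mono)
    also have "\<dots> \<le> norm (y + t *\<^sub>R a) + norm y" using norm_triangle_ineq4[of "y + t *\<^sub>R a" y] by simp
    finally show "- norm y \<le> norm (y + t *\<^sub>R a) - t * d" by simp
  qed
  have le: "p y \<le> norm (y + t *\<^sub>R a) - t * d" if "0 \<le> t" "a \<in> A" for t a y
    unfolding p_def using cINF_lower[OF bdd, of "(t, a)" y] that by (auto simp: T_def)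
  obtain a0 where a0: "a0 \<in> A" using A by blast
  have p: "sublinear p"
    unfolding p_def[abs_def]
  proof (rule sublinear_INF[OF T bdd])
    fix i j u v assume ij: "i \<in> T" "j \<in> T"
    obtain s a t b where st: "i = (s, a)" "j = (t, b)" "0 \<le> s" "a \<in> A" "0 \<le> t" "b \<in> A"
      using ij by (auto simp: T_def)
    \<comment> \<open>Convexity of \<open>A\<close> enters here: a combination with nonnegative
      weights is \<open>s + t\<close> times one point of \<open>A\<close>. If both weights vanish,
      any point will do.\<close>
    obtain c where c: "c \<in> A" "s *\<^sub>R a + t *\<^sub>R b = (s + t) *\<^sub>R c"
    proof (cases "s + t = 0")
      case True
      then have "s = 0" "t = 0" using st by auto
      then show ?thesis using that[OF a0] by simp
    next
      case False
      then have st': "0 < s + t" using st by simp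
      have "(s / (s + t)) *\<^sub>R a + (t / (s + t)) *\<^sub>R b \<in> A"
        by (rule convexD[OF A(2)]) (use st st' in \<open>auto simp: add_divide_distrib[symmetric]\<close>)
      then show ?thesis using that st' by (auto simp: scaleR_add_right)
    qed
    have "u + v + (s + t) *\<^sub>R c = (u + s *\<^sub>R a) + (v + t *\<^sub>R b)" using c(2) by (simp add: algebra_simps)
    then have "norm (u + v + (s + t) *\<^sub>R c) \<le> norm (u + s *\<^sub>R a) + norm (v + t *\<^sub>R b)"
      by (simp only: norm_triangle_ineq)
    then show "\<exists>k\<in>T. (case k of (t, a) \<Rightarrow> norm (u + v + t *\<^sub>R a) - t * d) \<le>
        (case i of (t, a) \<Rightarrow> norm (u + t *\<^sub>R a) - t * d) + (case j of (t, a) \<Rightarrow> norm (v + t *\<^sub>R a) - t * d)"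
      using st c(1) by (intro bexI[of _ "(s + t, c)"]) (auto simp: T_def algebra_simps)
  next
    fix i c y assume i: "i \<in> T" and c: "0 < (c::real)"
    obtain t a where ta: "i = (t, a)" "0 \<le> t" "a \<in> A" using i by (auto simp: T_def)
    have "c *\<^sub>R y + (c * t) *\<^sub>R a = c *\<^sub>R (y + t *\<^sub>R a)" by (simp add: algebra_simps)
    then have "norm (c *\<^sub>R y + (c * t) *\<^sub>R a) = c * norm (y + t *\<^sub>R a)" using c by simp
    then show "\<exists>k\<in>T. (case k of (t, a) \<Rightarrow> norm (c *\<^sub>R y + t *\<^sub>R a) - t * d) \<le>
        c * (case i of (t, a) \<Rightarrow> norm (y + t *\<^sub>R a) - t * d)"
      using ta c by (intro bexI[of _ "(c * t, a)"]) (auto simp: T_def algebra_simps)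
  qed
  obtain q where q: "sublinear q" "q \<le> p" and min: "\<And>r. sublinear r \<Longrightarrow> r \<le> q \<Longrightarrow> r = q"
    using minimal_sublinear_exists[OF p] by blast
  have lin: "linear q" by (rule minimal_sublinear_linear[OF q(1) min])
  have qn: "q y \<le> norm y" for y using le_funD[OF q(2), of y] le[of 0 a0 y] a0 by simp
  have qa: "\<bar>q y\<bar> \<le> norm y" for y using qn[of y] qn[of "-y"] linear_neg[OF lin, of y] by simp
  have bl: "bounded_linear q"
    using lin qa by (intro bounded_linear_intro[of _ 1]) (auto simp: linear_add linear_scale)
  have fq: "blinfun_apply (Blinfun q) = q" by (rule bounded_linear_Blinfun_apply[OF bl])
  show thesis
  proof (rule that[of "Blinfun q"])
    show "norm (Blinfun q) \<le> 1" by (rule norm_blinfun_bound) (use qa in \<open>auto simp: fq\<close>)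
    fix b assume "b \<in> B"
    then have a: "x - b \<in> A" by (auto simp: A_def)
    \<comment> \<open>With weight \<open>1\<close> and the point \<open>x - b\<close> itself, the
      norm in the infimum vanishes and only \<open>- d\<close> remains.\<close>
    have "q (-(x - b)) \<le> - d" using le_funD[OF q(2), of "-(x-b)"] le[of 1 "x-b" "-(x-b)"] a by simp
    then have "d \<le> q (x - b)" using linear_neg[OF lin, of "x-b"] by simp
    then show "infdist x B \<le> Blinfun q x - Blinfun q b" by (simp add: fq d_def linear_diff[OF lin])
  qed
qed

subsection \<open>Radstrom's embedding\<close>

lemma bdd_above_blinfun:
  fixes f :: "'a::real_normed_vector \<Rightarrow>\<^sub>L real"
  assumes "bounded C" shows "bdd_above (blinfun_apply f ` C)"
  by (rule bounded_imp_bdd_above[OF bounded_linear_image[OF assms blinfun.bounded_linear_right]])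

lemma support_fun_upper: "bounded C \<Longrightarrow> x \<in> C \<Longrightarrow> blinfun_apply f x \<le> support_fun f C"
  unfolding support_fun_def by (rule cSUP_upper[OF _ bdd_above_blinfun])

lemma support_fun_least: "C \<noteq> {} \<Longrightarrow> (\<And>x. x \<in> C \<Longrightarrow> blinfun_apply f x \<le> b) \<Longrightarrow> support_fun f C \<le> b"
  unfolding support_fun_def by (rule cSUP_least)

lemma support_fun_scaleR_left:
  assumes "C \<noteq> {}" "bounded C" "0 \<le> c"
  shows "support_fun (c *\<^sub>R f) C = c * support_fun f C"
proof (rule antisym)
  show "support_fun (c *\<^sub>R f) C \<le> c * support_fun f C"
    by (rule support_fun_least) (use assms in \<open>auto simp: blinfun.scaleR_left intro!: mult_left_mono support_fun_upper\<close>)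
  show "c * support_fun f C \<le> support_fun (c *\<^sub>R f) C"
  proof (cases "c = 0")
    case True
    then show ?thesis using assms(1) by (auto simp: support_fun_def)
  next
    case False
    then have c: "0 < c" using assms by simp
    have "support_fun f C \<le> support_fun (c *\<^sub>R f) C / c"
    proof (rule support_fun_least[OF assms(1)])
      fix x assume "x \<in> C"
      from support_fun_upper[OF assms(2) this, of "c *\<^sub>R f"] c
      show "blinfun_apply f x \<le> support_fun (c *\<^sub>R f) C / c" by (simp add: blinfun.scaleR_left field_simps)
    qed
    then show ?thesis using c by (simp add: field_simps)
  qed
qed

lemma support_fun_lipschitz:
  assumes "C \<noteq> {}" "\<And>x. x \<in> C \<Longrightarrow> norm x \<le> R"
  shows "\<bar>support_fun f C - support_fun g C\<bar> \<le> norm (f - g) * R"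
proof -
  have bC: "bounded C" using assms(2) by (auto simp: bounded_iff)
  have *: "support_fun f C \<le> support_fun g C + norm (f - g) * R" for f g
  proof (rule support_fun_least[OF assms(1)])
    fix x assume x: "x \<in> C"
    have "blinfun_apply (f - g) x \<le> norm (f - g) * norm x"
      using norm_blinfun[of "f - g" x] by simp
    also have "\<dots> \<le> norm (f - g) * R" using assms(2)[OF x] by (simp add: mult_left_mono)
    finally show "blinfun_apply f x \<le> support_fun g C + norm (f - g) * R"
      using support_fun_upper[OF bC x, of g] by (simp add: blinfun.diff_left)
  qed
  show ?thesis using *[of f g] *[of g f] by (simp add: norm_minus_commute)
qed

text \<open>The radial retraction of the dual onto its closed unit ball. It divides by a positive
  number, so positive homogeneity of support functions recovers their values on the whole
  dual.\<close>

definition dual_clip :: "('a::real_normed_vector \<Rightarrow>\<^sub>L real) \<Rightarrow> ('a \<Rightarrow>\<^sub>L real)" where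
  "dual_clip f = inverse (max 1 (norm f)) *\<^sub>R f"

lemma norm_dual_clip: "norm (dual_clip f) \<le> 1"
  by (simp add: dual_clip_def field_simps)

lemma dual_clip_id: "norm f \<le> 1 \<Longrightarrow> dual_clip f = f"
  by (simp add: dual_clip_def max_def)

lemma scaleR_dual_clip: "max 1 (norm f) *\<^sub>R dual_clip f = f"
  by (simp add: dual_clip_def)

lemma continuous_dual_clip: "continuous_on UNIV dual_clip"
  unfolding dual_clip_def by (intro continuous_intros) auto

text \<open>Clipping the functional makes the support function bounded on the whole dual, so that the target is the Banach space of bounded continuous functions on the dual.\<close>

definition radstrom :: "'a::real_normed_vector set \<Rightarrow> (('a \<Rightarrow>\<^sub>L real) \<Rightarrow>\<^sub>C real)" where
  "radstrom C = Bcontfun (\<lambda>f. support_fun (dual_clip f) C)"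

lemma radstrom_apply:
  assumes "C \<noteq> {}" "bounded C"
  shows "apply_bcontfun (radstrom C) f = support_fun (dual_clip f) C"
proof -
  obtain R where R: "\<And>x. x \<in> C \<Longrightarrow> norm x \<le> R" using assms(2) by (auto simp: bounded_iff)
  have R0: "0 \<le> R" using assms(1) R norm_ge_zero order_trans by blast
  have z: "support_fun 0 C = 0" using assms(1) by (simp add: support_fun_def)
  have "\<bar>support_fun (dual_clip f) C\<bar> \<le> R" for f
    using support_fun_lipschitz[OF assms(1) R, of "dual_clip f" 0] z
      mult_right_mono[OF norm_dual_clip[of f] R0] by simp
  moreover have "R-lipschitz_on UNIV (\<lambda>f. support_fun f C)"
    by (rule lipschitz_onI)
      (use support_fun_lipschitz[OF assms(1) R] R0 in \<open>auto simp: dist_norm mult.commute\<close>)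
  then have "continuous_on UNIV (\<lambda>f. support_fun f C)" by (rule lipschitz_on_continuous_on)
  then have "continuous_on UNIV (\<lambda>f. support_fun (dual_clip f) C)"
    by (rule continuous_on_compose2[OF _ continuous_dual_clip]) simp
  ultimately have "(\<lambda>f. support_fun (dual_clip f) C) \<in> bcontfun"
    by (auto simp: bcontfun_def bounded_iff)
  then show ?thesis unfolding radstrom_def by (simp add: Bcontfun_inverse)
qed

lemma support_fun_eq_radstrom:
  assumes "C \<noteq> {}" "bounded C"
  shows "support_fun f C = max 1 (norm f) * apply_bcontfun (radstrom C) f"
  using support_fun_scaleR_left[OF assms, of "max 1 (norm f)" "dual_clip f"]
  by (simp add: radstrom_apply[OF assms] scaleR_dual_clip)

section \<open>Minkowski operations under the embedding\<close>

lemma bounded_set_plus: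
  fixes A B :: "'a::real_normed_vector set"
  assumes "bounded A" "bounded B" shows "bounded (A + B)"
proof -
  obtain a b where "\<And>x. x \<in> A \<Longrightarrow> norm x \<le> a" "\<And>x. x \<in> B \<Longrightarrow> norm x \<le> b"
    using assms unfolding bounded_iff by blast
  then have "norm x \<le> a + b" if "x \<in> A + B" for x
    using that by (force simp: set_plus_def intro: norm_triangle_le add_mono)
  then show ?thesis by (auto simp: bounded_iff)
qed

text \<open>Closedness is dropped because Minkowski sums may destroy it. This class is stable under
  sums and scalings, and taking a closure leads back to \<open>cb\<close> without changing the
  support function.\<close>

definition nbc :: "'a::real_normed_vector set \<Rightarrow> bool" where
  "nbc C \<longleftrightarrow> C \<noteq> {} \<and> bounded C \<and> convex C"

lemma nbcD: "nbc C \<Longrightarrow> C \<noteq> {}" "nbc C \<Longrightarrow> bounded C" "nbc C \<Longrightarrow> convex C"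
  by (auto simp: nbc_def)

lemma cb_nbc: "C \<in> cb \<Longrightarrow> nbc C" by (auto simp: nbc_def cb_def)

lemma closure_in_cb: "nbc C \<Longrightarrow> closure C \<in> cb"
  by (auto simp: nbc_def cb_def convex_closure)

lemma nbc_plus: "nbc A \<Longrightarrow> nbc B \<Longrightarrow> nbc (A + B)"
  by (auto simp: nbc_def bounded_set_plus convex_set_plus)

lemma nbc_zero: "nbc 0" by (simp add: nbc_def)

lemma nbc_scale: "nbc A \<Longrightarrow> nbc ((\<lambda>x. c *\<^sub>R x) ` A)"
  by (auto simp: nbc_def bounded_scaling convex_scaling)

lemma support_fun_plus:
  assumes "nbc A" "nbc B"
  shows "support_fun f (A + B) = support_fun f A + support_fun f B"
proof (rule antisym)
  note A = nbcD[OF assms(1)] and B = nbcD[OF assms(2)] and AB = nbcD[OF nbc_plus[OF assms]]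
  show "support_fun f (A + B) \<le> support_fun f A + support_fun f B"
    by (rule support_fun_least) (use A B AB in \<open>auto simp: blinfun.add_right intro!: add_mono support_fun_upper elim!: set_plus_elim\<close>)
  have "support_fun f (A + B) - blinfun_apply f b \<ge> support_fun f A" if "b \<in> B" for b
  proof (rule support_fun_least[OF A(1)])
    fix a assume "a \<in> A"
    then have "a + b \<in> A + B" using that by blast
    from support_fun_upper[OF AB(2) this, of f] show "blinfun_apply f a \<le> support_fun f (A + B) - blinfun_apply f b"
      by (simp add: blinfun.add_right)
  qed
  then have "support_fun f B \<le> support_fun f (A + B) - support_fun f A"
    by (intro support_fun_least[OF B(1)]) (simp add: algebra_simps)
  then show "support_fun f A + support_fun f B \<le> support_fun f (A + B)" by simp
qed

lemma support_fun_scale_set: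
  assumes "nbc A" "0 \<le> c"
  shows "support_fun f ((\<lambda>x. c *\<^sub>R x) ` A) = c * support_fun f A"
proof -
  have "support_fun f ((\<lambda>x. c *\<^sub>R x) ` A) = support_fun (c *\<^sub>R f) A"
    by (simp add: support_fun_def image_image blinfun.scaleR_left blinfun.scaleR_right)
  then show ?thesis using support_fun_scaleR_left[OF nbcD(1,2)[OF assms(1)] assms(2)] by simp
qed

lemma radstrom_plus: "nbc A \<Longrightarrow> nbc B \<Longrightarrow> radstrom (A + B) = radstrom A + radstrom B"
  by (rule bcontfun_eqI) (simp add: radstrom_apply nbcD nbc_plus[THEN nbcD(1)] nbc_plus[THEN nbcD(2)] support_fun_plus)

lemma radstrom_zero: "radstrom 0 = 0"
  by (rule bcontfun_eqI) (simp add: radstrom_apply, simp add: support_fun_def)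

lemma radstrom_scale: "nbc A \<Longrightarrow> 0 \<le> c \<Longrightarrow> radstrom ((\<lambda>x. c *\<^sub>R x) ` A) = c *\<^sub>R radstrom A"
  by (rule bcontfun_eqI)
    (simp add: radstrom_apply nbcD nbc_scale[THEN nbcD(1)] nbc_scale[THEN nbcD(2)] support_fun_scale_set)

lemma nbc_sum: "(\<And>i. i \<in> S \<Longrightarrow> nbc (A i)) \<Longrightarrow> nbc (\<Sum>i\<in>S. A i)"
  by (induction S rule: infinite_finite_induct) (auto simp del: set_zero intro: nbc_plus nbc_zero)

lemma radstrom_sum: "(\<And>i. i \<in> S \<Longrightarrow> nbc (A i)) \<Longrightarrow> radstrom (\<Sum>i\<in>S. A i) = (\<Sum>i\<in>S. radstrom (A i))"
  by (induction S rule: infinite_finite_induct)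
    (auto simp del: set_zero simp: radstrom_zero radstrom_plus nbc_sum)

lemma support_fun_closure:
  assumes "nbc A" shows "support_fun f (closure A) = support_fun f A"
proof (rule antisym)
  note A = nbcD[OF assms]
  have "blinfun_apply f x \<le> support_fun f A" if x: "x \<in> closure A" for x
  proof -
    obtain u where "\<forall>n. u n \<in> A" and lim: "u \<longlonglongrightarrow> x" using x unfolding closure_sequential by blast
    then have u: "u n \<in> A" for n by blast
    have "(\<lambda>n. blinfun_apply f (u n)) \<longlonglongrightarrow> blinfun_apply f x"
      by (intro tendsto_intros lim)
    then show ?thesis by (rule LIMSEQ_le_const2) (use support_fun_upper[OF A(2) u] in blast)
  qed
  then show "support_fun f (closure A) \<le> support_fun f A"
    by (intro support_fun_least) (use A in auto)
  show "support_fun f A \<le> support_fun f (closure A)"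
    using A closure_subset[of A] by (intro support_fun_least support_fun_upper) auto
qed

lemma radstrom_closure: "nbc A \<Longrightarrow> radstrom (closure A) = radstrom A"
  by (rule bcontfun_eqI) (simp add: radstrom_apply nbcD cb_nbc[OF closure_in_cb] support_fun_closure)

section \<open>Isometry and closed range of the embedding\<close>

text \<open>The separating functional with the best constant lies in the unit ball, and the support
  functions of \<open>A\<close> and \<open>B\<close> already differ at it by at least the distance
  from \<open>x\<close> to \<open>B\<close>.\<close>

lemma infdist_le_dist_radstrom:
  assumes "nbc A" "nbc B" "x \<in> A"
  shows "infdist x B \<le> dist (radstrom A) (radstrom B)"
proof -
  obtain f where f: "norm f \<le> 1" "\<And>b. b \<in> B \<Longrightarrow> infdist x B \<le> blinfun_apply f x - blinfun_apply f b"
    using separating_functional_infdist[OF nbcD(1)[OF assms(2)] nbcD(3)[OF assms(2)], of x] by blast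
  have "support_fun f B \<le> blinfun_apply f x - infdist x B"
    by (rule support_fun_least[OF nbcD(1)[OF assms(2)]]) (use f(2) in \<open>simp add: algebra_simps\<close>)
  then have "infdist x B \<le> support_fun f A - support_fun f B"
    using support_fun_upper[OF nbcD(2)[OF assms(1)] assms(3), of f] by linarith
  also have "\<dots> \<le> dist (apply_bcontfun (radstrom A) f) (apply_bcontfun (radstrom B) f)"
    using assms by (simp add: radstrom_apply nbcD dual_clip_id[OF f(1)] dist_real_def)
  also have "\<dots> \<le> dist (radstrom A) (radstrom B)" by (rule dist_bounded)
  finally show ?thesis .
qed

text \<open>A functional of norm at most one is 1-Lipschitz, so it cannot see \<open>A\<close>
  further out than \<open>d\<close> beyond \<open>B\<close>.\<close>

lemma support_fun_diff_le:
  assumes "nbc A" "nbc B" "norm f \<le> 1" and d: "\<And>a. a \<in> A \<Longrightarrow> infdist a B \<le> d"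
  shows "support_fun f A - support_fun f B \<le> d"
proof -
  note A = nbcD[OF assms(1)] and B = nbcD[OF assms(2)]
  have "support_fun f A \<le> support_fun f B + d"
  proof (rule support_fun_least[OF A(1)])
    fix a assume a: "a \<in> A"
    have "blinfun_apply f a - support_fun f B \<le> infdist a B"
      unfolding infdist_notempty[OF B(1)]
    proof (rule cINF_greatest[OF B(1)])
      fix b assume b: "b \<in> B"
      have "blinfun_apply f (a - b) \<le> norm f * norm (a - b)" using norm_blinfun[of f "a - b"] by simp
      also have "\<dots> \<le> dist a b" using mult_right_mono[OF assms(3), of "norm (a - b)"] by (simp add: dist_norm)
      finally show "blinfun_apply f a - support_fun f B \<le> dist a b"
        using support_fun_upper[OF B(2) b, of f] by (simp add: blinfun.diff_right)
    qed
    then show "blinfun_apply f a \<le> support_fun f B + d" using d[OF a] by simp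
  qed
  then show ?thesis by simp
qed

text \<open>Hormander's formula: the Hausdorff distance is the supremum over the dual unit ball of
  the differences of the support functions. It also shows that the suprema in
  \<open>hausdorff_dist\<close> are over bounded sets.\<close>

lemma hausdorff_dist_radstrom:
  assumes "nbc A" "nbc B"
  shows "hausdorff_dist A B = dist (radstrom A) (radstrom B)"
proof (rule antisym)
  note A = nbcD[OF assms(1)] and B = nbcD[OF assms(2)]
  show "hausdorff_dist A B \<le> dist (radstrom A) (radstrom B)"
    unfolding hausdorff_dist_def
    using infdist_le_dist_radstrom[OF assms] infdist_le_dist_radstrom[OF assms(2,1)] A(1) B(1)
    by (auto intro!: cSUP_least simp: dist_commute)
  have bdd: "bdd_above ((\<lambda>a. infdist a T) ` S)" if "nbc S" "nbc T" for S T :: "'a set"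
    by (rule bdd_aboveI2) (rule infdist_le_dist_radstrom[OF that])
  have up: "infdist a B \<le> hausdorff_dist A B" if "a \<in> A" for a
    unfolding hausdorff_dist_def using cSUP_upper[OF that bdd[OF assms]] by (rule max.coboundedI1)
  have "infdist b A \<le> hausdorff_dist A B" if "b \<in> B" for b
    unfolding hausdorff_dist_def using cSUP_upper[OF that bdd[OF assms(2,1)]] by (rule max.coboundedI2)
  note up = up this
  have *: "support_fun f A - support_fun f B \<le> hausdorff_dist A B"
      "support_fun f B - support_fun f A \<le> hausdorff_dist A B" if "norm f \<le> 1" for f
    using support_fun_diff_le[OF assms that, of "hausdorff_dist A B"]
      support_fun_diff_le[OF assms(2,1) that, of "hausdorff_dist A B"] up by auto
  show "dist (radstrom A) (radstrom B) \<le> hausdorff_dist A B"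
    by (rule dist_bound)
      (use *[OF norm_dual_clip] assms in \<open>auto simp: dist_real_def radstrom_apply nbcD abs_le_iff\<close>)
qed

text \<open>The limit set is cut out by the limiting support function; a point of it attaining the
  support value in a given direction up to \<open>\<epsilon>\<close> is the limit of nearest points chosen successively
  in a rapidly converging subsequence.\<close>

lemma closed_radstrom_cb: "closed (radstrom ` (cb :: 'a::banach set set))"
  unfolding closed_sequential_limits
proof (intro allI impI, elim conjE)
  fix u :: "nat \<Rightarrow> (('a \<Rightarrow>\<^sub>L real) \<Rightarrow>\<^sub>C real)" and y
  assume "\<forall>n. u n \<in> radstrom ` cb" and lim: "u \<longlonglongrightarrow> y"
  then obtain K where K: "\<And>n. K n \<in> cb" "\<And>n. u n = radstrom (K n)" unfolding image_iff by metis
  note nK = cb_nbc[OF K(1)]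
  define C where "C = {x. \<forall>f. norm f \<le> 1 \<longrightarrow> blinfun_apply f x \<le> apply_bcontfun y f}"
  have app: "(\<lambda>n. apply_bcontfun (u n) f) \<longlonglongrightarrow> apply_bcontfun y f" for f
    using tendsto_uniform_limitI[OF tendsto_bcontfun_uniform_limit[OF lim]] by simp
  have select: "\<exists>x\<in>C. apply_bcontfun y f - e \<le> blinfun_apply f x" if f: "norm f \<le> 1" and e: "0 < e" for f e
  proof -
    have "\<forall>k. \<exists>n. \<forall>m\<ge>n. dist (u m) y < (e / 8) * (1/2) ^ k"
    proof
      fix k
      have "0 < (e / 8) * (1/2) ^ k" using e by simp
      then show "\<exists>n. \<forall>m\<ge>n. dist (u m) y < (e / 8) * (1/2) ^ k" using lim unfolding lim_sequentially by blast
    qed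
    then obtain N where N: "\<And>k m. N k \<le> m \<Longrightarrow> dist (u m) y < (e / 8) * (1/2) ^ k" by metis
    \<comment> \<open>A partial sum of the \<open>N i\<close> is an index at least
      \<open>N k\<close>. That is all the bound needs, so no monotone subsequence has to be
      extracted.\<close>
    define L where "L k = K (\<Sum>i\<le>k. N i)" for k
    have nL: "nbc (L k)" for k by (simp add: L_def nK)
    have dL: "dist (radstrom (L k)) y < (e / 8) * (1/2) ^ k" for k
      unfolding L_def K(2)[symmetric] by (rule N) (simp add: member_le_sum)
    have step: "\<exists>x'\<in>L (Suc k). dist x x' < (e / 4) * (1/2) ^ k" if "x \<in> L k" for x k
    proof -
      have "infdist x (L (Suc k)) \<le> dist (radstrom (L k)) (radstrom (L (Suc k)))"
        by (rule infdist_le_dist_radstrom[OF nL nL that])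
      also have "\<dots> \<le> dist (radstrom (L k)) y + dist (radstrom (L (Suc k))) y" by (rule dist_triangle2)
      also have "\<dots> < (e / 8) * (1/2) ^ k + (e / 8) * (1/2) ^ k"
      proof (rule add_strict_mono[OF dL])
        have "(e / 8) * (1/2) ^ Suc k \<le> (e / 8) * (1/2) ^ k" using e by simp
        with dL[of "Suc k"] show "dist (radstrom (L (Suc k))) y < (e / 8) * (1/2) ^ k" by linarith
      qed
      finally have "infdist x (L (Suc k)) < (e / 4) * (1/2) ^ k" by simp
      then show ?thesis unfolding infdist_notempty[OF nbcD(1)[OF nL]]
        by (subst (asm) cINF_less_iff) (use nbcD(1)[OF nL] in auto)
    qed
    have "support_fun f (L 0) - e / 8 < (SUP x\<in>L 0. blinfun_apply f x)"
      using e by (simp add: support_fun_def)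
    then obtain x0 where x0: "x0 \<in> L 0" "support_fun f (L 0) - e / 8 < blinfun_apply f x0"
      unfolding less_cSUP_iff[OF nbcD(1)[OF nL] bdd_above_blinfun[OF nbcD(2)[OF nL]]] by blast
    obtain x where x: "x 0 = x0" "\<And>k. x k \<in> L k" "\<And>k. dist (x k) (x (Suc k)) < (e / 4) * (1/2) ^ k"
    proof -
      have "\<exists>x. \<forall>k. (x k \<in> L k \<and> (k = 0 \<longrightarrow> x k = x0)) \<and> dist (x k) (x (Suc k)) < (e / 4) * (1/2) ^ k"
      proof (rule dependent_nat_choice)
        show "\<exists>x. x \<in> L 0 \<and> (0 = 0 \<longrightarrow> x = x0)" using x0(1) by blast
      qed (use step in blast)
      then show thesis using that by metis
    qed
    have sm: "summable (\<lambda>k. (e / 4) * (1/2) ^ k)" by (intro summable_mult summable_geometric) simp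
    have "summable (\<lambda>k. norm (x (Suc k) - x k))"
      by (rule summable_comparison_test'[OF sm]) (use x(3) in \<open>simp add: dist_norm norm_minus_commute less_imp_le\<close>)
    then have "summable (\<lambda>k. x (Suc k) - x k)" by (rule summable_norm_cancel)
    then have S: "(\<lambda>n. \<Sum>k<n. x (Suc k) - x k) \<longlonglongrightarrow> (\<Sum>k. x (Suc k) - x k)" by (rule summable_LIMSEQ)
    define z where "z = (\<Sum>k. x (Suc k) - x k) + x0"
    have xz: "x \<longlonglongrightarrow> z"
      using tendsto_add[OF S tendsto_const[of x0]] x(1) by (simp add: sum_lessThan_telescope z_def)
    have zC: "z \<in> C" unfolding C_def
    proof (intro CollectI allI impI)
      fix g :: "'a \<Rightarrow>\<^sub>L real" assume g: "norm g \<le> 1"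
      have "(\<lambda>k. (e / 8) * (1/2) ^ k) \<longlonglongrightarrow> (e / 8) * 0"
        by (intro tendsto_intros LIMSEQ_power_zero) simp
      then have z: "(\<lambda>k. (e / 8) * (1/2) ^ k) \<longlonglongrightarrow> 0" by simp
      have "(\<lambda>k. dist (radstrom (L k)) y) \<longlonglongrightarrow> 0"
        by (rule Lim_null_comparison[OF _ z], intro always_eventually allI)
          (use less_imp_le[OF dL] in simp)
      then have rL: "(\<lambda>k. radstrom (L k)) \<longlonglongrightarrow> y" by (rule tendsto_dist_iff[THEN iffD2])
      have "(\<lambda>k. apply_bcontfun (radstrom (L k)) g) \<longlonglongrightarrow> apply_bcontfun y g"
        using tendsto_uniform_limitI[OF tendsto_bcontfun_uniform_limit[OF rL]] by simp
      moreover have "(\<lambda>k. blinfun_apply g (x k)) \<longlonglongrightarrow> blinfun_apply g z"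
        by (intro tendsto_intros xz)
      moreover have "blinfun_apply g (x k) \<le> apply_bcontfun (radstrom (L k)) g" for k
        using support_fun_upper[OF nbcD(2)[OF nL] x(2)] by (simp add: radstrom_apply nbcD nL dual_clip_id[OF g])
      ultimately show "blinfun_apply g z \<le> apply_bcontfun y g" by (intro LIMSEQ_le) auto
    qed
    have "norm (\<Sum>k. x (Suc k) - x k) \<le> (\<Sum>k. (e / 4) * (1/2) ^ k)"
      by (rule norm_suminf_le[OF _ sm]) (use x(3) in \<open>simp add: dist_norm norm_minus_commute less_imp_le\<close>)
    also have "\<dots> = e / 2" by (subst suminf_mult) (simp_all add: suminf_geometric)
    finally have "norm (z - x0) \<le> e / 2" by (simp add: z_def)
    then have "norm f * norm (x0 - z) \<le> 1 * (e / 2)" using f by (intro mult_mono) (auto simp: norm_minus_commute)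
    then have "blinfun_apply f (x0 - z) \<le> e / 2" using norm_blinfun[of f "x0 - z"] by simp
    moreover have "\<bar>apply_bcontfun (radstrom (L 0)) f - apply_bcontfun y f\<bar> < e / 8"
      using dist_bounded[of "radstrom (L 0)" f y] dL[of 0] by (simp add: dist_real_def)
    then have "apply_bcontfun y f - e / 8 < support_fun f (L 0)"
      by (simp only: radstrom_apply[OF nbcD(1,2)[OF nL]] dual_clip_id[OF f] abs_less_iff, linarith?)
    \<comment> \<open>The losses add up to less than \<open>e\<close>: \<open>e / 8\<close> from
      \<open>y\<close> to \<open>L 0\<close>, \<open>e / 8\<close> from the choice of
      \<open>x0\<close>, and \<open>e / 2\<close> from the displacement between \<open>x0\<close>
      and the limit \<open>z\<close>.\<close>
    ultimately have "apply_bcontfun y f - e \<le> blinfun_apply f z"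
      using x0(2) e unfolding blinfun.diff_right by linarith
    then show ?thesis using zC by blast
  qed
  have Cne: "C \<noteq> {}" using select[of 0 1] by auto
  have "C = (\<Inter>f\<in>{f. norm f \<le> 1}. {x. blinfun_apply f x \<le> apply_bcontfun y f})" by (auto simp: C_def)
  moreover have "closed {x. blinfun_apply f x \<le> apply_bcontfun y f}" for f
    by (intro closed_Collect_le continuous_intros)
  moreover have "convex {x. blinfun_apply f x \<le> apply_bcontfun y f}" for f
    using convex_linear_vimage[OF bounded_linear.linear[OF blinfun.bounded_linear_right[of f]] convex_real_interval(2)[of "apply_bcontfun y f"]]
    by (simp add: vimage_def)
  ultimately have Ccc: "closed C" "convex C" by (auto intro!: closed_INT convex_INT)
  have "norm x \<le> norm y" if "x \<in> C" for x
  proof -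
    \<comment> \<open>Separating \<open>x\<close> from the origin yields a norming functional, so
      the norm of \<open>y\<close> bounds every point of \<open>C\<close>.\<close>
    obtain f :: "'a \<Rightarrow>\<^sub>L real" where f: "norm f \<le> 1" "infdist x {0} \<le> blinfun_apply f x - blinfun_apply f 0"
      using separating_functional_infdist[of "{0}" x] by auto
    then have "norm x \<le> blinfun_apply f x" by (simp add: infdist_def)
    also have "\<dots> \<le> apply_bcontfun y f" using that f(1) by (simp add: C_def)
    also have "\<dots> \<le> norm y" using norm_bounded[of y f] by simp
    finally show ?thesis .
  qed
  then have Ccb: "C \<in> cb" using Cne Ccc by (auto simp: cb_def bounded_iff)
  have nC: "nbc C" by (rule cb_nbc[OF Ccb])
  have "radstrom C = y"
  proof (rule bcontfun_eqI)
    fix f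
    \<comment> \<open>The set \<open>C\<close> only knows \<open>y\<close> on the unit ball.
      Elsewhere \<open>y\<close> is determined because invariance under clipping passes to the
      limit.\<close>
    have yclip: "apply_bcontfun y f = apply_bcontfun y (dual_clip f)"
    proof (rule LIMSEQ_unique[OF app])
      have "apply_bcontfun (u n) f = apply_bcontfun (u n) (dual_clip f)" for n
        by (simp add: K(2) radstrom_apply nbcD[OF nK] dual_clip_id[OF norm_dual_clip])
      then show "(\<lambda>n. apply_bcontfun (u n) f) \<longlonglongrightarrow> apply_bcontfun y (dual_clip f)"
        using app[of "dual_clip f"] by simp
    qed
    have "support_fun (dual_clip f) C \<le> apply_bcontfun y (dual_clip f)"
      by (rule support_fun_least[OF Cne]) (simp add: C_def norm_dual_clip)
    moreover have "apply_bcontfun y (dual_clip f) \<le> support_fun (dual_clip f) C"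
    proof (rule field_le_epsilon)
      fix e :: real assume "0 < e"
      from select[OF norm_dual_clip this] obtain x where "x \<in> C" "apply_bcontfun y (dual_clip f) - e \<le> blinfun_apply (dual_clip f) x"
        by blast
      then show "apply_bcontfun y (dual_clip f) \<le> support_fun (dual_clip f) C + e"
        using support_fun_upper[OF nbcD(2)[OF nC], of x "dual_clip f"] by linarith
    qed
    ultimately show "apply_bcontfun (radstrom C) f = apply_bcontfun y f"
      by (simp add: radstrom_apply nbcD nC yclip)
  qed
  then show "y \<in> radstrom ` cb" using Ccb by blast
qed

subsection \<open>Comparing tags by covering arguments\<close>

definition sym_ball :: "(real \<Rightarrow> real) \<Rightarrow> real \<Rightarrow> real set" where
  "sym_ball \<delta> t = {t - \<delta> t<..<t + \<delta> t}"

text \<open>A \<open>\<delta>\<close> is only required to be positive on the unit interval, while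
  the library asks for a neighbourhood of every real number. The value \<open>UNIV\<close> outside
  is harmless because tags outside do not occur.\<close>

lemma gauge_extend_01:
  assumes "\<And>t. t \<in> {0..1} \<Longrightarrow> 0 < \<delta> t"
  shows "gauge (\<lambda>t. if t \<in> {0..1} then sym_ball \<delta> t else UNIV)"
  using assms by (auto simp: gauge_def sym_ball_def)

lemma fine_extend_01:
  assumes "\<And>t K. (t, K) \<in> p \<Longrightarrow> K \<subseteq> {0..1}" "\<And>t K. (t, K) \<in> p \<Longrightarrow> t \<in> K"
  shows "(\<lambda>t. if t \<in> {0..1} then sym_ball \<delta> t else UNIV) fine p \<longleftrightarrow> sym_ball \<delta> fine p"
proof -
  have "t \<in> {0..1}" if "(t, K) \<in> p" for t K using assms(1,2)[OF that] by blast
  then show ?thesis unfolding fine_def by (intro ball_cong refl) (auto split: prod.splits)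
qed

text \<open>The factor \<open>2\<close> is twice the dimension in the library's version of
  Henstock's lemma. The absolute values stand inside the sum, which later allows arbitrary disjoint
  subfamilies.\<close>

lemma Henstock_lemma_01:
  fixes f :: "real \<Rightarrow> real"
  assumes f: "f integrable_on {0..1}" and pos: "\<And>t. t \<in> {0..1} \<Longrightarrow> 0 < \<delta> t" and c: "0 < c"
    and less: "\<And>p. p tagged_division_of {0..1} \<Longrightarrow> sym_ball \<delta> fine p \<Longrightarrow>
       \<bar>(\<Sum>(t, K)\<in>p. measure lebesgue K * f t) - integral {0..1} f\<bar> < c"
    and p: "p tagged_partial_division_of {0..1}" "sym_ball \<delta> fine p"
  shows "(\<Sum>(t, K)\<in>p. \<bar>measure lebesgue K * f t - integral K f\<bar>) \<le> 2 * c"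
proof -
  let ?\<gamma> = "\<lambda>t. if t \<in> {0..1} then sym_ball \<delta> t else UNIV"
  have fine: "?\<gamma> fine q \<longleftrightarrow> sym_ball \<delta> fine q" if "q tagged_partial_division_of {0..1}" for q
    using tagged_partial_division_ofD(2,3)[OF that] by (rule fine_extend_01[rotated])
  have lb: "measure lborel K = measure lebesgue K"
    if "q tagged_partial_division_of {0..1}" "(t, K) \<in> q" for q t and K :: "real set"
    using tagged_partial_division_ofD(4)[OF that] by auto
  have "(\<Sum>(t, K)\<in>p. norm (measure lborel K *\<^sub>R f t - integral K f)) \<le> 2 * real (DIM(real)) * c"
  proof (rule Henstock_lemma_part2[of f 0 1 c ?\<gamma>])
    show "?\<gamma> fine p" using fine[OF p(1)] p(2) by blast
    fix q assume q: "q tagged_division_of cbox 0 (1::real)" "?\<gamma> fine q"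
    then have q': "q tagged_division_of {0..1}" "q tagged_partial_division_of {0..1}"
      by (auto simp: tagged_division_of_def)
    then have "sym_ball \<delta> fine q" using fine q(2) by blast
    moreover have "(\<Sum>(t, K)\<in>q. measure lborel K *\<^sub>R f t) = (\<Sum>(t, K)\<in>q. measure lebesgue K * f t)"
      by (rule sum.cong[OF refl]) (use lb[OF q'(2)] in auto)
    ultimately show "norm ((\<Sum>(t, K)\<in>q. measure lborel K *\<^sub>R f t) - integral (cbox 0 1) f) < c"
      using less[of q] q'(1) by simp
  qed (use f c gauge_extend_01[of \<delta>, OF pos] p in auto)
  moreover have "(\<Sum>(t, K)\<in>p. norm (measure lborel K *\<^sub>R f t - integral K f)) =
      (\<Sum>(t, K)\<in>p. \<bar>measure lebesgue K * f t - integral K f\<bar>)"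
    by (rule sum.cong[OF refl]) (use lb[OF p(1)] in auto)
  ultimately show ?thesis by simp
qed

text \<open>Vitali's covering lemma turns control of sums over disjoint balls into control of sums
  over arbitrary nonoverlapping intervals in the balls, at the cost of splitting at a level \<open>\<xi>\<close>.\<close>

lemma sum_level_split_le:
  fixes t \<rho> u :: "'i \<Rightarrow> real" and J :: "'i \<Rightarrow> real set"
  assumes F: "finite F" and \<rho>: "\<And>i. i \<in> F \<Longrightarrow> 0 < \<rho> i \<and> \<rho> i \<le> 1"
    and J: "\<And>i. i \<in> F \<Longrightarrow> J i \<in> lmeasurable" "\<And>i. i \<in> F \<Longrightarrow> J i \<subseteq> cball (t i) (\<rho> i)"
    and neg: "pairwise (\<lambda>i j. negligible (J i \<inter> J j)) F"
    and tot: "(\<Sum>i\<in>F. measure lebesgue (J i)) \<le> 1"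
    and u: "\<And>i. i \<in> F \<Longrightarrow> u i \<le> b" and \<xi>: "0 < \<xi>" and b: "0 \<le> b"
    and disj: "\<And>D. D \<subseteq> F \<Longrightarrow> pairwise (\<lambda>i j. disjnt (cball (t i) (\<rho> i)) (cball (t j) (\<rho> j))) D
       \<Longrightarrow> (\<Sum>i\<in>D. u i * \<rho> i) \<le> c"
  shows "(\<Sum>i\<in>F. u i * measure lebesgue (J i)) \<le> \<xi> + 10 * b * c / \<xi>"
proof -
  \<comment> \<open>Indices at or below the level contribute at most \<open>\<xi>\<close> in total
    because the lengths add up to at most one. Only the total length of the remaining intervals has
    to be estimated.\<close>
  define F' where "F' = {i \<in> F. \<xi> < u i}"
  have F': "finite F'" "F' \<subseteq> F" using F by (auto simp: F'_def)
  obtain D where D: "D \<subseteq> F'" "pairwise (\<lambda>i j. disjnt (cball (t i) (\<rho> i)) (cball (t j) (\<rho> j))) D"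
    and cov: "\<And>i. i \<in> F' \<Longrightarrow> \<exists>j. j \<in> D \<and> \<not> disjnt (cball (t i) (\<rho> i)) (cball (t j) (\<rho> j)) \<and>
                        cball (t i) (\<rho> i) \<subseteq> ball (t j) (5 * \<rho> j)"
  proof (rule Vitali_covering_lemma_cballs_balls[of F' \<rho> 1 t])
    show "0 < \<rho> i \<and> \<rho> i \<le> 1" if "i \<in> F'" for i using \<rho> F' that by blast
  qed (rule that; assumption)
  have fD: "finite D" using D(1) F'(1) finite_subset by blast
  have "(\<Sum>i\<in>F'. measure lebesgue (J i)) = measure lebesgue (\<Union>(J ` F'))"
    by (rule measure_negligible_finite_Union_image[symmetric])
      (use F' J pairwise_subset[OF neg] in auto)
  also have "\<dots> \<le> measure lebesgue (\<Union>j\<in>D. ball (t j) (5 * \<rho> j))"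
  proof (rule measure_mono_fmeasurable)
    show "\<Union>(J ` F') \<subseteq> (\<Union>j\<in>D. ball (t j) (5 * \<rho> j))"
      using cov J(2) F'(2) by blast
    show "\<Union>(J ` F') \<in> sets lebesgue" using F' J by (intro sets.finite_UN) auto
    show "(\<Union>j\<in>D. ball (t j) (5 * \<rho> j)) \<in> lmeasurable" using fD by (intro fmeasurable.finite_UN) auto
  qed
  also have "\<dots> \<le> (\<Sum>j\<in>D. measure lebesgue (ball (t j) (5 * \<rho> j)))"
    by (rule measure_UNION_le[OF fD]) auto
  \<comment> \<open>Vitali enlarges radii by the factor 5, hence lengths
    \<open>10 * \<rho> j\<close>.\<close>
  also have "\<dots> = (\<Sum>j\<in>D. 10 * \<rho> j)"
  proof (rule sum.cong[OF refl])
    fix j assume "j \<in> D"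
    then have "0 < \<rho> j" using D F' \<rho> by blast
    then show "measure lebesgue (ball (t j) (5 * \<rho> j)) = 10 * \<rho> j"
      by (simp add: ball_eq_greaterThanLessThan)
  qed
  \<comment> \<open>Chebyshev: every selected index has \<open>\<xi> < u j\<close>.\<close>
  also have "\<dots> \<le> (\<Sum>j\<in>D. 10 / \<xi> * (u j * \<rho> j))"
  proof (rule sum_mono)
    fix j assume j: "j \<in> D"
    then have "0 < \<rho> j" "\<xi> < u j" using D F' \<rho> by (auto simp: F'_def)
    then have "\<xi> * \<rho> j \<le> u j * \<rho> j" by simp
    then show "10 * \<rho> j \<le> 10 / \<xi> * (u j * \<rho> j)" using \<xi> by (simp add: field_simps)
  qed
  also have "\<dots> \<le> 10 / \<xi> * c"
    unfolding sum_distrib_left[symmetric]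
    by (rule mult_left_mono[OF disj]) (use D F' \<xi> in auto)
  finally have m: "(\<Sum>i\<in>F'. measure lebesgue (J i)) \<le> 10 / \<xi> * c" .
  have "(\<Sum>i\<in>F. u i * measure lebesgue (J i)) \<le>
      (\<Sum>i\<in>F. \<xi> * measure lebesgue (J i) + (if i \<in> F' then b * measure lebesgue (J i) else 0))"
  proof (rule sum_mono)
    fix i assume i: "i \<in> F"
    have "u i * measure lebesgue (J i) \<le> \<xi> * measure lebesgue (J i)" if "i \<notin> F'"
      by (rule mult_right_mono) (use that i in \<open>auto simp: F'_def\<close>)
    moreover have "u i * measure lebesgue (J i) \<le> \<xi> * measure lebesgue (J i) + b * measure lebesgue (J i)"
      using mult_right_mono[OF u[OF i], of "measure lebesgue (J i)"] \<xi> by (simp add: add_increasing)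
    ultimately show "u i * measure lebesgue (J i) \<le>
      \<xi> * measure lebesgue (J i) + (if i \<in> F' then b * measure lebesgue (J i) else 0)" by simp
  qed
  also have "\<dots> = \<xi> * (\<Sum>i\<in>F. measure lebesgue (J i)) + b * (\<Sum>i\<in>F'. measure lebesgue (J i))"
    using F F'(2) by (simp add: sum.distrib sum_distrib_left sum.inter_restrict[symmetric] Int_absorb1)
  also have "\<dots> \<le> \<xi> * 1 + b * (10 / \<xi> * c)"
    by (intro add_mono mult_left_mono tot m) (use \<xi> b in auto)
  finally show ?thesis by (simp add: mult_ac)
qed

text \<open>An interval around \<open>t i\<close> that also contains \<open>x i\<close> and is fine for both tags compares the two
  values of \<open>f\<close> through the integral over that interval.\<close>

lemma sum_value_diff_le:
  fixes f \<delta> :: "real \<Rightarrow> real" and t x \<rho> :: "'i \<Rightarrow> real"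
  assumes H: "\<And>p. p tagged_partial_division_of {0..1} \<Longrightarrow> sym_ball \<delta> fine p \<Longrightarrow>
       (\<Sum>(t, K)\<in>p. \<bar>measure lebesgue K * f t - integral K f\<bar>) \<le> c"
    and D: "finite D" "pairwise (\<lambda>i j. disjnt (cball (t i) (\<rho> i)) (cball (t j) (\<rho> j))) D"
    and t: "\<And>i. i \<in> D \<Longrightarrow> t i \<in> {0..1}" and x: "\<And>i. i \<in> D \<Longrightarrow> x i \<in> {0..1} \<inter> cball (t i) (\<rho> i)"
    and \<rho>: "\<And>i. i \<in> D \<Longrightarrow> 0 < \<rho> i \<and> \<rho> i \<le> 1 \<and> \<rho> i < \<delta> (t i) \<and> 2 * \<rho> i < \<delta> (x i)"
  shows "(\<Sum>i\<in>D. \<bar>f (t i) - f (x i)\<bar> * \<rho> i) \<le> 2 * c"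
proof -
  \<comment> \<open>The ball is clipped to the unit interval. Since \<open>t i\<close> lies there
    and the radius is at most one, a length of at least \<open>\<rho> i\<close> survives.\<close>
  define K where "K i = {max 0 (t i - \<rho> i)..min 1 (t i + \<rho> i)}" for i
  have K: "t i \<in> K i" "x i \<in> K i" "K i \<subseteq> {0..1}" "K i \<subseteq> cball (t i) (\<rho> i)" "\<rho> i \<le> measure lebesgue (K i)"
    if "i \<in> D" for i
  proof -
    have "0 \<le> t i" "t i \<le> 1" "0 < \<rho> i" using t[OF that] \<rho>[OF that] by auto
    moreover have "0 \<le> x i" "x i \<le> 1" "t i - \<rho> i \<le> x i" "x i \<le> t i + \<rho> i"
      using x[OF that] by (auto simp: cball_eq_atLeastAtMost)
    ultimately show "t i \<in> K i" "x i \<in> K i" "K i \<subseteq> {0..1}" "K i \<subseteq> cball (t i) (\<rho> i)"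
      by (auto simp: K_def cball_eq_atLeastAtMost)
    define a b where "a = max 0 (t i - \<rho> i)" and "b = min 1 (t i + \<rho> i)"
    have "a + \<rho> i \<le> b"
      using t[OF that] \<rho>[OF that] by (simp add: a_def b_def max_def min_def)
    moreover have "K i = {a..b}" by (simp add: K_def a_def b_def)
    ultimately show "\<rho> i \<le> measure lebesgue (K i)" using \<rho>[OF that] by simp
  qed
  \<comment> \<open>The balls are disjoint, so passing from indices to a set of tagged intervals
    merges nothing.\<close>
  have inj: "inj_on (\<lambda>i. (s i, K i)) D" if s: "\<And>i. i \<in> D \<Longrightarrow> s i \<in> K i" for s
  proof (rule inj_onI)
    fix i j assume ij: "i \<in> D" "j \<in> D" and eq: "(s i, K i) = (s j, K j)"
    have "t i \<in> cball (t i) (\<rho> i)" "t i \<in> cball (t j) (\<rho> j)"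
      using K(1,4)[OF ij(1)] K(4)[OF ij(2)] eq by auto
    then show "i = j" using D(2) ij unfolding pairwise_def disjnt_def by blast
  qed
  have *: "(\<Sum>i\<in>D. \<bar>measure lebesgue (K i) * f (s i) - integral (K i) f\<bar>) \<le> c"
    if s: "\<And>i. i \<in> D \<Longrightarrow> s i \<in> K i" and fs: "\<And>i. i \<in> D \<Longrightarrow> K i \<subseteq> sym_ball \<delta> (s i)" for s
  proof -
    let ?p = "(\<lambda>i. (s i, K i)) ` D"
    have "?p tagged_partial_division_of {0..1}"
      unfolding tagged_partial_division_of_def
    proof (intro conjI allI impI)
      fix y1 K1 y2 K2 assume "(y1, K1) \<in> ?p \<and> (y2, K2) \<in> ?p \<and> (y1, K1) \<noteq> (y2, K2)"
      then obtain i j where ij: "i \<in> D" "j \<in> D" "i \<noteq> j" "K1 = K i" "K2 = K j" by auto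
      then have "K i \<inter> K j = {}" using D(2) K(4)[OF ij(1)] K(4)[OF ij(2)] unfolding pairwise_def disjnt_def by blast
      then show "interior K1 \<inter> interior K2 = {}" using ij interior_subset by blast
    qed (use D(1) s K(3) in \<open>auto simp: K_def\<close>)
    moreover have "sym_ball \<delta> fine ?p" using fs by (auto simp: fine_def)
    ultimately have "(\<Sum>(t, K)\<in>?p. \<bar>measure lebesgue K * f t - integral K f\<bar>) \<le> c" by (rule H)
    then show ?thesis by (simp add: sum.reindex[OF inj[OF s]])
  qed
  have "(\<Sum>i\<in>D. \<bar>f (t i) - f (x i)\<bar> * \<rho> i) \<le>
      (\<Sum>i\<in>D. \<bar>measure lebesgue (K i) * f (t i) - integral (K i) f\<bar> + \<bar>measure lebesgue (K i) * f (x i) - integral (K i) f\<bar>)"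
  proof (rule sum_mono)
    fix i assume i: "i \<in> D"
    have "\<bar>f (t i) - f (x i)\<bar> * \<rho> i \<le> \<bar>f (t i) - f (x i)\<bar> * measure lebesgue (K i)"
      using K(5)[OF i] by (simp add: mult_left_mono)
    also have "\<dots> = \<bar>measure lebesgue (K i) * f (t i) - measure lebesgue (K i) * f (x i)\<bar>"
      unfolding right_diff_distrib[symmetric] abs_mult by simp
    finally show "\<bar>f (t i) - f (x i)\<bar> * \<rho> i \<le> \<bar>measure lebesgue (K i) * f (t i) - integral (K i) f\<bar> + \<bar>measure lebesgue (K i) * f (x i) - integral (K i) f\<bar>"
      by linarith
  qed
  also have "\<dots> \<le> c + c"
    unfolding sum.distrib
  proof (intro add_mono *)
    fix i assume i: "i \<in> D"
    show "K i \<subseteq> sym_ball \<delta> (t i)" using K(4)[OF i] \<rho>[OF i] by (auto simp: sym_ball_def cball_eq_atLeastAtMost)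
    \<comment> \<open>Two points of a ball of radius \<open>\<rho> i\<close> are at most
      \<open>2 * \<rho> i\<close> apart; this is the origin of the condition
      \<open>2 * \<rho> i < \<delta> (x i)\<close>.\<close>
    show "K i \<subseteq> sym_ball \<delta> (x i)" using K(4)[OF i] \<rho>[OF i] x[OF i] by (auto simp: sym_ball_def cball_eq_atLeastAtMost)
  qed (use K in auto)
  finally show ?thesis by simp
qed

section \<open>Almost disjoint families and measurable hulls\<close>

text \<open>A common point of two nonoverlapping intervals lies on the frontier of one of them.
  Indices rather than intervals are compared, so equal one-point intervals with different tags are
  covered.\<close>

lemma AE_nonoverlap:
  fixes J :: "'i \<Rightarrow> real set"
  assumes F: "finite F" and J: "\<And>i. i \<in> F \<Longrightarrow> \<exists>a b. J i = {a..b}"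
    and dis: "\<And>i j. i \<in> F \<Longrightarrow> j \<in> F \<Longrightarrow> i \<noteq> j \<Longrightarrow> interior (J i) \<inter> interior (J j) = {}"
  shows "AE x in lebesgue. \<forall>i\<in>F. \<forall>j\<in>F. x \<in> J i \<longrightarrow> x \<in> J j \<longrightarrow> i = j"
proof -
  have cl: "negligible (frontier (J i))" if "i \<in> F" for i
  proof -
    obtain a b where "J i = cbox a b" using J[OF \<open>i \<in> F\<close>] by (auto simp: cbox_interval)
    then show "negligible (frontier (J i))" by (simp only: negligible_convex_frontier convex_box)
  qed
  have "negligible (\<Union>i\<in>F. frontier (J i))" using F cl by (intro negligible_Union) auto
  then have N: "(\<Union>i\<in>F. frontier (J i)) \<in> null_sets lebesgue" by (simp add: negligible_iff_null_sets)
  have "x \<in> (\<Union>i\<in>F. frontier (J i))" if x: "i \<in> F" "j \<in> F" "x \<in> J i" "x \<in> J j" "i \<noteq> j" for x i j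
  proof -
    have "x \<notin> interior (J i) \<or> x \<notin> interior (J j)" using dis[OF x(1,2,5)] by blast
    moreover have "x \<in> closure (J i)" "x \<in> closure (J j)" using x(3,4) closure_subset by blast+
    ultimately show ?thesis using x(1,2) unfolding frontier_def by blast
  qed
  then show ?thesis by (intro AE_I'[OF N]) blast
qed

lemma set_integral_finite_UN_AE_disjoint:
  fixes f :: "'a \<Rightarrow> real"
  assumes F: "finite F" and ae: "AE x in M. \<forall>i\<in>F. \<forall>j\<in>F. x \<in> A i \<longrightarrow> x \<in> A j \<longrightarrow> i = j"
    and A: "\<And>i. i \<in> F \<Longrightarrow> A i \<in> sets M" and f: "\<And>i. i \<in> F \<Longrightarrow> set_integrable M (A i) f"
  shows "(LINT x:(\<Union>i\<in>F. A i)|M. f x) = (\<Sum>i\<in>F. LINT x:A i|M. f x)"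
  using assms
proof (induction F rule: finite_induct)
  case empty
  then show ?case by (simp add: set_lebesgue_integral_def)
next
  case (insert i F)
  have "(LINT x:(A i \<union> (\<Union>i\<in>F. A i))|M. f x) = (LINT x:A i|M. f x) + (LINT x:(\<Union>i\<in>F. A i)|M. f x)"
  proof (rule set_integral_Un_AE)
    show "AE x in M. \<not> (x \<in> A i \<and> x \<in> (\<Union>i\<in>F. A i))"
      using insert.prems(1) by eventually_elim (use insert.hyps in auto)
    show "(\<Union>i\<in>F. A i) \<in> sets M" using insert by (intro sets.finite_UN) auto
    show "set_integrable M (\<Union>i\<in>F. A i) f" using insert by (intro set_integrable_UN) auto
  qed (use insert in auto)
  moreover have "(LINT x:(\<Union>i\<in>F. A i)|M. f x) = (\<Sum>i\<in>F. LINT x:A i|M. f x)"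
  proof (rule insert.IH)
    show "AE x in M. \<forall>i\<in>F. \<forall>j\<in>F. x \<in> A i \<longrightarrow> x \<in> A j \<longrightarrow> i = j"
      using insert.prems(1) by eventually_elim auto
  qed (use insert in auto)
  ultimately show ?case using insert by simp
qed

text \<open>The sets where \<open>\<delta>\<close> exceeds \<open>1 / (m + 1)\<close> exhaust
  \<open>C\<close> but need not be measurable, so continuity from above is applied to hulls instead.
  The last conclusion expresses that \<open>H\<close> is a hull: a measurable part of it that avoids
  the thick set is null. Everything depends on \<open>C\<close>, \<open>\<delta>\<close> and
  \<open>\<eta>\<close> alone, not on any integrand.\<close>

lemma thick_piece:
  fixes C :: "real set" and \<delta> :: "real \<Rightarrow> real"
  assumes C: "C \<subseteq> {0..1}" and pos: "\<And>t. t \<in> C \<Longrightarrow> 0 < \<delta> t" and \<eta>: "0 < \<eta>"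
  obtains r H G where "0 < r" "H \<in> sets lebesgue" "H \<subseteq> {0..1}" "open G" "C \<subseteq> G" "G \<subseteq> {-1<..<2}"
    "measure lebesgue (G - H) < \<eta>"
    "\<And>N. N \<in> sets lebesgue \<Longrightarrow> N \<subseteq> H \<Longrightarrow> N \<inter> {t \<in> C. r < \<delta> t} = {} \<Longrightarrow> N \<in> null_sets lebesgue"
proof -
  define S where "S m = {t \<in> C. 1 / real (Suc m) < \<delta> t}" for m
  have Smono: "S m \<subseteq> S n" if "m \<le> n" for m n
  proof -
    have *: "1 / real (Suc n) \<le> 1 / real (Suc m)" using that by (simp add: field_simps)
    show ?thesis
    proof
      fix t assume "t \<in> S m"
      then have "t \<in> C" "1 / real (Suc m) < \<delta> t" unfolding S_def by blast+
      then show "t \<in> S n" unfolding S_def using le_less_trans[OF *] by blast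
    qed
  qed
  have SC: "C \<subseteq> (\<Union>m. S m)"
  proof
    fix t assume t: "t \<in> C"
    from reals_Archimedean[OF pos[OF t]] obtain m where "inverse (real (Suc m)) < \<delta> t" by blast
    then show "t \<in> (\<Union>m. S m)" using t by (auto simp: S_def inverse_eq_divide)
  qed
  have "\<exists>E. measurable_envelope lebesgue (S m) E \<and> E \<subseteq> {0..1}" for m
    using measurable_envelopeI_countable_cover[of "S m" "\<lambda>_. {0..1::real}" lebesgue] C
    by (auto simp: S_def)
  then obtain E where E: "\<And>m. measurable_envelope lebesgue (S m) (E m)" "\<And>m. E m \<subseteq> {0..1}" by metis
  \<comment> \<open>Envelopes of an increasing sequence need not increase. Intersecting all later
    ones restores monotonicity and still contains \<open>S m\<close>.\<close>
  define H where "H m = (\<Inter>j\<in>{m..}. E j)" for m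
  have Hs: "H m \<in> sets lebesgue" for m
    unfolding H_def using measurable_envelopeD(2)[OF E(1)] by (intro sets.countable_INT) auto
  have H01: "H m \<subseteq> {0..1}" for m using E(2)[of m] by (auto simp: H_def)
  have SH: "S m \<subseteq> H m" for m using measurable_envelopeD(1)[OF E(1)] Smono by (fastforce simp: H_def)
  define U where "U = (\<Union>m. H m)"
  have U: "U \<in> sets lebesgue" "U \<subseteq> {0..1}"
    unfolding U_def using Hs H01 by auto
  have "(\<Union>m. S m) \<subseteq> U" unfolding U_def using SH by (rule UN_mono[OF order_refl])
  with SC have CU: "C \<subseteq> U" by (rule order_trans)
  obtain G0 where G0: "open G0" "U \<subseteq> G0" "G0 - U \<in> lmeasurable" "emeasure lebesgue (G0 - U) < ennreal (\<eta> / 2)"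
    using sets_lebesgue_outer_open[OF U(1), of "\<eta>/2"] \<eta> by auto
  have "(\<lambda>m. measure lebesgue (U - H m)) \<longlonglongrightarrow> measure lebesgue (\<Inter>m. U - H m)"
  proof (rule Lim_measure_decseq)
    show "range (\<lambda>m. U - H m) \<subseteq> sets lebesgue" using U(1) Hs by auto
    show "decseq (\<lambda>m. U - H m)" by (rule decseq_SucI) (auto simp: H_def)
    show "emeasure lebesgue (U - H m) \<noteq> \<infinity>" for m
    proof -
      have "U - H m \<subseteq> {0..1}" using U(2) by blast
      from emeasure_mono[OF this, of lebesgue] show ?thesis by (auto simp: top_unique)
    qed
  qed
  moreover have "(\<Inter>m. U - H m) = {}" by (auto simp: U_def)
  ultimately have "(\<lambda>m. measure lebesgue (U - H m)) \<longlonglongrightarrow> 0"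
    by (simp only: measure_empty)
  then obtain m where m: "measure lebesgue (U - H m) < \<eta> / 2"
    using \<eta> by (fastforce simp: lim_sequentially dist_real_def dest: spec[of _ "\<eta>/2"])
  have UH: "U - H m \<in> lmeasurable"
    using U Hs bounded_subset[of "{0..1::real}" "U - H m"] by (intro bounded_set_imp_lmeasurable) auto
  \<comment> \<open>Half of \<open>\<eta>\<close> pays for the open superset \<open>G0\<close> and
    half for stopping at stage \<open>m\<close>. Cutting with \<open>{-1<..<2}\<close> makes the
    neighbourhood bounded.\<close>
  show thesis
  proof (rule that[of "1 / real (Suc m)" "H m" "G0 \<inter> {-1<..<2}"])
    show "C \<subseteq> G0 \<inter> {- 1<..<2}" using C CU G0(2) by fastforce
    have "measure lebesgue (G0 \<inter> {-1<..<2} - H m) \<le> measure lebesgue ((G0 - U) \<union> (U - H m))"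
      by (rule measure_mono_fmeasurable) (use G0 UH Hs in \<open>auto intro: fmeasurable.Un\<close>)
    also have "\<dots> \<le> measure lebesgue (G0 - U) + measure lebesgue (U - H m)"
      by (rule measure_Un_le) (use G0 UH in auto)
    also have "\<dots> < \<eta>"
      using m G0(3,4) emeasure_eq_measure2[OF G0(3)] \<eta> by (simp add: ennreal_less_iff)
    finally show "measure lebesgue (G0 \<inter> {-1<..<2} - H m) < \<eta>" .
    fix N assume N: "N \<in> sets lebesgue" "N \<subseteq> H m" "N \<inter> {t \<in> C. 1 / real (Suc m) < \<delta> t} = {}"
    then have "N \<subseteq> E m - S m" by (auto simp: H_def S_def)
    then show "N \<in> null_sets lebesgue" using measurable_envelopeD1[OF E(1) N(1)] N(1) by auto
  qed (use G0 Hs H01 in auto)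
qed

text \<open>Almost every point of the hull \<open>H\<close> of \<open>A = {t \<in> C. r < \<delta> t}\<close> carries a value of \<open>f\<close> that is bounded
  by the values on \<open>A\<close>, so the tag \<open>t i\<close> may be compared with tags from \<open>A\<close> only.\<close>

lemma sum_integral_diff_hull_le:
  fixes f \<delta> :: "real \<Rightarrow> real" and t \<rho> :: "'i \<Rightarrow> real" and J :: "'i \<Rightarrow> real set"
  assumes f: "set_integrable lebesgue {0..1} f"
    and H: "\<And>p. p tagged_partial_division_of {0..1} \<Longrightarrow> sym_ball \<delta> fine p \<Longrightarrow>
       (\<Sum>(t, K)\<in>p. \<bar>measure lebesgue K * f t - integral K f\<bar>) \<le> c"
    and F: "finite F" and C: "C \<subseteq> {0..1}" and t: "\<And>i. i \<in> F \<Longrightarrow> t i \<in> C"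
    and bf: "\<And>y. y \<in> C \<Longrightarrow> \<bar>f y\<bar> \<le> b" and b: "0 \<le> b" and \<xi>: "0 < \<xi>"
    and \<rho>: "\<And>i. i \<in> F \<Longrightarrow> 0 < \<rho> i \<and> \<rho> i \<le> 1 \<and> \<rho> i < \<delta> (t i) \<and> 2 * \<rho> i \<le> r"
    and J: "\<And>i. i \<in> F \<Longrightarrow> J i \<subseteq> {0..1} \<inter> cball (t i) (\<rho> i)" "\<And>i. i \<in> F \<Longrightarrow> \<exists>a b. J i = {a..b}"
    and neg: "pairwise (\<lambda>i j. negligible (J i \<inter> J j)) F"
    and tot: "(\<Sum>i\<in>F. measure lebesgue (J i)) \<le> 1"
    and Hh: "Hh \<in> sets lebesgue"
    and null: "\<And>N. N \<in> sets lebesgue \<Longrightarrow> N \<subseteq> Hh \<Longrightarrow> N \<inter> {t \<in> C. r < \<delta> t} = {} \<Longrightarrow> N \<in> null_sets lebesgue"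
  shows "(\<Sum>i\<in>F. LINT y:J i \<inter> Hh|lebesgue. \<bar>f (t i) - f y\<bar>) \<le> \<xi> + 40 * b * c / \<xi>"
proof (rule field_le_epsilon)
  fix \<kappa> :: real assume \<kappa>: "0 < \<kappa>"
  define A where "A = {t \<in> C. r < \<delta> t}"
  \<comment> \<open>An interval that misses \<open>A\<close> meets the hull in a null set only, so
    it contributes nothing.\<close>
  define F' where "F' = {i \<in> F. J i \<inter> A \<noteq> {}}"
  have F': "finite F'" "F' \<subseteq> F" using F by (auto simp: F'_def)
  have Jm: "J i \<in> lmeasurable" if "i \<in> F" for i using J(2)[OF that] by auto
  \<comment> \<open>The supremum over \<open>J i \<inter> A\<close> need not be attained;
    \<open>\<kappa>\<close> is the slack. The chosen tag may depend on the coordinate because only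
    the final bound has to be uniform.\<close>
  have "\<exists>x. x \<in> J i \<inter> A \<and> (\<forall>y\<in>J i \<inter> A. \<bar>f (t i) - f y\<bar> \<le> \<bar>f (t i) - f x\<bar> + \<kappa>)" if i: "i \<in> F'" for i
  proof -
    let ?S = "(\<lambda>y. \<bar>f (t i) - f y\<bar>) ` (J i \<inter> A)"
    have ne: "J i \<inter> A \<noteq> {}" using i by (simp add: F'_def)
    have bdd: "bdd_above ?S"
    proof (rule bdd_aboveI2)
      fix y assume "y \<in> J i \<inter> A"
      then show "\<bar>f (t i) - f y\<bar> \<le> 2 * b"
        using bf[of y] bf[OF t, of i] i F'(2) by (auto simp: A_def)
    qed
    have "Sup ?S - \<kappa> < Sup ?S" using \<kappa> by simp
    then obtain x where x: "x \<in> J i \<inter> A" "Sup ?S - \<kappa> < \<bar>f (t i) - f x\<bar>"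
      using less_cSUP_iff[OF ne bdd] by blast
    then show ?thesis using cSUP_upper[OF _ bdd] by (smt (verit))
  qed
  then obtain x where x: "\<And>i. i \<in> F' \<Longrightarrow> x i \<in> J i \<inter> A"
    "\<And>i y. i \<in> F' \<Longrightarrow> y \<in> J i \<inter> A \<Longrightarrow> \<bar>f (t i) - f y\<bar> \<le> \<bar>f (t i) - f (x i)\<bar> + \<kappa>"
    by metis
  define u where "u i = \<bar>f (t i) - f (x i)\<bar>" for i
  have totF': "(\<Sum>i\<in>F'. measure lebesgue (J i)) \<le> 1"
    using sum_mono2[OF F F'(2), of "\<lambda>i. measure lebesgue (J i)"] tot by simp
  \<comment> \<open>The \<open>2 * b\<close> bounds a difference of two values and the
    \<open>2 * c\<close> comes from using Henstock's lemma with both tags. Together with the Vitali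
    constant 10 this makes 40.\<close>
  have main: "(\<Sum>i\<in>F'. u i * measure lebesgue (J i)) \<le> \<xi> + 10 * (2 * b) * (2 * c) / \<xi>"
  proof (rule sum_level_split_le[where \<rho> = \<rho> and t = t])
    show "u i \<le> 2 * b" if "i \<in> F'" for i
      using bf[of "x i"] bf[OF t, of i] that F'(2) x(1)[OF that] by (auto simp: u_def A_def)
    show "(\<Sum>i\<in>D. u i * \<rho> i) \<le> 2 * c"
      if D: "D \<subseteq> F'" "pairwise (\<lambda>i j. disjnt (cball (t i) (\<rho> i)) (cball (t j) (\<rho> j))) D" for D
      unfolding u_def
    proof (rule sum_value_diff_le[OF H _ D(2)])
      show "finite D" using D(1) F'(1) finite_subset by blast
      fix i assume "i \<in> D"
      then have i: "i \<in> F'" "i \<in> F" using D(1) F'(2) by auto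
      show "t i \<in> {0..1}" using t[OF i(2)] C by blast
      show "x i \<in> {0..1} \<inter> cball (t i) (\<rho> i)" using x(1)[OF i(1)] J(1)[OF i(2)] by blast
      have "r < \<delta> (x i)" using x(1)[OF i(1)] by (simp add: A_def)
      then show "0 < \<rho> i \<and> \<rho> i \<le> 1 \<and> \<rho> i < \<delta> (t i) \<and> 2 * \<rho> i < \<delta> (x i)" using \<rho>[OF i(2)] by simp
    qed
    show "pairwise (\<lambda>i j. negligible (J i \<inter> J j)) F'" using neg F'(2) by (rule pairwise_subset)
    show "J i \<subseteq> cball (t i) (\<rho> i)" if "i \<in> F'" for i using J(1)[of i] F'(2) that by blast
  qed (use F' \<rho> Jm totF' b \<xi> in auto)
  define v where "v i = (if i \<in> F' then u i + \<kappa> else 0)" for i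
  have v0: "0 \<le> v i" for i using \<kappa> by (simp add: v_def u_def)
  have f': "(\<lambda>y. indicat_real {0..1} y * f y) \<in> borel_measurable lebesgue"
    using f unfolding set_integrable_def by (simp add: borel_measurable_integrable)
  have le: "(LINT y:J i \<inter> Hh|lebesgue. \<bar>f (t i) - f y\<bar>) \<le> v i * measure lebesgue (J i)" if i: "i \<in> F" for i
  proof -
    let ?B = "J i \<inter> Hh"
    have Bs: "?B \<in> sets lebesgue" using Jm[OF i] Hh by auto
    have Bm: "?B \<in> lmeasurable" using Jm[OF i] Hh by (metis fmeasurable_Int_fmeasurable)
    have intB: "set_integrable lebesgue ?B f"
      by (rule set_integrable_subset[OF f Bs]) (use J(1)[OF i] in blast)
    have intc: "set_integrable lebesgue ?B (\<lambda>_. a)" for a :: real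
      unfolding set_integrable_def using Bm by (auto intro!: integrable_mult_left simp: fmeasurable_def)
    \<comment> \<open>The exceptional points of the hull. They form a measurable set that avoids
      \<open>A\<close>, hence a null set; the indicator is there because \<open>f\<close> is only
      known to be measurable on the unit interval.\<close>
    define N where "N = {y \<in> ?B. v i < \<bar>f (t i) - indicat_real {0..1} y * f y\<bar>}"
    have "N = ?B \<inter> {y \<in> space lebesgue. v i < \<bar>f (t i) - indicat_real {0..1} y * f y\<bar>}" by (auto simp: N_def)
    moreover have "{y \<in> space lebesgue. v i < \<bar>f (t i) - indicat_real {0..1} y * f y\<bar>} \<in> sets lebesgue"
      using f' by measurable
    ultimately have Ns: "N \<in> sets lebesgue" using Bs by simp
    have "N \<inter> A = {}"
    proof -
      have False if "y \<in> N" "y \<in> A" for y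
      proof -
        have y: "y \<in> J i \<inter> A" "y \<in> {0..1}" using that J(1)[OF i] by (auto simp: N_def)
        then have iF: "i \<in> F'" using i by (auto simp: F'_def)
        have "\<bar>f (t i) - f y\<bar> \<le> v i" using x(2)[OF iF y(1)] iF by (simp add: v_def u_def)
        then show False using that(1) y(2) by (simp add: N_def)
      qed
      then show ?thesis by blast
    qed
    then have Nn: "N \<in> null_sets lebesgue" using null[OF Ns] by (auto simp: A_def N_def)
    have "(LINT y:?B|lebesgue. \<bar>f (t i) - f y\<bar>) \<le> (LINT y:?B|lebesgue. v i)"
      unfolding set_lebesgue_integral_def
    proof (rule integral_mono_AE)
      show "integrable lebesgue (\<lambda>y. indicat_real ?B y *\<^sub>R \<bar>f (t i) - f y\<bar>)"
        using set_integrable_abs[OF set_integral_diff(1)[OF intc[of "f (t i)"] intB]] by (simp add: set_integrable_def)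
      show "integrable lebesgue (\<lambda>y. indicat_real ?B y *\<^sub>R v i)" using intc by (simp add: set_integrable_def)
      show "AE y in lebesgue. indicat_real ?B y *\<^sub>R \<bar>f (t i) - f y\<bar> \<le> indicat_real ?B y *\<^sub>R v i"
      proof (rule AE_I'[OF Nn], rule subsetI)
        fix y assume "y \<in> {y \<in> space lebesgue. \<not> indicat_real ?B y *\<^sub>R \<bar>f (t i) - f y\<bar> \<le> indicat_real ?B y *\<^sub>R v i}"
        then have "y \<in> ?B" "v i < \<bar>f (t i) - f y\<bar>" by (cases "y \<in> ?B"; simp add: not_le)+
        moreover have "y \<in> {0..1}" using \<open>y \<in> ?B\<close> J(1)[OF i] by blast
        ultimately show "y \<in> N" by (simp add: N_def)
      qed
    qed
    also have "\<dots> = v i * measure lebesgue ?B" using Bs by (simp add: set_lebesgue_integral_def mult.commute)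
    also have "\<dots> \<le> v i * measure lebesgue (J i)"
      by (intro mult_left_mono measure_mono_fmeasurable v0) (use Bs Jm[OF i] in auto)
    finally show ?thesis .
  qed
  have "(\<Sum>i\<in>F. LINT y:J i \<inter> Hh|lebesgue. \<bar>f (t i) - f y\<bar>) \<le> (\<Sum>i\<in>F. v i * measure lebesgue (J i))"
    by (rule sum_mono) (rule le)
  also have "\<dots> = (\<Sum>i\<in>F'. v i * measure lebesgue (J i))"
    by (rule sum.mono_neutral_right) (use F F' in \<open>auto simp: v_def\<close>)
  also have "\<dots> = (\<Sum>i\<in>F'. u i * measure lebesgue (J i)) + \<kappa> * (\<Sum>i\<in>F'. measure lebesgue (J i))"
    by (simp add: v_def distrib_right sum.distrib sum_distrib_left)
  also have "\<dots> \<le> \<xi> + 10 * (2 * b) * (2 * c) / \<xi> + \<kappa> * 1"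
    using main totF' \<kappa> by (intro add_mono mult_left_mono) auto
  finally show "(\<Sum>i\<in>F. LINT y:J i \<inter> Hh|lebesgue. \<bar>f (t i) - f y\<bar>) \<le> \<xi> + 40 * b * c / \<xi> + \<kappa>"
    by (simp add: mult_ac)
qed

text \<open>Each interval is cut along the hull \<open>Hh\<close>. Inside, the preceding comparison
  applies. Outside, the tag value is bounded by \<open>b\<close> and \<open>f\<close> is integrated
  over \<open>G - Hh\<close>; the two remainders become small through the measure of
  \<open>G - Hh\<close> and absolute continuity.\<close>

lemma sum_piece_le:
  fixes f \<delta> :: "real \<Rightarrow> real" and t \<rho> :: "'i \<Rightarrow> real" and J :: "'i \<Rightarrow> real set"
  assumes f: "set_integrable lebesgue {0..1} f"
    and H: "\<And>p. p tagged_partial_division_of {0..1} \<Longrightarrow> sym_ball \<delta> fine p \<Longrightarrow>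
       (\<Sum>(t, K)\<in>p. \<bar>measure lebesgue K * f t - integral K f\<bar>) \<le> c"
    and F: "finite F" and C: "C \<subseteq> {0..1}" and t: "\<And>i. i \<in> F \<Longrightarrow> t i \<in> C"
    and bf: "\<And>y. y \<in> C \<Longrightarrow> \<bar>f y\<bar> \<le> b" and b: "0 \<le> b" and \<xi>: "0 < \<xi>"
    and \<rho>: "\<And>i. i \<in> F \<Longrightarrow> 0 < \<rho> i \<and> \<rho> i \<le> 1 \<and> \<rho> i < \<delta> (t i) \<and> 2 * \<rho> i \<le> r"
    and J: "\<And>i. i \<in> F \<Longrightarrow> J i \<subseteq> {0..1} \<inter> cball (t i) (\<rho> i)" "\<And>i. i \<in> F \<Longrightarrow> \<exists>a b. J i = {a..b}"
    and ae: "AE x in lebesgue. \<forall>i\<in>F. \<forall>j\<in>F. x \<in> J i \<longrightarrow> x \<in> J j \<longrightarrow> i = j"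
    and Hh: "Hh \<in> sets lebesgue"
    and null: "\<And>N. N \<in> sets lebesgue \<Longrightarrow> N \<subseteq> Hh \<Longrightarrow> N \<inter> {t \<in> C. r < \<delta> t} = {} \<Longrightarrow> N \<in> null_sets lebesgue"
    and G: "\<And>i. i \<in> F \<Longrightarrow> J i \<subseteq> G" "G - Hh \<in> lmeasurable"
  shows "(\<Sum>i\<in>F. \<bar>measure lebesgue (J i) * f (t i) - (LINT y:J i|lebesgue. f y)\<bar>) \<le>
    \<xi> + 40 * b * c / \<xi> + b * measure lebesgue (G - Hh) + (LINT y:(G - Hh) \<inter> {0..1}|lebesgue. \<bar>f y\<bar>)"
proof -
  have Jm: "J i \<in> lmeasurable" if "i \<in> F" for i using J(2)[OF that] by auto
  have int: "set_integrable lebesgue B f" if "B \<in> sets lebesgue" "B \<subseteq> {0..1}" for B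
    by (rule set_integrable_subset[OF f that])
  have intabs: "set_integrable lebesgue B (\<lambda>y. \<bar>f y\<bar>)" if "B \<in> sets lebesgue" "B \<subseteq> {0..1}" for B
    by (intro set_integrable_abs int that)
  have Bm: "B \<in> lmeasurable" if "B \<in> sets lebesgue" "B \<subseteq> {0..1}" for B :: "real set"
    by (rule bounded_set_imp_lmeasurable[OF bounded_subset[OF bounded_closed_interval that(2)] that(1)])
  have intc: "set_integrable lebesgue B (\<lambda>_. a)" if "B \<in> lmeasurable" for B :: "real set" and a :: real
    unfolding set_integrable_def using that by (auto intro!: integrable_mult_left simp: fmeasurable_def)
  have neg: "pairwise (\<lambda>i j. negligible (J i \<inter> J j)) F"
  proof (intro pairwiseI)
    fix i j assume ij: "i \<in> F" "j \<in> F" "i \<noteq> j"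
    have "AE x in lebesgue. x \<notin> J i \<inter> J j" using ae by eventually_elim (use ij in blast)
    moreover have "J i \<inter> J j \<in> sets lebesgue" using Jm ij by auto
    ultimately show "negligible (J i \<inter> J j)"
      unfolding negligible_iff_null_sets by (subst (asm) AE_iff_null_sets[symmetric]) auto
  qed
  have "(\<Sum>i\<in>F. measure lebesgue (J i)) = measure lebesgue (\<Union>(J ` F))"
    by (rule measure_negligible_finite_Union_image[OF F Jm neg, symmetric])
  also have "\<dots> \<le> measure lebesgue {0..1::real}"
    by (rule measure_mono_fmeasurable) (use J(1) Jm F in \<open>auto intro!: sets.finite_UN\<close>)
  finally have tot: "(\<Sum>i\<in>F. measure lebesgue (J i)) \<le> 1" by simp
  have D: "J i - Hh \<in> sets lebesgue" "J i \<inter> Hh \<in> sets lebesgue" "J i \<subseteq> {0..1}" "J i \<in> sets lebesgue" if "i \<in> F" for i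
    using Jm[OF that] Hh J(1)[OF that] by auto
  have trm: "\<bar>measure lebesgue (J i) * f (t i) - (LINT y:J i|lebesgue. f y)\<bar> \<le>
      (LINT y:J i \<inter> Hh|lebesgue. \<bar>f (t i) - f y\<bar>) + (b * measure lebesgue (J i - Hh) + (LINT y:J i - Hh|lebesgue. \<bar>f y\<bar>))"
    if i: "i \<in> F" for i
  proof -
    note D = D[OF i]
    have sub: "J i \<inter> Hh \<subseteq> {0..1}" "J i - Hh \<subseteq> {0..1}" using D(3) by auto
    have dint: "set_integrable lebesgue B (\<lambda>y. \<bar>f (t i) - f y\<bar>)" if "B \<in> sets lebesgue" "B \<subseteq> {0..1}" for B
      by (intro set_integrable_abs set_integral_diff intc int Bm that)
    have "measure lebesgue (J i) * f (t i) - (LINT y:J i|lebesgue. f y) = (LINT y:J i|lebesgue. f (t i) - f y)"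
      using set_integral_diff(2)[OF intc[OF Jm[OF i], of "f (t i)"] int[OF D(4,3)]] Jm[OF i]
      by (simp add: set_lebesgue_integral_def)
    also have "\<bar>\<dots>\<bar> \<le> (LINT y:J i|lebesgue. \<bar>f (t i) - f y\<bar>)"
      unfolding set_lebesgue_integral_def
      using integral_abs_bound[of lebesgue "\<lambda>y. indicator (J i) y *\<^sub>R (f (t i) - f y)"] by (simp add: abs_mult)
    also have "\<dots> = (LINT y:(J i \<inter> Hh) \<union> (J i - Hh)|lebesgue. \<bar>f (t i) - f y\<bar>)"
      by (rule arg_cong2[where f = "\<lambda>A. set_lebesgue_integral lebesgue A"]) auto
    also have "\<dots> = (LINT y:J i \<inter> Hh|lebesgue. \<bar>f (t i) - f y\<bar>) + (LINT y:J i - Hh|lebesgue. \<bar>f (t i) - f y\<bar>)"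
      by (rule set_integral_Un) (use dint D sub in auto)
    also have "(LINT y:J i - Hh|lebesgue. \<bar>f (t i) - f y\<bar>) \<le> (LINT y:J i - Hh|lebesgue. b + \<bar>f y\<bar>)"
    proof (rule set_integral_mono)
      show "set_integrable lebesgue (J i - Hh) (\<lambda>y. b + \<bar>f y\<bar>)"
        by (intro set_integral_add intc Bm set_integrable_abs int D sub)
      show "\<bar>f (t i) - f y\<bar> \<le> b + \<bar>f y\<bar>" for y using bf[OF t[OF i]] by linarith
    qed (rule dint[OF D(1) sub(2)])
    also have "\<dots> = (LINT y:J i - Hh|lebesgue. b) + (LINT y:J i - Hh|lebesgue. \<bar>f y\<bar>)"
      by (intro set_integral_add intc Bm set_integrable_abs int D sub)
    also have "(LINT y:J i - Hh|lebesgue. b) = b * measure lebesgue (J i - Hh)"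
      using D(1) by (simp add: set_lebesgue_integral_def mult.commute)
    finally show ?thesis by simp
  qed
  have U: "(\<Union>i\<in>F. J i - Hh) \<in> sets lebesgue" "(\<Union>i\<in>F. J i - Hh) \<subseteq> (G - Hh) \<inter> {0..1}"
    subgoal by (rule sets.finite_UN[OF F]) (rule D)
    subgoal using D(3) G(1) by blast
    done
  have aeD: "AE x in lebesgue. \<forall>i\<in>F. \<forall>j\<in>F. x \<in> J i - Hh \<longrightarrow> x \<in> J j - Hh \<longrightarrow> i = j"
    using ae by eventually_elim blast
  have negD: "pairwise (\<lambda>i j. negligible ((J i - Hh) \<inter> (J j - Hh))) F"
    using neg unfolding pairwise_def by (meson negligible_subset Diff_subset Int_mono)
  have GH: "(G - Hh) \<inter> {0..1} \<in> sets lebesgue" using G(2) by auto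
  have "(\<Sum>i\<in>F. measure lebesgue (J i - Hh)) = measure lebesgue (\<Union>i\<in>F. J i - Hh)"
    by (rule measure_negligible_finite_Union_image[OF F _ negD, symmetric]) (use Bm D in blast)
  also have "\<dots> \<le> measure lebesgue (G - Hh)"
    by (rule measure_mono_fmeasurable) (use U G(2) in auto)
  finally have m: "(\<Sum>i\<in>F. measure lebesgue (J i - Hh)) \<le> measure lebesgue (G - Hh)" .
  have "(\<Sum>i\<in>F. LINT y:J i - Hh|lebesgue. \<bar>f y\<bar>) = (LINT y:(\<Union>i\<in>F. J i - Hh)|lebesgue. \<bar>f y\<bar>)"
  proof (rule set_integral_finite_UN_AE_disjoint[OF F aeD, symmetric])
    fix i assume i: "i \<in> F"
    show "J i - Hh \<in> sets lebesgue" by (rule D(1)[OF i])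
    show "set_integrable lebesgue (J i - Hh) (\<lambda>y. \<bar>f y\<bar>)"
      by (rule intabs[OF D(1)[OF i]]) (use D(3)[OF i] in blast)
  qed
  also have "\<dots> \<le> (LINT y:(G - Hh) \<inter> {0..1}|lebesgue. \<bar>f y\<bar>)"
    unfolding set_lebesgue_integral_def
  proof (rule integral_mono)
    show "integrable lebesgue (\<lambda>y. indicat_real (\<Union>i\<in>F. J i - Hh) y *\<^sub>R \<bar>f y\<bar>)"
      "integrable lebesgue (\<lambda>y. indicat_real ((G - Hh) \<inter> {0..1}) y *\<^sub>R \<bar>f y\<bar>)"
      unfolding set_integrable_def[symmetric]
      by (rule intabs; use U GH in blast)+
    show "indicat_real (\<Union>i\<in>F. J i - Hh) y *\<^sub>R \<bar>f y\<bar> \<le> indicat_real ((G - Hh) \<inter> {0..1}) y *\<^sub>R \<bar>f y\<bar>" for y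
      using subsetD[OF U(2), of y] by (cases "y \<in> (\<Union>i\<in>F. J i - Hh)") (simp_all del: UN_iff)
  qed
  finally have n: "(\<Sum>i\<in>F. LINT y:J i - Hh|lebesgue. \<bar>f y\<bar>) \<le> (LINT y:(G - Hh) \<inter> {0..1}|lebesgue. \<bar>f y\<bar>)" .
  have "(\<Sum>i\<in>F. \<bar>measure lebesgue (J i) * f (t i) - (LINT y:J i|lebesgue. f y)\<bar>) \<le>
      (\<Sum>i\<in>F. LINT y:J i \<inter> Hh|lebesgue. \<bar>f (t i) - f y\<bar>) +
      (b * (\<Sum>i\<in>F. measure lebesgue (J i - Hh)) + (\<Sum>i\<in>F. LINT y:J i - Hh|lebesgue. \<bar>f y\<bar>))"
    using sum_mono[OF trm, of F] by (simp add: sum.distrib sum_distrib_left)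
  also have "\<dots> \<le> (\<xi> + 40 * b * c / \<xi>) + (b * measure lebesgue (G - Hh) + (LINT y:(G - Hh) \<inter> {0..1}|lebesgue. \<bar>f y\<bar>))"
    by (intro add_mono mult_left_mono m n b
        sum_integral_diff_hull_le[OF f H F C t bf b \<xi> \<rho> J neg tot Hh null])
  finally show ?thesis by simp
qed

subsection \<open>From Henstock and absolutely continuous to McShane\<close>

lemma apply_bcontfun_sum:
  fixes h :: "'i \<Rightarrow> ('b::topological_space \<Rightarrow>\<^sub>C real)"
  shows "apply_bcontfun (\<Sum>i\<in>F. h i) x = (\<Sum>i\<in>F. apply_bcontfun (h i) x)"
  by (induction F rule: infinite_finite_induct) auto

definition gauge_sum :: "(real \<Rightarrow> 'y::real_vector) \<Rightarrow> (real \<times> real set) set \<Rightarrow> 'y" where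
  "gauge_sum g P = (\<Sum>(t, I)\<in>P. measure lebesgue I *\<^sub>R g t)"

lemma apply_gauge_sum:
  fixes g :: "real \<Rightarrow> ('b::topological_space \<Rightarrow>\<^sub>C real)"
  shows "apply_bcontfun (gauge_sum g P) x = (\<Sum>(t, I)\<in>P. measure lebesgue I * apply_bcontfun (g t) x)"
  unfolding gauge_sum_def apply_bcontfun_sum by (intro sum.cong refl) auto

lemma has_integral_01I:
  fixes f :: "real \<Rightarrow> real"
  assumes "\<And>\<epsilon>. 0 < \<epsilon> \<Longrightarrow> \<exists>\<delta>. positive_gauge \<delta> \<and>
    (\<forall>p. perron_partition_01 p \<longrightarrow> sym_ball \<delta> fine p \<longrightarrow> \<bar>(\<Sum>(t, K)\<in>p. measure lebesgue K * f t) - y\<bar> < \<epsilon>)"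
  shows "(f has_integral y) {0..1}"
  unfolding has_integral_real
proof (intro allI impI)
  fix e :: real assume "0 < e"
  then obtain \<delta> where \<delta>: "positive_gauge \<delta>"
    "\<And>p. perron_partition_01 p \<Longrightarrow> sym_ball \<delta> fine p \<Longrightarrow> \<bar>(\<Sum>(t, K)\<in>p. measure lebesgue K * f t) - y\<bar> < e"
    using assms by blast
  have pos: "0 < \<delta> t" if "t \<in> {0..1}" for t using \<delta>(1) that by (simp add: positive_gauge_def)
  show "\<exists>\<gamma>. gauge \<gamma> \<and> (\<forall>\<D>. \<D> tagged_division_of {0..1} \<and> \<gamma> fine \<D> \<longrightarrow>
      norm ((\<Sum>(x, k)\<in>\<D>. measure lborel k *\<^sub>R f x) - y) < e)"
  proof (intro exI conjI allI impI)
    show "gauge (\<lambda>t. if t \<in> {0..1} then sym_ball \<delta> t else UNIV)" by (rule gauge_extend_01[OF pos])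
    fix p assume p: "p tagged_division_of {0..1} \<and> (\<lambda>t. if t \<in> {0..1} then sym_ball \<delta> t else UNIV) fine p"
    then have tp: "p tagged_division_of {0..1}" by blast
    have "sym_ball \<delta> fine p"
      by (rule fine_extend_01[THEN iffD1, OF tagged_division_ofD(3)[OF tp] tagged_division_ofD(2)[OF tp] conjunct2[OF p]])
    moreover have "perron_partition_01 p" using tp by (simp add: perron_partition_01_iff_tagged_division)
    ultimately have "\<bar>(\<Sum>(t, K)\<in>p. measure lebesgue K * f t) - y\<bar> < e" by (rule \<delta>(2)[rotated])
    moreover have lb: "measure lborel K = measure lebesgue K" if "(t, K) \<in> p" for t K
      using tagged_division_ofD(4)[OF tp that] by auto
    have "(\<Sum>(x, k)\<in>p. measure lborel k *\<^sub>R f x) = (\<Sum>(t, K)\<in>p. measure lebesgue K * f t)"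
      by (rule sum.cong[OF refl]) (use lb in auto)
    ultimately show "norm ((\<Sum>(x, k)\<in>p. measure lborel k *\<^sub>R f x) - y) < e" by simp
  qed
qed

definition riemann_close :: "(real \<Rightarrow> 'y::real_normed_vector) \<Rightarrow> 'y \<Rightarrow> ((real \<times> real set) set \<Rightarrow> bool) \<Rightarrow>
    (real \<Rightarrow> real) \<Rightarrow> real \<Rightarrow> bool" where
  "riemann_close g w Q \<delta> \<epsilon> \<longleftrightarrow> (\<forall>P. Q P \<longrightarrow> sym_ball \<delta> fine P \<longrightarrow> dist w (gauge_sum g P) < \<epsilon>)"

lemma riemann_close_perron:
  "riemann_close g w partition_01 \<delta> \<epsilon> \<Longrightarrow> riemann_close g w perron_partition_01 \<delta> \<epsilon>"
  by (simp add: riemann_close_def perron_partition_01_def)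

lemma riemann_close_coord:
  fixes g :: "real \<Rightarrow> ('b::metric_space \<Rightarrow>\<^sub>C real)"
  assumes "riemann_close g w Q \<delta> \<epsilon>" "Q P" "sym_ball \<delta> fine P"
  shows "\<bar>(\<Sum>(t, K)\<in>P. measure lebesgue K * apply_bcontfun (g t) x) - apply_bcontfun w x\<bar> < \<epsilon>"
proof -
  have "dist (apply_bcontfun w x) (apply_bcontfun (gauge_sum g P) x) < \<epsilon>"
    using assms dist_bounded[of w x "gauge_sum g P"] unfolding riemann_close_def by (metis le_less_trans)
  then show ?thesis by (simp add: apply_gauge_sum dist_real_def abs_minus_commute)
qed

lemma coord_has_integral:
  fixes g :: "real \<Rightarrow> ('b::metric_space \<Rightarrow>\<^sub>C real)"
  assumes "\<And>\<epsilon>. 0 < \<epsilon> \<Longrightarrow> \<exists>\<delta>. positive_gauge \<delta> \<and> riemann_close g w perron_partition_01 \<delta> \<epsilon>"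
  shows "((\<lambda>t. apply_bcontfun (g t) x) has_integral apply_bcontfun w x) {0..1}"
proof (rule has_integral_01I)
  fix \<epsilon> :: real assume "0 < \<epsilon>"
  then obtain \<delta> where "positive_gauge \<delta>" and r: "riemann_close g w perron_partition_01 \<delta> \<epsilon>" using assms by blast
  then show "\<exists>\<delta>. positive_gauge \<delta> \<and> (\<forall>p. perron_partition_01 p \<longrightarrow> sym_ball \<delta> fine p \<longrightarrow>
      \<bar>(\<Sum>(t, K)\<in>p. measure lebesgue K * apply_bcontfun (g t) x) - apply_bcontfun w x\<bar> < \<epsilon>)"
    using riemann_close_coord[OF r] by blast
qed

lemma coord_Henstock:
  fixes g :: "real \<Rightarrow> ('b::metric_space \<Rightarrow>\<^sub>C real)"
  assumes "((\<lambda>t. apply_bcontfun (g t) x) has_integral apply_bcontfun w x) {0..1}"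
    and "positive_gauge \<delta>" "riemann_close g w perron_partition_01 \<delta> \<epsilon>" "0 < \<epsilon>"
    and "p tagged_partial_division_of {0..1}" "sym_ball \<delta> fine p"
  shows "(\<Sum>(t, K)\<in>p. \<bar>measure lebesgue K * apply_bcontfun (g t) x - integral K (\<lambda>t. apply_bcontfun (g t) x)\<bar>) \<le> 2 * \<epsilon>"
proof (rule Henstock_lemma_01[OF _ _ assms(4) _ assms(5,6)])
  show "(\<lambda>t. apply_bcontfun (g t) x) integrable_on {0..1}" using assms(1) by blast
  show "0 < \<delta> t" if "t \<in> {0..1}" for t using assms(2) that by (simp add: positive_gauge_def)
  fix q assume "q tagged_division_of {0..1}" "sym_ball \<delta> fine q"
  then show "\<bar>(\<Sum>(t, K)\<in>q. measure lebesgue K * apply_bcontfun (g t) x) - integral {0..1} (\<lambda>t. apply_bcontfun (g t) x)\<bar> < \<epsilon>"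
    using riemann_close_coord[OF assms(3)] integral_unique[OF assms(1)]
    by (simp add: perron_partition_01_iff_tagged_division)
qed

text \<open>A single tagged interval is a legitimate partial division, so Henstock's lemma bounds
  the value at the tag by the integral over an interval whose length is controlled from below. The
  bound depends on \<open>k\<close> but not on the coordinate.\<close>

lemma locally_bounded_of_Henstock:
  fixes g :: "real \<Rightarrow> ('b::metric_space \<Rightarrow>\<^sub>C real)"
  assumes int: "\<And>x. set_integrable lebesgue {0..1} (\<lambda>t. apply_bcontfun (g t) x)"
    and AC: "\<And>\<epsilon>. 0 < \<epsilon> \<Longrightarrow> \<exists>\<eta>>0. \<forall>E\<in>sets lebesgue. E \<subseteq> {0..1} \<longrightarrow> measure lebesgue E < \<eta> \<longrightarrow>
      (\<forall>x. (LINT t:E|lebesgue. \<bar>apply_bcontfun (g t) x\<bar>) \<le> \<epsilon>)"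
    and hi: "\<And>x. ((\<lambda>t. apply_bcontfun (g t) x) has_integral apply_bcontfun w x) {0..1}"
    and \<delta>: "positive_gauge \<delta>" "riemann_close g w perron_partition_01 \<delta> 1" and k: "0 < k"
  obtains b where "0 < b" "\<And>t x. t \<in> {0..1} \<Longrightarrow> k < \<delta> t \<Longrightarrow> \<bar>apply_bcontfun (g t) x\<bar> \<le> b"
proof -
  obtain \<eta> where \<eta>: "0 < \<eta>" "\<And>E x. E \<in> sets lebesgue \<Longrightarrow> E \<subseteq> {0..1} \<Longrightarrow> measure lebesgue E < \<eta> \<Longrightarrow>
      (LINT t:E|lebesgue. \<bar>apply_bcontfun (g t) x\<bar>) \<le> 1"
    using AC[of 1] by auto
  \<comment> \<open>Small enough for the interval to be fine and for its measure, at most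
    \<open>2 * s\<close>, to stay below \<open>\<eta>\<close>. The bound is \<open>3 / s\<close>: 2
    from Henstock's lemma with error 1, plus 1 from the integral.\<close>
  define s where "s = min (min (\<eta> / 4) (k / 2)) 1"
  have s: "0 < s" "2 * s < \<eta>" "s < k" "s \<le> 1" using \<eta>(1) k by (auto simp: s_def min_def)
  have "\<bar>apply_bcontfun (g t) x\<bar> \<le> 3 / s" if t: "t \<in> {0..1}" "k < \<delta> t" for t x
  proof -
    let ?f = "\<lambda>t. apply_bcontfun (g t) x"
    define a b where "a = max 0 (t - s)" and "b = min 1 (t + s)"
    have ab: "a + s \<le> b" "b \<le> a + 2 * s" "a \<le> t" "t \<le> b" "0 \<le> a" "b \<le> 1" "t - s \<le> a" "b \<le> t + s"
      using t(1) s by (auto simp: a_def b_def max_def min_def)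
    let ?J = "{a..b}"
    have J: "?J \<subseteq> {0..1}" "?J \<in> sets lebesgue" "measure lebesgue ?J < \<eta>" "s \<le> measure lebesgue ?J"
      using ab s by auto
    have "{(t, ?J)} tagged_partial_division_of {0..1}"
      unfolding tagged_partial_division_of_def using ab J(1) by (auto simp: cbox_interval)
    moreover have "sym_ball \<delta> fine {(t, ?J)}" using ab t(2) s by (auto simp: fine_def sym_ball_def)
    ultimately have "\<bar>measure lebesgue ?J * ?f t - integral ?J ?f\<bar> \<le> 2"
      using coord_Henstock[OF hi \<delta>, of "{(t, ?J)}" x] by simp
    moreover have intJ: "set_integrable lebesgue ?J ?f" by (rule set_integrable_subset[OF int J(2,1)])
    have "\<bar>integral ?J ?f\<bar> \<le> 1"
    proof -
      have "integral ?J ?f = (LINT t:?J|lebesgue. ?f t)" by (rule set_lebesgue_integral_eq_integral(2)[OF intJ, symmetric])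
      also have "\<bar>\<dots>\<bar> \<le> (LINT t:?J|lebesgue. \<bar>?f t\<bar>)"
        unfolding set_lebesgue_integral_def
        using integral_abs_bound[of lebesgue "\<lambda>y. indicator ?J y *\<^sub>R ?f y"] by (simp add: abs_mult)
      also have "\<dots> \<le> 1" by (rule \<eta>(2)[OF J(2,1,3)])
      finally show ?thesis .
    qed
    ultimately have "\<bar>measure lebesgue ?J * ?f t\<bar> \<le> 3" by linarith
    then have "measure lebesgue ?J * \<bar>?f t\<bar> \<le> 3" by (simp only: abs_mult) simp
    moreover have "s * \<bar>?f t\<bar> \<le> measure lebesgue ?J * \<bar>?f t\<bar>" using J(4) by (rule mult_right_mono) simp
    ultimately have "s * \<bar>?f t\<bar> \<le> 3" by linarith
    then show ?thesis using s(1) by (simp add: field_simps)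
  qed
  then show thesis using that[of "3 / s"] s(1) by simp
qed

lemma measurable_gauge_imp_positive: "measurable_gauge \<delta> \<Longrightarrow> positive_gauge \<delta>"
  by (simp add: measurable_gauge_def)

lemma partition_01D:
  assumes "partition_01 P"
  shows "finite P" "\<And>p. p \<in> P \<Longrightarrow> fst p \<in> {0..1}" "\<And>p. p \<in> P \<Longrightarrow> snd p \<subseteq> {0..1}"
    "\<And>p. p \<in> P \<Longrightarrow> \<exists>a b. snd p = {a..b}"
    "\<And>p q. p \<in> P \<Longrightarrow> q \<in> P \<Longrightarrow> p \<noteq> q \<Longrightarrow> interior (snd p) \<inter> interior (snd q) = {}"
    "(\<Union>p\<in>P. snd p) = {0..1}"
proof -
  have "finite P \<and> (\<forall>p\<in>P. fst p \<in> {0..1} \<and> snd p \<subseteq> {0..1} \<and> (\<exists>a b. a \<le> b \<and> snd p = {a..b})) \<and>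
      (\<forall>p\<in>P. \<forall>q\<in>P. p \<noteq> q \<longrightarrow> interior (snd p) \<inter> interior (snd q) = {}) \<and> \<Union>(snd ` P) = {0..1}"
    using assms unfolding partition_01_def case_prod_beta prod.collapse .
  note P = this[THEN conjunct1] this[THEN conjunct2, THEN conjunct1]
    this[THEN conjunct2, THEN conjunct2, THEN conjunct1] this[THEN conjunct2, THEN conjunct2, THEN conjunct2]
  show "finite P" "(\<Union>p\<in>P. snd p) = {0..1}" by fact+
  show "fst p \<in> {0..1}" "snd p \<subseteq> {0..1}" "\<exists>a b. snd p = {a..b}" if "p \<in> P" for p
    using P(2) that by blast+
  show "interior (snd p) \<inter> interior (snd q) = {}" if "p \<in> P" "q \<in> P" "p \<noteq> q" for p q
    using P(3) that by blast
qed

section \<open>The McShane gauge\<close>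

text \<open>The index \<open>\<kappa>\<close> takes countably many values and is measurable together
  with \<open>\<delta>0\<close>, so choosing a different formula on each of its level sets preserves
  measurability. The sets \<open>G k\<close> enter only through the continuous distance to their
  complements.\<close>

lemma glued_gauge:
  fixes \<delta> :: "nat \<Rightarrow> real \<Rightarrow> real" and \<delta>0 \<delta>' :: "real \<Rightarrow> real" and G :: "nat \<Rightarrow> real set"
    and r :: "nat \<Rightarrow> real" and \<kappa> :: "real \<Rightarrow> nat"
  assumes \<kappa>_def: "\<And>t. \<kappa> t = nat \<lfloor>1 / \<delta>0 t\<rfloor>"
    and \<delta>'_def: "\<And>t. \<delta>' t = min (min (\<delta> (\<kappa> t) t / 2) (min (r (\<kappa> t) / 2) 1)) (infdist t (- G (\<kappa> t)))"
    and Gd: "Gd = positive_gauge \<or> Gd = measurable_gauge"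
    and \<delta>0: "Gd \<delta>0" and \<delta>: "\<And>k. Gd (\<delta> k)" and r: "\<And>k. 0 < r k"
    and G: "\<And>k. open (G k)" "\<And>k. G k \<noteq> UNIV" "\<And>t. t \<in> {0..1} \<Longrightarrow> t \<in> G (\<kappa> t)"
  shows "Gd \<delta>'"
proof -
  have Gpos: "positive_gauge d" if "Gd d" for d using Gd that measurable_gauge_imp_positive by blast
  have pos: "positive_gauge \<delta>'"
    unfolding positive_gauge_def
  proof
    fix t :: real assume t: "t \<in> {0..1}"
    have "0 < infdist t (- G (\<kappa> t))"
      by (rule infdist_pos_not_in_closed) (use G t in \<open>auto simp: closed_Compl\<close>)
    moreover have "0 < \<delta> (\<kappa> t) t" using Gpos[OF \<delta>] t by (simp add: positive_gauge_def)
    ultimately show "0 < \<delta>' t" using r[of "\<kappa> t"] by (simp add: \<delta>'_def)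
  qed
  show ?thesis
  proof (cases "Gd = positive_gauge")
    case False
    then have Gm: "Gd = measurable_gauge" using Gd by blast
    have m0: "\<delta>0 \<in> borel_measurable (lebesgue_on {0..1})" using \<delta>0 by (simp add: Gm measurable_gauge_def)
    have m: "\<delta> k \<in> borel_measurable (lebesgue_on {0..1})" for k using \<delta>[of k] by (simp add: Gm measurable_gauge_def)
    have \<kappa>: "\<kappa> \<in> measurable (lebesgue_on {0..1}) (count_space UNIV)" unfolding \<kappa>_def[abs_def] using m0 by measurable
    have inf: "(\<lambda>t. infdist t (- G k)) \<in> borel_measurable (lebesgue_on {0..1})" for k
      by (intro continuous_imp_measurable_on_sets_lebesgue continuous_intros) auto
    have "\<delta>' \<in> borel_measurable (lebesgue_on {0..1})"
      unfolding \<delta>'_def[abs_def]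
      by (rule measurable_compose_countable[OF _ \<kappa>, where f = "\<lambda>k t. min (min (\<delta> k t / 2) (min (r k / 2) 1)) (infdist t (- G k))"])
        (use m inf in measurable)
    then show ?thesis using pos by (simp add: Gm measurable_gauge_def)
  qed (use pos in simp)
qed

lemma McShane_of_Henstock:
  fixes g :: "real \<Rightarrow> ('b::metric_space \<Rightarrow>\<^sub>C real)"
  assumes int: "\<And>x. set_integrable lebesgue {0..1} (\<lambda>t. apply_bcontfun (g t) x)"
    and AC: "\<And>\<epsilon>. 0 < \<epsilon> \<Longrightarrow> \<exists>\<eta>>0. \<forall>E\<in>sets lebesgue. E \<subseteq> {0..1} \<longrightarrow> measure lebesgue E < \<eta> \<longrightarrow>
      (\<forall>x. (LINT t:E|lebesgue. \<bar>apply_bcontfun (g t) x\<bar>) \<le> \<epsilon>)"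
    and Gd: "Gd = positive_gauge \<or> Gd = measurable_gauge"
    and HK: "\<And>\<epsilon>. 0 < \<epsilon> \<Longrightarrow> \<exists>\<delta>. Gd \<delta> \<and> riemann_close g w perron_partition_01 \<delta> \<epsilon>"
    and \<epsilon>: "0 < \<epsilon>"
  shows "\<exists>\<delta>. Gd \<delta> \<and> riemann_close g w partition_01 \<delta> \<epsilon>"
proof -
  have Gpos: "positive_gauge d" if "Gd d" for d using Gd that measurable_gauge_imp_positive by blast
  have hi: "((\<lambda>t. apply_bcontfun (g t) x) has_integral apply_bcontfun w x) {0..1}" for x
    by (rule coord_has_integral) (use HK Gpos in blast)
  obtain \<delta>0 where \<delta>0: "Gd \<delta>0" "riemann_close g w perron_partition_01 \<delta>0 1" using HK[of 1] by auto
  define \<kappa> where "\<kappa> t = nat \<lfloor>1 / \<delta>0 t\<rfloor>" for t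
  define C where "C k = {t \<in> {0..1}. \<kappa> t = k}" for k
  have "\<exists>b>0. \<forall>t x. t \<in> C k \<longrightarrow> \<bar>apply_bcontfun (g t) x\<bar> \<le> b" for k
  proof -
    \<comment> \<open>On \<open>C k\<close> the number \<open>1 / \<delta>0 t\<close> is below
      \<open>k + 1\<close>, so the level \<open>1 / (k + 2)\<close> is exceeded with room to
      spare.\<close>
    obtain b where b: "0 < b" "\<And>t x. t \<in> {0..1} \<Longrightarrow> 1 / (real k + 2) < \<delta>0 t \<Longrightarrow> \<bar>apply_bcontfun (g t) x\<bar> \<le> b"
      by (rule locally_bounded_of_Henstock[OF int AC hi Gpos[OF \<delta>0(1)] \<delta>0(2), of "1 / (real k + 2)"]) auto
    have "1 / (real k + 2) < \<delta>0 t" if "t \<in> C k" for t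
    proof -
      have "0 < \<delta>0 t" using Gpos[OF \<delta>0(1)] that by (simp add: positive_gauge_def C_def)
      moreover have "1 / \<delta>0 t < real k + 2" using that by (auto simp: C_def \<kappa>_def) linarith
      ultimately show ?thesis by (simp add: field_simps)
    qed
    then show ?thesis using b by (auto simp: C_def)
  qed
  then obtain b where b: "\<And>k. 0 < b k" "\<And>k t x. t \<in> C k \<Longrightarrow> \<bar>apply_bcontfun (g t) x\<bar> \<le> b k" by metis
  \<comment> \<open>Each piece will cost \<open>4 * e k\<close>. The geometric weights sum to 2, so
    the total is at most \<open>8 * \<epsilon> / 10\<close>.\<close>
  define e where "e k = \<epsilon> / 10 * (1/2) ^ k" for k :: nat
  \<comment> \<open>Chosen so that the Chebyshev term \<open>40 * b k * (2 * c k) / e k\<close>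
    equals \<open>e k\<close>; the inner factor 2 is that of Henstock's lemma.\<close>
  define c where "c k = (e k)\<^sup>2 / (80 * b k)" for k
  have e: "0 < e k" for k using \<epsilon> by (simp add: e_def)
  have c: "0 < c k" "80 * b k * c k / e k = e k" for k
    using e[of k] b(1)[of k] by (simp_all add: c_def power2_eq_square)
  obtain \<delta> where \<delta>: "\<And>k. Gd (\<delta> k)" "\<And>k. riemann_close g w perron_partition_01 (\<delta> k) (c k)"
    using HK[OF c(1)] by metis
  have "\<exists>\<eta>. 0 < \<eta> \<and> b k * \<eta> \<le> e k \<and> (\<forall>E\<in>sets lebesgue. E \<subseteq> {0..1} \<longrightarrow> measure lebesgue E < \<eta> \<longrightarrow>
      (\<forall>x. (LINT t:E|lebesgue. \<bar>apply_bcontfun (g t) x\<bar>) \<le> e k))" for k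
  proof -
    obtain \<eta> where \<eta>: "0 < \<eta>" "\<forall>E\<in>sets lebesgue. E \<subseteq> {0..1} \<longrightarrow> measure lebesgue E < \<eta> \<longrightarrow>
      (\<forall>x. (LINT t:E|lebesgue. \<bar>apply_bcontfun (g t) x\<bar>) \<le> e k)" using AC[OF e] by blast
    have "b k * min \<eta> (e k / b k) \<le> b k * (e k / b k)" using b(1)[of k] by (intro mult_left_mono) auto
    then show ?thesis using \<eta> b(1)[of k] e[of k] by (intro exI[of _ "min \<eta> (e k / b k)"]) auto
  qed
  then obtain \<eta> where \<eta>: "\<And>k. 0 < \<eta> k" "\<And>k. b k * \<eta> k \<le> e k"
    "\<And>k E x. E \<in> sets lebesgue \<Longrightarrow> E \<subseteq> {0..1} \<Longrightarrow> measure lebesgue E < \<eta> k \<Longrightarrow>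
      (LINT t:E|lebesgue. \<bar>apply_bcontfun (g t) x\<bar>) \<le> e k" by metis
  define Q where "Q k r H G \<longleftrightarrow> 0 < r \<and> H \<in> sets lebesgue \<and> open G \<and> C k \<subseteq> G \<and> G \<subseteq> {-1<..<2} \<and> measure lebesgue (G - H) < \<eta> k \<and>
    (\<forall>N\<in>sets lebesgue. N \<subseteq> H \<longrightarrow> N \<inter> {t \<in> C k. r < \<delta> k t} = {} \<longrightarrow> N \<in> null_sets lebesgue)"
    for k and r :: real and H G :: "real set"
  have "\<exists>r H G. Q k r H G" for k
  proof -
    have "C k \<subseteq> {0..1}" "\<And>t. t \<in> C k \<Longrightarrow> 0 < \<delta> k t"
      using Gpos[OF \<delta>(1)] by (auto simp: C_def positive_gauge_def)
    then show ?thesis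
    proof (rule thick_piece[OF _ _ \<eta>(1)])
      fix r H G
      assume a: "0 < r" "H \<in> sets lebesgue" "open G" "C k \<subseteq> G" "G \<subseteq> {-1<..<2}" "measure lebesgue (G - H) < \<eta> k"
        and n: "\<And>N. N \<in> sets lebesgue \<Longrightarrow> N \<subseteq> H \<Longrightarrow> N \<inter> {t \<in> C k. r < \<delta> k t} = {} \<Longrightarrow> N \<in> null_sets lebesgue"
      show ?thesis
        unfolding Q_def by (rule exI[of _ r], rule exI[of _ H], rule exI[of _ G], intro conjI ballI impI a n)
    qed
  qed
  then obtain r H G where Q: "\<And>k. Q k (r k) (H k) (G k)" by metis
  have r: "\<And>k. 0 < r k" and H: "\<And>k. H k \<in> sets lebesgue"
    and G: "\<And>k. open (G k)" "\<And>k. C k \<subseteq> G k" "\<And>k. G k \<subseteq> {-1<..<2}" "\<And>k. measure lebesgue (G k - H k) < \<eta> k"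
    and null: "\<And>k N. N \<in> sets lebesgue \<Longrightarrow> N \<subseteq> H k \<Longrightarrow> N \<inter> {t \<in> C k. r k < \<delta> k t} = {} \<Longrightarrow> N \<in> null_sets lebesgue"
    using Q unfolding Q_def by blast+
  \<comment> \<open>The four bounds make the ball fine for its own tag, fine for every thick tag in
    it, admissible for Vitali's lemma, and contained in \<open>G (\<kappa> t)\<close>.\<close>
  define \<delta>' where "\<delta>' t = min (min (\<delta> (\<kappa> t) t / 2) (min (r (\<kappa> t) / 2) 1)) (infdist t (- G (\<kappa> t)))" for t
  \<comment> \<open>The distance to the empty set is 0 by convention, so positivity of the gauge
    needs a point outside \<open>G k\<close>.\<close>
  have "(5::real) \<notin> G k" for k using G(3)[of k] by auto
  then have GU: "G k \<noteq> UNIV" for k by blast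
  have GC: "t \<in> G (\<kappa> t)" if "t \<in> {0..1}" for t
  proof -
    have "t \<in> C (\<kappa> t)" using that by (simp add: C_def)
    then show ?thesis using G(2) by blast
  qed
  have Gd': "Gd \<delta>'"
    by (rule glued_gauge[OF \<kappa>_def \<delta>'_def Gd \<delta>0(1) \<delta>(1) r G(1) GU GC])
  have "dist w (gauge_sum g P) < \<epsilon>" if P: "partition_01 P" "sym_ball \<delta>' fine P" for P
  proof -
    note PD = partition_01D[OF P(1)]
    have ae: "AE x in lebesgue. \<forall>p\<in>P. \<forall>q\<in>P. x \<in> snd p \<longrightarrow> x \<in> snd q \<longrightarrow> p = q"
      by (rule AE_nonoverlap[where J = snd, OF PD(1,4,5)])
    have "dist (apply_bcontfun (gauge_sum g P) x) (apply_bcontfun w x) \<le> 8 * \<epsilon> / 10" for x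
    proof -
      let ?f = "\<lambda>t. apply_bcontfun (g t) x"
      let ?h = "\<lambda>p. \<bar>measure lebesgue (snd p) * ?f (fst p) - (LINT y:snd p|lebesgue. ?f y)\<bar>"
      have piece: "(\<Sum>p\<in>{p \<in> P. \<kappa> (fst p) = k}. ?h p) \<le> 4 * e k" for k
      proof -
        let ?F = "{p \<in> P. \<kappa> (fst p) = k}"
        have GH: "G k - H k \<in> lmeasurable"
        proof (rule bounded_set_imp_lmeasurable)
          show "bounded (G k - H k)"
            by (rule bounded_subset[of "{-1..2::real}"]) (use G(3)[of k] in force)+
          show "G k - H k \<in> sets lebesgue" using G(1)[of k] H[of k] by (intro sets.Diff) auto
        qed
        have "(\<Sum>p\<in>?F. ?h p) \<le> e k + 40 * b k * (2 * c k) / e k + b k * measure lebesgue (G k - H k)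
            + (LINT y:(G k - H k) \<inter> {0..1}|lebesgue. \<bar>?f y\<bar>)"
        proof (rule sum_piece_le[OF int, where \<delta> = "\<delta> k" and C = "C k" and \<rho> = "\<lambda>p. \<delta>' (fst p)" and r = "r k"])
          show "(\<Sum>(t, K)\<in>p. \<bar>measure lebesgue K * ?f t - integral K ?f\<bar>) \<le> 2 * c k"
            if "p tagged_partial_division_of {0..1}" "sym_ball (\<delta> k) fine p" for p
            by (rule coord_Henstock[OF hi Gpos[OF \<delta>(1)] \<delta>(2) c(1) that])
          show "AE x in lebesgue. \<forall>i\<in>?F. \<forall>j\<in>?F. x \<in> snd i \<longrightarrow> x \<in> snd j \<longrightarrow> i = j"
            using ae by eventually_elim blast
          show "\<bar>?f y\<bar> \<le> b k" if "y \<in> C k" for y by (rule b(2)[OF that])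
          show "N \<in> null_sets lebesgue"
            if "N \<in> sets lebesgue" "N \<subseteq> H k" "N \<inter> {t \<in> C k. r k < \<delta> k t} = {}" for N
            by (rule null[OF that])
          fix p assume p: "p \<in> ?F"
          then have pP: "p \<in> P" and pk: "\<kappa> (fst p) = k" by auto
          show pC: "fst p \<in> C k" using PD(2)[OF pP] pk by (simp add: C_def)
          have pos: "0 < \<delta>' (fst p)" using Gpos[OF Gd'] PD(2)[OF pP] by (simp add: positive_gauge_def)
          have le: "\<delta>' (fst p) \<le> \<delta> k (fst p) / 2" "\<delta>' (fst p) \<le> r k / 2" "\<delta>' (fst p) \<le> 1"
            "\<delta>' (fst p) \<le> infdist (fst p) (- G k)" by (simp_all add: \<delta>'_def pk)
          then show "0 < \<delta>' (fst p) \<and> \<delta>' (fst p) \<le> 1 \<and> \<delta>' (fst p) < \<delta> k (fst p) \<and> 2 * \<delta>' (fst p) \<le> r k"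
            using pos by auto
          have sub: "snd p \<subseteq> sym_ball \<delta>' (fst p)" using P(2) pP unfolding fine_def by force
          have "sym_ball \<delta>' (fst p) \<subseteq> cball (fst p) (\<delta>' (fst p))"
            by (auto simp: sym_ball_def cball_eq_atLeastAtMost)
          with sub show "snd p \<subseteq> {0..1} \<inter> cball (fst p) (\<delta>' (fst p))"
            using PD(3)[OF pP] by blast
          show "\<exists>a b. snd p = {a..b}" by (rule PD(4)[OF pP])
          show "snd p \<subseteq> G k"
          proof (rule subsetI, rule ccontr)
            fix y assume y: "y \<in> snd p" "y \<notin> G k"
            then have "infdist (fst p) (- G k) \<le> dist (fst p) y" by (intro infdist_le) simp
            also have "\<dots> < \<delta>' (fst p)" using subsetD[OF sub y(1)] by (auto simp: sym_ball_def dist_real_def)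
            finally show False using le(4) by simp
          qed
        qed (use PD(1) b(1)[of k] e[of k] H[of k] GH in \<open>auto simp: C_def\<close>)
        also have "40 * b k * (2 * c k) / e k = e k" using c(2)[of k] by simp
        also have "b k * measure lebesgue (G k - H k) \<le> b k * \<eta> k" using G(4)[of k] b(1)[of k] by (simp add: mult_left_mono)
        also have "\<dots> \<le> e k" by (rule \<eta>(2))
        also have "(LINT y:(G k - H k) \<inter> {0..1}|lebesgue. \<bar>?f y\<bar>) \<le> e k"
        proof (rule \<eta>(3))
          have "measure lebesgue ((G k - H k) \<inter> {0..1}) \<le> measure lebesgue (G k - H k)"
            by (rule measure_mono_fmeasurable) (use GH in auto)
          then show "measure lebesgue ((G k - H k) \<inter> {0..1}) < \<eta> k" using G(4)[of k] by simp
        qed (use GH in auto)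
        finally show ?thesis by simp
      qed
      have wx: "apply_bcontfun w x = (\<Sum>p\<in>P. LINT y:snd p|lebesgue. ?f y)"
      proof -
        have "apply_bcontfun w x = (LINT y:{0..1}|lebesgue. ?f y)"
          using set_lebesgue_integral_eq_integral(2)[OF int, of x] integral_unique[OF hi, of x] by simp
        also have "\<dots> = (LINT y:(\<Union>p\<in>P. snd p)|lebesgue. ?f y)" by (simp only: PD(6))
        also have "\<dots> = (\<Sum>p\<in>P. LINT y:snd p|lebesgue. ?f y)"
        proof (rule set_integral_finite_UN_AE_disjoint[OF PD(1) ae])
          fix p assume p: "p \<in> P"
          show m: "snd p \<in> sets lebesgue" using PD(4)[OF p] by auto
          show "set_integrable lebesgue (snd p) ?f" by (rule set_integrable_subset[OF int m PD(3)[OF p]])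
        qed
        finally show ?thesis .
      qed
      have "dist (apply_bcontfun (gauge_sum g P) x) (apply_bcontfun w x) =
          \<bar>\<Sum>p\<in>P. measure lebesgue (snd p) * ?f (fst p) - (LINT y:snd p|lebesgue. ?f y)\<bar>"
        unfolding wx apply_gauge_sum dist_real_def by (simp add: sum_subtractf case_prod_beta)
      also have "\<dots> \<le> (\<Sum>p\<in>P. ?h p)" by (rule sum_abs)
      \<comment> \<open>Tags are grouped by their piece. A partition meets finitely many pieces, but
        which ones is unknown, so the bound is by the full series.\<close>
      also have "\<dots> = (\<Sum>k\<in>(\<lambda>p. \<kappa> (fst p)) ` P. \<Sum>p\<in>{p \<in> P. \<kappa> (fst p) = k}. ?h p)"
        by (rule sum.group[symmetric]) (use PD(1) in auto)
      also have "\<dots> \<le> (\<Sum>k\<in>(\<lambda>p. \<kappa> (fst p)) ` P. 4 * e k)" by (rule sum_mono) (rule piece)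
      also have "\<dots> = 4 * \<epsilon> / 10 * (\<Sum>k\<in>(\<lambda>p. \<kappa> (fst p)) ` P. (1/2) ^ k)"
        by (simp add: e_def sum_distrib_left mult.assoc)
      also have "\<dots> \<le> 4 * \<epsilon> / 10 * (\<Sum>k. (1/2) ^ k)"
        by (intro mult_left_mono sum_le_suminf summable_geometric) (use PD(1) \<epsilon> in auto)
      also have "\<dots> = 8 * \<epsilon> / 10" by (simp add: suminf_geometric)
      finally show ?thesis .
    qed
    then have "dist (gauge_sum g P) w \<le> 8 * \<epsilon> / 10" by (rule dist_bound)
    then show ?thesis using \<epsilon> by (simp add: dist_commute)
  qed
  then show ?thesis using Gd' unfolding riemann_close_def by blast
qed

subsection \<open>The indefinite McShane integral\<close>

lemma negligible_Int_nonoverlap: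
  fixes a b c d :: real
  assumes "interior {a..b} \<inter> interior {c..d} = {}"
  shows "negligible ({a..b} \<inter> {c..d})"
proof (rule negligible_subset)
  show "negligible (frontier {a..b} \<union> frontier {c..d})"
    by (intro negligible_Un negligible_convex_frontier) auto
  show "{a..b} \<inter> {c..d} \<subseteq> frontier {a..b} \<union> frontier {c..d}"
    using assms closure_subset unfolding frontier_def by blast
qed

text \<open>Both families of tags are completed by the same Perron partition of the complement, which
  cancels in the difference.\<close>

lemma McShane_retag:
  fixes g :: "real \<Rightarrow> 'y::real_normed_vector" and a b t s :: "'i \<Rightarrow> real"
  assumes pos: "positive_gauge \<delta>" and rc: "riemann_close g w partition_01 \<delta> \<epsilon>"
    and N: "finite N" and ab: "\<And>i. i \<in> N \<Longrightarrow> a i < b i" and sub: "\<And>i. i \<in> N \<Longrightarrow> {a i..b i} \<subseteq> {0..1}"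
    and dis: "\<And>i j. i \<in> N \<Longrightarrow> j \<in> N \<Longrightarrow> i \<noteq> j \<Longrightarrow> interior {a i..b i} \<inter> interior {a j..b j} = {}"
    and t: "\<And>i. i \<in> N \<Longrightarrow> t i \<in> {0..1} \<and> {a i..b i} \<subseteq> sym_ball \<delta> (t i)"
    and s: "\<And>i. i \<in> N \<Longrightarrow> s i \<in> {0..1} \<and> {a i..b i} \<subseteq> sym_ball \<delta> (s i)"
  shows "norm (\<Sum>i\<in>N. (b i - a i) *\<^sub>R (g (t i) - g (s i))) \<le> 2 * \<epsilon>"
proof -
  define I where "I i = {a i..b i}" for i
  have I: "\<exists>c d. I i = cbox c d" "I i \<subseteq> {0..1}" "interior (I i) \<noteq> {}" "I i \<noteq> {}" "measure lebesgue (I i) = b i - a i"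
    if "i \<in> N" for i
    using ab[OF that] sub[OF that] unfolding I_def by (auto simp: cbox_interval less_imp_le)
  have Idis: "interior (I i) \<inter> interior (I j) = {}" if "i \<in> N" "j \<in> N" "i \<noteq> j" for i j
    unfolding I_def by (rule dis[OF that])
  \<comment> \<open>Strictly positive lengths are needed here: equal one-point intervals would merge
    in the set of intervals.\<close>
  have inj: "inj_on I N"
  proof (rule inj_onI, rule ccontr)
    fix i j assume "i \<in> N" "j \<in> N" "I i = I j" "i \<noteq> j"
    then show False using Idis[of i j] I(3)[of i] by simp
  qed
  have "I ` N division_of \<Union>(I ` N)"
  proof (rule division_ofI)
    fix K1 K2 assume "K1 \<in> I ` N" "K2 \<in> I ` N" "K1 \<noteq> K2"
    then show "interior K1 \<inter> interior K2 = {}" using Idis by blast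
  qed (use N I in auto)
  moreover have "\<Union>(I ` N) \<subseteq> cbox 0 1" using I(2) by (auto simp: cbox_interval)
  ultimately obtain q where q: "I ` N \<subseteq> q" "q division_of cbox (0::real) 1"
    using partial_division_extend_interval by metis
  note qD = division_ofD[OF q(2)]
  let ?\<gamma> = "\<lambda>t. if t \<in> {0..1} then sym_ball \<delta> t else UNIV"
  have \<gamma>: "gauge ?\<gamma>" by (rule gauge_extend_01) (use pos in \<open>simp add: positive_gauge_def\<close>)
  have "\<exists>p. p tagged_division_of K \<and> ?\<gamma> fine p" if "K \<in> q - I ` N" for K
    using qD(4)[of K] that fine_division_exists[OF \<gamma>] by (metis DiffD1)
  then obtain pf where pf: "\<And>K. K \<in> q - I ` N \<Longrightarrow> pf K tagged_division_of K" "\<And>K. K \<in> q - I ` N \<Longrightarrow> ?\<gamma> fine pf K"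
    by metis
  define p where "p = \<Union>(pf ` (q - I ` N))"
  have p: "p tagged_division_of \<Union>(q - I ` N)"
    unfolding p_def by (rule tagged_division_Union) (use qD pf in auto)
  note pD = tagged_division_ofD[OF p]
  have qU: "\<Union>(q - I ` N) \<subseteq> {0..1}" using qD(2) by (auto simp: cbox_interval)
  have pK: "\<exists>K'\<in>q - I ` N. K \<subseteq> K'" if "(u, K) \<in> p" for u K
    using that tagged_division_ofD(3)[OF pf(1)] unfolding p_def by blast
  have pt: "u \<in> {0..1}" if "(u, K) \<in> p" for u K using pD(2,3)[OF that] qU by blast
  have pfine: "sym_ball \<delta> fine p"
  proof (rule fineI)
    fix u K assume uK: "(u, K) \<in> p"
    then obtain K' where "K' \<in> q - I ` N" "(u, K) \<in> pf K'" unfolding p_def by blast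
    then have "K \<subseteq> ?\<gamma> u" using fineD[OF pf(2)] by blast
    then show "K \<subseteq> sym_ball \<delta> u" using pt[OF uK] by simp
  qed
  have intdis: "interior (I i) \<inter> interior K = {}" if i: "i \<in> N" and uK: "(u, K) \<in> p" for i u K
  proof -
    obtain K' where K': "K' \<in> q - I ` N" "K \<subseteq> K'" using pK[OF uK] by blast
    then have "interior (I i) \<inter> interior K' = {}" using qD(5)[of "I i" K'] q(1) i by blast
    then show ?thesis using interior_mono[OF K'(2)] by blast
  qed
  have sumP: "dist w ((\<Sum>i\<in>N. (b i - a i) *\<^sub>R g (u i)) + gauge_sum g p) < \<epsilon>"
    if u: "\<And>i. i \<in> N \<Longrightarrow> u i \<in> {0..1} \<and> I i \<subseteq> sym_ball \<delta> (u i)" for u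
  proof -
    let ?A = "(\<lambda>i. (u i, I i)) ` N"
    have disj: "?A \<inter> p = {}" using intdis I(3) by fastforce
    have "partition_01 (?A \<union> p)"
      unfolding partition_01_def
    proof (intro conjI)
      show "finite (?A \<union> p)" using N pD(1) by simp
      have box: "\<exists>a b. a \<le> b \<and> K = {a..b}" if x: "x \<in> K" and K: "\<exists>a b. K = cbox a b" for x :: real and K
      proof -
        obtain a b where "K = {a..b}" using K by (auto simp: cbox_interval)
        then show ?thesis using x by (intro exI[of _ a] exI[of _ b]) auto
      qed
      show "\<forall>(t, I)\<in>?A \<union> p. t \<in> {0..1} \<and> I \<subseteq> {0..1} \<and> (\<exists>a b. a \<le> b \<and> I = {a..b})"
      proof (intro ballI, clarify)
        fix t K assume "(t, K) \<in> ?A \<union> p"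
        then consider i where "i \<in> N" "t = u i" "K = I i" | "(t, K) \<in> p" by blast
        then show "t \<in> {0..1} \<and> K \<subseteq> {0..1} \<and> (\<exists>a b. a \<le> b \<and> K = {a..b})"
        proof cases
          case 1
          have "\<exists>a b. a \<le> b \<and> K = {a..b}" unfolding 1(3) I_def using ab[OF 1(1)] less_imp_le by blast
          then show ?thesis using 1 u I(2) by blast
        next
          case 2
          have "K \<subseteq> {0..1}" using pD(3)[OF 2] qU by (rule order_trans)
          then show ?thesis using pt[OF 2] box[OF pD(2,4)[OF 2]] by blast
        qed
      qed
      show "\<forall>(t, I)\<in>?A \<union> p. \<forall>(u, J)\<in>?A \<union> p. (t, I) \<noteq> (u, J) \<longrightarrow> interior I \<inter> interior J = {}"
      proof (intro ballI, unfold split_paired_all prod.case, intro ballI impI, unfold split_paired_all prod.case, intro impI)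
        fix t1 K1 t2 K2 assume K: "(t1, K1) \<in> ?A \<union> p" "(t2, K2) \<in> ?A \<union> p" "(t1, K1) \<noteq> (t2, K2)"
        consider i j where "i \<in> N" "j \<in> N" "K1 = I i" "K2 = I j" "t1 = u i" "t2 = u j"
          | i where "i \<in> N" "K1 = I i" "(t2, K2) \<in> p" | i where "i \<in> N" "K2 = I i" "(t1, K1) \<in> p"
          | "(t1, K1) \<in> p" "(t2, K2) \<in> p" using K by blast
        then show "interior K1 \<inter> interior K2 = {}"
        proof cases
          case 1
          then have "i \<noteq> j" using K(3) by blast
          then show ?thesis using Idis 1 by simp
        next
          case 2
          then show ?thesis using intdis by simp
        next
          case 3
          then show ?thesis using intdis by (simp add: Int_commute)
        next
          case 4
          then show ?thesis using pD(5)[of t1 K1 t2 K2] K(3) by blast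
        qed
      qed
      have "\<Union>(snd ` p) = \<Union>{K. \<exists>x. (x, K) \<in> p}" by force
      also have "\<dots> = \<Union>(q - I ` N)" by (rule pD(6))
      finally have "\<Union>(snd ` (?A \<union> p)) = \<Union>(I ` N) \<union> \<Union>(q - I ` N)" by (simp add: image_Un image_image)
      also have "\<dots> = \<Union>q" using q(1) by blast
      finally show "\<Union>(snd ` (?A \<union> p)) = {0..1}" using qD(6) by (simp add: cbox_interval)
    qed
    moreover have "sym_ball \<delta> fine (?A \<union> p)" using pfine u by (auto simp: fine_def)
    ultimately have "dist w (gauge_sum g (?A \<union> p)) < \<epsilon>" using rc by (simp add: riemann_close_def)
    moreover have "gauge_sum g (?A \<union> p) = gauge_sum g ?A + gauge_sum g p"
      unfolding gauge_sum_def by (rule sum.union_disjoint) (use N pD(1) disj in auto)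
    moreover have "gauge_sum g ?A = (\<Sum>i\<in>N. (b i - a i) *\<^sub>R g (u i))"
    proof -
      have "inj_on (\<lambda>i. (u i, I i)) N" using inj by (auto simp: inj_on_def)
      then show ?thesis unfolding gauge_sum_def by (simp add: sum.reindex I(5))
    qed
    ultimately show ?thesis by simp
  qed
  let ?T = "\<Sum>i\<in>N. (b i - a i) *\<^sub>R g (t i)" and ?S = "\<Sum>i\<in>N. (b i - a i) *\<^sub>R g (s i)"
  have "dist w (?T + gauge_sum g p) < \<epsilon>" "dist w (?S + gauge_sum g p) < \<epsilon>"
    using sumP[of t] sumP[of s] t s by (simp_all add: I_def)
  then have "dist (?T + gauge_sum g p) (?S + gauge_sum g p) < 2 * \<epsilon>"
    using dist_triangle3[of "?T + gauge_sum g p" "?S + gauge_sum g p" w] by linarith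
  then have "norm (?T - ?S) < 2 * \<epsilon>" by (simp add: dist_norm)
  then show ?thesis by (simp add: scaleR_diff_right sum_subtractf)
qed

text \<open>Only the lengths matter: shrinking the intervals realises arbitrary smaller weights.\<close>

lemma McShane_retag_weighted:
  fixes g :: "real \<Rightarrow> 'y::real_normed_vector" and a b t s v :: "'i \<Rightarrow> real"
  assumes pos: "positive_gauge \<delta>" and rc: "riemann_close g w partition_01 \<delta> \<epsilon>"
    and N: "finite N" and v: "\<And>i. i \<in> N \<Longrightarrow> 0 \<le> v i \<and> v i \<le> measure lebesgue {a i..b i}"
    and sub: "\<And>i. i \<in> N \<Longrightarrow> {a i..b i} \<subseteq> {0..1}"
    and dis: "\<And>i j. i \<in> N \<Longrightarrow> j \<in> N \<Longrightarrow> i \<noteq> j \<Longrightarrow> interior {a i..b i} \<inter> interior {a j..b j} = {}"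
    and t: "\<And>i. i \<in> N \<Longrightarrow> t i \<in> {0..1} \<and> {a i..b i} \<subseteq> sym_ball \<delta> (t i)"
    and s: "\<And>i. i \<in> N \<Longrightarrow> s i \<in> {0..1} \<and> {a i..b i} \<subseteq> sym_ball \<delta> (s i)"
  shows "norm (\<Sum>i\<in>N. v i *\<^sub>R (g (t i) - g (s i))) \<le> 2 * \<epsilon>"
proof -
  \<comment> \<open>Zero weights would give one-point intervals, so they are removed first.\<close>
  let ?N = "{i \<in> N. 0 < v i}"
  have le: "{a i..a i + v i} \<subseteq> {a i..b i}" if "i \<in> ?N" for i
    using v[of i] that by (cases "a i \<le> b i") auto
  have "norm (\<Sum>i\<in>?N. (a i + v i - a i) *\<^sub>R (g (t i) - g (s i))) \<le> 2 * \<epsilon>"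
  proof (rule McShane_retag[OF pos rc])
    fix i assume i: "i \<in> ?N"
    show "a i < a i + v i" using i by simp
    show "{a i..a i + v i} \<subseteq> {0..1}" using le[OF i] sub i by blast
    show "t i \<in> {0..1} \<and> {a i..a i + v i} \<subseteq> sym_ball \<delta> (t i)" using le[OF i] t i by blast
    show "s i \<in> {0..1} \<and> {a i..a i + v i} \<subseteq> sym_ball \<delta> (s i)" using le[OF i] s i by blast
    fix j assume j: "j \<in> ?N" "i \<noteq> j"
    then have "interior {a i..b i} \<inter> interior {a j..b j} = {}" using i dis by simp
    then show "interior {a i..a i + v i} \<inter> interior {a j..a j + v j} = {}"
      using interior_mono[OF le[OF i]] interior_mono[OF le[OF j(1)]] by blast
  qed (use N in auto)
  moreover have "(\<Sum>i\<in>?N. v i *\<^sub>R (g (t i) - g (s i))) = (\<Sum>i\<in>N. v i *\<^sub>R (g (t i) - g (s i)))"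
    by (rule sum.mono_neutral_left[OF N]) (use v in \<open>auto simp: less_le\<close>)
  ultimately show ?thesis by simp
qed

section \<open>Step functions of fine partitions\<close>

text \<open>The integral over \<open>E\<close> of the step function with value \<open>g t\<close> on
  \<open>I\<close>.\<close>

definition step_sum :: "(real \<Rightarrow> 'y::real_vector) \<Rightarrow> (real \<times> real set) set \<Rightarrow> real set \<Rightarrow> 'y" where
  "step_sum g P E = (\<Sum>(t, I)\<in>P. measure lebesgue (E \<inter> I) *\<^sub>R g t)"

lemma lmeasurable_01: "E \<in> sets lebesgue \<Longrightarrow> E \<subseteq> {0..1::real} \<Longrightarrow> E \<in> lmeasurable"
  by (rule bounded_set_imp_lmeasurable[OF bounded_subset[OF bounded_closed_interval]])

lemma measure_tagged_split:
  fixes p :: "(real \<times> real set) set"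
  assumes p: "p tagged_partial_division_of {0..1}" and E: "E \<in> sets lebesgue" "E \<subseteq> \<Union>(snd ` p)"
  shows "measure lebesgue E = (\<Sum>x\<in>p. measure lebesgue (E \<inter> snd x))"
proof -
  note pD = tagged_partial_division_ofD[OF p]
  have box: "\<exists>a b. snd x = {a..b}" "snd x \<subseteq> {0..1}" if "x \<in> p" for x
    using pD(3,4)[of "fst x" "snd x"] that by (auto simp: cbox_interval)
  have sx: "snd x \<in> sets lebesgue" if "x \<in> p" for x using box(1)[OF that] by auto
  have "measure lebesgue (\<Union>x\<in>p. E \<inter> snd x) = (\<Sum>x\<in>p. measure lebesgue (E \<inter> snd x))"
  proof (rule measure_negligible_finite_Union_image[OF pD(1)])
    fix x assume x: "x \<in> p"
    show "E \<inter> snd x \<in> lmeasurable" by (rule lmeasurable_01) (use E(1) sx[OF x] box(2)[OF x] in auto)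
  next
    show "pairwise (\<lambda>x y. negligible (E \<inter> snd x \<inter> (E \<inter> snd y))) p"
    proof (rule pairwiseI)
      fix x y assume xy: "x \<in> p" "y \<in> p" "x \<noteq> y"
      obtain a b c d where e: "snd x = {a..b}" "snd y = {c..d}" using box(1) xy by meson
      have "interior (snd x) \<inter> interior (snd y) = {}"
        using pD(5)[of "fst x" "snd x" "fst y" "snd y"] xy by simp
      then have "negligible (snd x \<inter> snd y)" unfolding e by (rule negligible_Int_nonoverlap)
      then show "negligible (E \<inter> snd x \<inter> (E \<inter> snd y))" by (rule negligible_subset) auto
    qed
  qed
  moreover have "(\<Union>x\<in>p. E \<inter> snd x) = E" using E(2) by auto
  ultimately show ?thesis by simp
qed

text \<open>On the common refinement both tags are fine for every cell, so the difference is a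
  weighted retagging with the measures of \<open>E\<close> in the cells as weights. The bound does
  not depend on \<open>E\<close>, which is the source of all uniformity below.\<close>

lemma step_sum_compare:
  fixes g :: "real \<Rightarrow> 'y::real_normed_vector"
  assumes pos: "positive_gauge \<delta>" and rc: "riemann_close g w partition_01 \<delta> \<epsilon>"
    and P: "P tagged_partial_division_of {0..1}" "sym_ball \<delta> fine P"
    and p: "p tagged_partial_division_of {0..1}" "sym_ball \<delta> fine p"
    and E: "E \<in> sets lebesgue" "E \<subseteq> \<Union>(snd ` P)" "E \<subseteq> \<Union>(snd ` p)"
  shows "norm (step_sum g P E - step_sum g p E) \<le> 2 * \<epsilon>"
proof -
  note PD = tagged_partial_division_ofD[OF P(1)] and pD = tagged_partial_division_ofD[OF p(1)]
  have box: "\<exists>a b. snd x = {a..b}" "snd x \<subseteq> {0..1}" "fst x \<in> {0..1}" if "x \<in> Q" "Q tagged_partial_division_of {0..1}"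
    for x and Q :: "(real \<times> real set) set"
    using tagged_partial_division_ofD(2,3,4)[OF that(2), of "fst x" "snd x"] that(1) by (auto simp: cbox_interval)
  have fin: "snd x \<subseteq> sym_ball \<delta> (fst x)" if "x \<in> Q" "sym_ball \<delta> fine Q" for x Q
    using fineD[OF that(2), of "fst x" "snd x"] that(1) by simp
  have dis: "interior (snd x) \<inter> interior (snd y) = {}"
    if "x \<in> Q" "y \<in> Q" "x \<noteq> y" "Q tagged_partial_division_of {0..1}" for x y and Q :: "(real \<times> real set) set"
    using tagged_partial_division_ofD(5)[OF that(4), of "fst x" "snd x" "fst y" "snd y"] that by simp
  have "\<exists>a b. snd (fst z) \<inter> snd (snd z) = {a..b}" if z: "z \<in> P \<times> p" for z
  proof -
    obtain a b c d where "snd (fst z) = {a..b}" "snd (snd z) = {c..d}"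
      using box(1)[OF _ P(1), of "fst z"] box(1)[OF _ p(1), of "snd z"] z by (metis mem_Times_iff)
    then have "snd (fst z) \<inter> snd (snd z) = {max a c..min b d}" by (simp only: Int_atLeastAtMost)
    then show ?thesis by blast
  qed
  then obtain a b where ab: "\<And>z. z \<in> P \<times> p \<Longrightarrow> snd (fst z) \<inter> snd (snd z) = {a z..b z}" by metis
  let ?v = "\<lambda>z. measure lebesgue (E \<inter> {a z..b z})"
  have "norm (\<Sum>z\<in>P \<times> p. ?v z *\<^sub>R (g (fst (fst z)) - g (fst (snd z)))) \<le> 2 * \<epsilon>"
  proof (rule McShane_retag_weighted[OF pos rc])
    show "finite (P \<times> p)" using PD(1) pD(1) by simp
    fix z assume z: "z \<in> P \<times> p"
    then have z': "fst z \<in> P" "snd z \<in> p" by auto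
    show "0 \<le> ?v z \<and> ?v z \<le> measure lebesgue {a z..b z}"
      using measure_mono_fmeasurable[of "E \<inter> {a z..b z}" "{a z..b z}" lebesgue] E(1) by auto
    show "{a z..b z} \<subseteq> {0..1}" using ab[OF z] box(2)[OF z'(1) P(1)] by blast
    show "fst (fst z) \<in> {0..1} \<and> {a z..b z} \<subseteq> sym_ball \<delta> (fst (fst z))"
      using ab[OF z] box(3)[OF z'(1) P(1)] fin[OF z'(1) P(2)] by blast
    show "fst (snd z) \<in> {0..1} \<and> {a z..b z} \<subseteq> sym_ball \<delta> (fst (snd z))"
      using ab[OF z] box(3)[OF z'(2) p(1)] fin[OF z'(2) p(2)] by blast
    fix z1 assume z1: "z1 \<in> P \<times> p" "z \<noteq> z1"
    then have z1': "fst z1 \<in> P" "snd z1 \<in> p" by auto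
    have "fst z \<noteq> fst z1 \<or> snd z \<noteq> snd z1" using z1(2) by (simp add: prod_eq_iff)
    then have "interior (snd (fst z)) \<inter> interior (snd (fst z1)) = {} \<or> interior (snd (snd z)) \<inter> interior (snd (snd z1)) = {}"
      using dis[OF z'(1) z1'(1) _ P(1)] dis[OF z'(2) z1'(2) _ p(1)] by blast
    then show "interior {a z..b z} \<inter> interior {a z1..b z1} = {}"
      unfolding ab[OF z, symmetric] ab[OF z1(1), symmetric] interior_Int by blast
  qed
  also have "(\<Sum>z\<in>P \<times> p. ?v z *\<^sub>R (g (fst (fst z)) - g (fst (snd z)))) =
      (\<Sum>x\<in>P. \<Sum>y\<in>p. measure lebesgue (E \<inter> snd x \<inter> snd y) *\<^sub>R g (fst x)) -
      (\<Sum>x\<in>P. \<Sum>y\<in>p. measure lebesgue (E \<inter> snd x \<inter> snd y) *\<^sub>R g (fst y))"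
  proof -
    have "(\<Sum>z\<in>P \<times> p. ?v z *\<^sub>R (g (fst (fst z)) - g (fst (snd z)))) =
        (\<Sum>z\<in>P \<times> p. measure lebesgue (E \<inter> snd (fst z) \<inter> snd (snd z)) *\<^sub>R (g (fst (fst z)) - g (fst (snd z))))"
      by (rule sum.cong[OF refl]) (simp only: ab[symmetric] Int_assoc)
    also have "\<dots> = (\<Sum>x\<in>P. \<Sum>y\<in>p. measure lebesgue (E \<inter> snd x \<inter> snd y) *\<^sub>R (g (fst x) - g (fst y)))"
      by (simp add: sum.cartesian_product case_prod_beta)
    finally show ?thesis by (simp add: scaleR_diff_right sum_subtractf)
  qed
  also have "(\<Sum>x\<in>P. \<Sum>y\<in>p. measure lebesgue (E \<inter> snd x \<inter> snd y) *\<^sub>R g (fst x)) = step_sum g P E"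
    unfolding step_sum_def case_prod_beta
  proof (rule sum.cong[OF refl])
    fix x assume x: "x \<in> P"
    have "measure lebesgue (E \<inter> snd x) = (\<Sum>y\<in>p. measure lebesgue (E \<inter> snd x \<inter> snd y))"
      by (rule measure_tagged_split[OF p(1)]) (use E box(1)[OF x P(1)] in auto)
    then show "(\<Sum>y\<in>p. measure lebesgue (E \<inter> snd x \<inter> snd y) *\<^sub>R g (fst x)) = measure lebesgue (E \<inter> snd x) *\<^sub>R g (fst x)"
      by (simp add: scaleR_sum_left)
  qed
  also have "(\<Sum>x\<in>P. \<Sum>y\<in>p. measure lebesgue (E \<inter> snd x \<inter> snd y) *\<^sub>R g (fst y)) = step_sum g p E"
    unfolding step_sum_def case_prod_beta
  proof (subst sum.swap, rule sum.cong[OF refl])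
    fix y assume y: "y \<in> p"
    have "measure lebesgue (E \<inter> snd y) = (\<Sum>x\<in>P. measure lebesgue (E \<inter> snd y \<inter> snd x))"
      by (rule measure_tagged_split[OF P(1)]) (use E box(1)[OF y p(1)] in auto)
    also have "\<dots> = (\<Sum>x\<in>P. measure lebesgue (E \<inter> snd x \<inter> snd y))" by (simp only: Int_assoc Int_commute[of "snd y"])
    finally show "(\<Sum>x\<in>P. measure lebesgue (E \<inter> snd x \<inter> snd y) *\<^sub>R g (fst y)) = measure lebesgue (E \<inter> snd y) *\<^sub>R g (fst y)"
      by (simp add: scaleR_sum_left)
  qed
  finally show ?thesis .
qed

lemma riemann_close_mono:
  assumes "riemann_close g w Q d \<epsilon>" "\<And>t. t \<in> {0..1} \<Longrightarrow> d' t \<le> d t"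
    and "\<And>P t I. Q P \<Longrightarrow> (t, I) \<in> P \<Longrightarrow> t \<in> {0..1}"
  shows "riemann_close g w Q d' \<epsilon>"
  unfolding riemann_close_def
proof (intro allI impI)
  fix P assume P: "Q P" "sym_ball d' fine P"
  have "sym_ball d fine P"
  proof (rule fineI)
    fix t I assume tI: "(t, I) \<in> P"
    have "I \<subseteq> sym_ball d' t" by (rule fineD[OF P(2) tI])
    also have "\<dots> \<subseteq> sym_ball d t" using assms(2)[OF assms(3)[OF P(1) tI]] by (auto simp: sym_ball_def)
    finally show "I \<subseteq> sym_ball d t" .
  qed
  then show "dist w (gauge_sum g P) < \<epsilon>" using assms(1) P(1) by (simp add: riemann_close_def)
qed

lemma McShane_indefinite:
  fixes g :: "real \<Rightarrow> 'y::{real_normed_vector, complete_space}"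
  assumes McS: "\<And>\<epsilon>. 0 < \<epsilon> \<Longrightarrow> \<exists>\<delta>. positive_gauge \<delta> \<and> riemann_close g w partition_01 \<delta> \<epsilon>"
  obtains \<delta> P \<nu> where "\<And>n::nat. positive_gauge (\<delta> n)" "\<And>n. riemann_close g w partition_01 (\<delta> n) ((1/2) ^ n)"
    "\<And>n. P n tagged_division_of {0..1}" "\<And>n. sym_ball (\<delta> n) fine P n"
    "\<And>n E. E \<in> sets lebesgue \<Longrightarrow> E \<subseteq> {0..1} \<Longrightarrow> norm (step_sum g (P n) E - \<nu> E) \<le> 2 * (1/2) ^ n"
proof -
  have "\<exists>d. positive_gauge d \<and> riemann_close g w partition_01 d ((1/2) ^ n)" for n :: nat using McS by simp
  then obtain d where d: "\<And>n. positive_gauge (d n)" "\<And>n::nat. riemann_close g w partition_01 (d n) ((1/2) ^ n)"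
    by metis
  \<comment> \<open>Taking minima makes the gauges decrease, so a later partition is fine for every
    earlier gauge and can be compared with the earlier one.\<close>
  define \<delta> where "\<delta> n t = Min ((\<lambda>m. d m t) ` {..n})" for n t
  have pos: "positive_gauge (\<delta> n)" for n using d(1) by (auto simp: positive_gauge_def \<delta>_def)
  have mono: "\<delta> m t \<le> \<delta> n t" if "n \<le> m" for m n t
    unfolding \<delta>_def using that by (intro Min_antimono image_mono) auto
  have tag: "t \<in> {0..1}" if "partition_01 Q" "(t, I) \<in> Q" for Q t I
    using partition_01D(2)[OF that] by simp
  have rc: "riemann_close g w partition_01 (\<delta> n) ((1/2) ^ n)" for n
    by (rule riemann_close_mono[OF d(2) _ tag]) (auto simp: \<delta>_def)
  have "\<exists>p. p tagged_division_of {0..1} \<and> sym_ball (\<delta> n) fine p" for n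
  proof -
    obtain p where p: "p tagged_division_of {0..1::real}" "(\<lambda>t. if t \<in> {0..1} then sym_ball (\<delta> n) t else UNIV) fine p"
      by (rule fine_division_exists_real[OF gauge_extend_01[of "\<delta> n"]]) (use pos in \<open>simp add: positive_gauge_def\<close>)
    then have "sym_ball (\<delta> n) fine p"
      by (intro fine_extend_01[THEN iffD1, OF tagged_division_ofD(3)[OF p(1)] tagged_division_ofD(2)[OF p(1)]])
    then show ?thesis using p(1) by blast
  qed
  then obtain P where P: "\<And>n. P n tagged_division_of {0..1}" "\<And>n. sym_ball (\<delta> n) fine P n" by metis
  have PU: "\<Union>(snd ` P n) = {0..1}" for n using tagged_division_ofD(6)[OF P(1)[of n]] by force
  have cmp: "norm (step_sum g (P n) E - step_sum g (P m) E) \<le> 2 * (1/2) ^ n"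
    if E: "E \<in> sets lebesgue" "E \<subseteq> {0..1}" and nm: "n \<le> m" for n m E
  proof (rule step_sum_compare[OF pos rc])
    show "sym_ball (\<delta> n) fine P m"
    proof (rule fineI)
      fix t I assume "(t, I) \<in> P m"
      then have "I \<subseteq> sym_ball (\<delta> m) t" by (rule fineD[OF P(2)])
      then show "I \<subseteq> sym_ball (\<delta> n) t" using mono[OF nm, of t] by (auto simp: sym_ball_def)
    qed
    show "P n tagged_partial_division_of {0..1}" "P m tagged_partial_division_of {0..1}"
      using P(1) unfolding tagged_division_of_def by blast+
    show "E \<subseteq> \<Union>(snd ` P n)" "E \<subseteq> \<Union>(snd ` P m)" using E(2) by (simp_all only: PU)
  qed (fact P(2), fact E(1))
  define \<nu> where "\<nu> E = lim (\<lambda>n. step_sum g (P n) E)" for E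
  have lim: "(\<lambda>n. step_sum g (P n) E) \<longlonglongrightarrow> \<nu> E" if E: "E \<in> sets lebesgue" "E \<subseteq> {0..1}" for E
  proof -
    have "Cauchy (\<lambda>n. step_sum g (P n) E)"
    proof (rule CauchyI)
      fix e :: real assume e: "0 < e"
      obtain N where N: "2 * (1/2) ^ N < e / 2"
        using real_arch_pow_inv[of "e / 4" "1/2"] e by (auto simp: mult.commute)
      have "norm (step_sum g (P m) E - step_sum g (P n) E) < e" if "N \<le> m" "N \<le> n" for m n
      proof -
        have "norm (step_sum g (P m) E - step_sum g (P n) E) \<le>
            norm (step_sum g (P N) E - step_sum g (P m) E) + norm (step_sum g (P N) E - step_sum g (P n) E)"
          using norm_triangle_ineq4[of "step_sum g (P N) E - step_sum g (P n) E" "step_sum g (P N) E - step_sum g (P m) E"] by simp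
        then show ?thesis using cmp[OF E that(1)] cmp[OF E that(2)] N by linarith
      qed
      then show "\<exists>M. \<forall>m\<ge>M. \<forall>n\<ge>M. norm (step_sum g (P m) E - step_sum g (P n) E) < e" by blast
    qed
    then show ?thesis unfolding \<nu>_def by (simp add: Cauchy_convergent_iff convergent_LIMSEQ_iff)
  qed
  have "norm (step_sum g (P n) E - \<nu> E) \<le> 2 * (1/2) ^ n" if E: "E \<in> sets lebesgue" "E \<subseteq> {0..1}" for n E
  proof (rule LIMSEQ_le_const2)
    show "(\<lambda>m. norm (step_sum g (P n) E - step_sum g (P m) E)) \<longlonglongrightarrow> norm (step_sum g (P n) E - \<nu> E)"
      by (intro tendsto_intros lim[OF E])
    show "\<exists>N. \<forall>m\<ge>N. norm (step_sum g (P n) E - step_sum g (P m) E) \<le> 2 * (1/2) ^ n"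
      using cmp[OF E] by blast
  qed
  then show thesis using that[OF pos rc P] by blast
qed

lemma tagged_division_01D:
  assumes "P tagged_division_of {0..1::real}" "x \<in> P"
  shows "snd x \<subseteq> {0..1}" "snd x \<in> sets lebesgue" "\<exists>a b. snd x = {a..b}"
  using tagged_division_ofD(3,4)[OF assms(1), of "fst x" "snd x"] assms(2) by (auto simp: cbox_interval)

section \<open>The limit as a vector measure\<close>

lemma step_sum_finite_UN:
  fixes g :: "real \<Rightarrow> 'y::real_normed_vector"
  assumes P: "P tagged_division_of {0..1}" and A: "finite A"
    and E: "\<And>i. i \<in> A \<Longrightarrow> E i \<in> sets lebesgue \<and> E i \<subseteq> {0..1}"
    and neg: "pairwise (\<lambda>i j. negligible (E i \<inter> E j)) A"
  shows "step_sum g P (\<Union>i\<in>A. E i) = (\<Sum>i\<in>A. step_sum g P (E i))"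
proof -
  have "measure lebesgue ((\<Union>i\<in>A. E i) \<inter> snd x) = (\<Sum>i\<in>A. measure lebesgue (E i \<inter> snd x))" if x: "x \<in> P" for x
  proof -
    have "measure lebesgue (\<Union>i\<in>A. E i \<inter> snd x) = (\<Sum>i\<in>A. measure lebesgue (E i \<inter> snd x))"
    proof (rule measure_negligible_finite_Union_image[OF A])
      fix i assume i: "i \<in> A"
      show "E i \<inter> snd x \<in> lmeasurable"
        by (rule lmeasurable_01) (use E[OF i] tagged_division_01D[OF P x] in auto)
    next
      show "pairwise (\<lambda>i j. negligible (E i \<inter> snd x \<inter> (E j \<inter> snd x))) A"
        using neg unfolding pairwise_def by (auto intro: negligible_subset)
    qed
    moreover have "(\<Union>i\<in>A. E i) \<inter> snd x = (\<Union>i\<in>A. E i \<inter> snd x)" by blast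
    ultimately show ?thesis by (simp only:)
  qed
  then have "step_sum g P (\<Union>i\<in>A. E i) = (\<Sum>x\<in>P. \<Sum>i\<in>A. measure lebesgue (E i \<inter> snd x) *\<^sub>R g (fst x))"
    unfolding step_sum_def case_prod_beta by (intro sum.cong refl) (simp add: scaleR_sum_left)
  also have "\<dots> = (\<Sum>i\<in>A. step_sum g P (E i))"
    unfolding step_sum_def case_prod_beta by (rule sum.swap)
  finally show ?thesis .
qed

lemma indefinite_LIMSEQ:
  fixes \<nu> :: "real set \<Rightarrow> 'y::real_normed_vector"
  assumes bd: "\<And>n E. E \<in> sets lebesgue \<Longrightarrow> E \<subseteq> {0..1} \<Longrightarrow> norm (step_sum g (P n) E - \<nu> E) \<le> 2 * (1/2) ^ n"
    and E: "E \<in> sets lebesgue" "E \<subseteq> {0..1}"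
  shows "(\<lambda>n. step_sum g (P n) E) \<longlonglongrightarrow> \<nu> E"
proof -
  have z: "(\<lambda>n. 2 * (1/2::real) ^ n) \<longlonglongrightarrow> 0"
    by (intro tendsto_mult_right_zero LIMSEQ_power_zero) simp
  have "(\<lambda>n. step_sum g (P n) E - \<nu> E) \<longlonglongrightarrow> 0"
    by (rule Lim_null_comparison[OF always_eventually z]) (use bd[OF E] in blast)
  then show ?thesis by (rule Lim_null[THEN iffD2])
qed

lemma indefinite_finite_UN:
  fixes \<nu> :: "real set \<Rightarrow> 'y::real_normed_vector"
  assumes P: "\<And>n. P n tagged_division_of {0..1}"
    and bd: "\<And>n E. E \<in> sets lebesgue \<Longrightarrow> E \<subseteq> {0..1} \<Longrightarrow> norm (step_sum g (P n) E - \<nu> E) \<le> 2 * (1/2) ^ n"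
    and A: "finite A" and E: "\<And>i. i \<in> A \<Longrightarrow> E i \<in> sets lebesgue \<and> E i \<subseteq> {0..1}"
    and neg: "pairwise (\<lambda>i j. negligible (E i \<inter> E j)) A"
  shows "\<nu> (\<Union>i\<in>A. E i) = (\<Sum>i\<in>A. \<nu> (E i))"
proof (rule LIMSEQ_unique)
  show "(\<lambda>n. step_sum g (P n) (\<Union>i\<in>A. E i)) \<longlonglongrightarrow> \<nu> (\<Union>i\<in>A. E i)"
    by (rule indefinite_LIMSEQ[OF bd]) (use A E in \<open>auto intro!: sets.finite_UN\<close>)
  show "(\<lambda>n. step_sum g (P n) (\<Union>i\<in>A. E i)) \<longlonglongrightarrow> (\<Sum>i\<in>A. \<nu> (E i))"
  proof -
    have "step_sum g (P n) (\<Union>i\<in>A. E i) = (\<Sum>i\<in>A. step_sum g (P n) (E i))" for n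
      by (rule step_sum_finite_UN[OF P A E neg])
    moreover have "(\<lambda>n. \<Sum>i\<in>A. step_sum g (P n) (E i)) \<longlonglongrightarrow> (\<Sum>i\<in>A. \<nu> (E i))"
      by (intro tendsto_sum indefinite_LIMSEQ[OF bd]) (use E in auto)
    ultimately show ?thesis by (simp only:)
  qed
qed

lemma indefinite_Un:
  fixes \<nu> :: "real set \<Rightarrow> 'y::real_normed_vector"
  assumes P: "\<And>n. P n tagged_division_of {0..1}"
    and bd: "\<And>n E. E \<in> sets lebesgue \<Longrightarrow> E \<subseteq> {0..1} \<Longrightarrow> norm (step_sum g (P n) E - \<nu> E) \<le> 2 * (1/2) ^ n"
    and A: "A \<in> sets lebesgue" "A \<subseteq> {0..1}" and B: "B \<in> sets lebesgue" "B \<subseteq> {0..1}" and AB: "A \<inter> B = {}"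
  shows "\<nu> (A \<union> B) = \<nu> A + \<nu> B"
proof -
  have "\<nu> (\<Union>c\<in>UNIV. if c then A else B) = (\<Sum>c\<in>UNIV. \<nu> (if c then A else B))"
    by (rule indefinite_finite_UN[OF P bd]) (use A B AB in \<open>auto simp: pairwise_def Int_commute\<close>)
  moreover have "(\<Union>c\<in>UNIV. if c then A else B) = A \<union> B" by (auto split: if_splits)
  ultimately show ?thesis by (simp add: UNIV_bool add.commute)
qed

lemma indefinite_null:
  fixes \<nu> :: "real set \<Rightarrow> 'y::real_normed_vector"
  assumes P: "\<And>n. P n tagged_division_of {0..1}"
    and bd: "\<And>n E. E \<in> sets lebesgue \<Longrightarrow> E \<subseteq> {0..1} \<Longrightarrow> norm (step_sum g (P n) E - \<nu> E) \<le> 2 * (1/2) ^ n"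
    and E: "E \<in> null_sets lebesgue" "E \<subseteq> {0..1}"
  shows "\<nu> E = 0"
proof (rule LIMSEQ_unique)
  show "(\<lambda>n. step_sum g (P n) E) \<longlonglongrightarrow> \<nu> E" by (rule indefinite_LIMSEQ[OF bd]) (use E in auto)
  have "measure lebesgue (E \<inter> snd x) = 0" if x: "x \<in> P n" for x n
  proof -
    have "E \<inter> snd x \<in> null_sets lebesgue" by (rule null_set_Int2) (use E tagged_division_01D[OF P x] in auto)
    then show ?thesis by (simp add: measure_eq_0_null_sets)
  qed
  then have "step_sum g (P n) E = 0" for n unfolding step_sum_def case_prod_beta by (simp add: sum.neutral)
  then show "(\<lambda>n. step_sum g (P n) E) \<longlonglongrightarrow> 0" by simp
qed

lemma indefinite_bounded:
  fixes \<nu> :: "real set \<Rightarrow> 'y::real_normed_vector"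
  assumes P: "\<And>n. P n tagged_division_of {0..1}"
    and bd: "\<And>n E. E \<in> sets lebesgue \<Longrightarrow> E \<subseteq> {0..1} \<Longrightarrow> norm (step_sum g (P n) E - \<nu> E) \<le> 2 * (1/2) ^ n"
  obtains B where "\<And>E. E \<in> sets lebesgue \<Longrightarrow> E \<subseteq> {0..1} \<Longrightarrow> norm (\<nu> E) \<le> B"
proof
  fix E :: "real set" assume E: "E \<in> sets lebesgue" "E \<subseteq> {0..1}"
  have "norm (step_sum g (P 0) E) \<le> (\<Sum>x\<in>P 0. norm (measure lebesgue (E \<inter> snd x) *\<^sub>R g (fst x)))"
    unfolding step_sum_def case_prod_beta by (rule norm_sum)
  also have "\<dots> \<le> (\<Sum>x\<in>P 0. norm (g (fst x)))"
  proof (rule sum_mono)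
    fix x assume x: "x \<in> P 0"
    have "measure lebesgue (E \<inter> snd x) \<le> measure lebesgue {0..1::real}"
      by (rule measure_mono_fmeasurable) (use E tagged_division_01D[OF P x] in auto)
    then show "norm (measure lebesgue (E \<inter> snd x) *\<^sub>R g (fst x)) \<le> norm (g (fst x))"
      by (simp add: mult_left_le_one_le)
  qed
  \<comment> \<open>The summand 2 is the approximation error \<open>2 * (1/2) ^ n\<close> at
    \<open>n = 0\<close>.\<close>
  finally show "norm (\<nu> E) \<le> (\<Sum>x\<in>P 0. norm (g (fst x))) + 2"
    using bd[OF E, of 0] norm_triangle_sub[of "\<nu> E" "step_sum g (P 0) E"] by (simp add: norm_minus_commute)
qed

text \<open>For a fixed partition the step sums involve finitely many intervals, so they vanish
  along the decreasing tails \<open>R N\<close>. The uniform approximation carries this over to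
  \<open>\<nu>\<close>.\<close>

lemma indefinite_countably_additive:
  fixes \<nu> :: "real set \<Rightarrow> 'y::real_normed_vector"
  assumes P: "\<And>n. P n tagged_division_of {0..1}"
    and bd: "\<And>n E. E \<in> sets lebesgue \<Longrightarrow> E \<subseteq> {0..1} \<Longrightarrow> norm (step_sum g (P n) E - \<nu> E) \<le> 2 * (1/2) ^ n"
    and E: "\<And>k::nat. E k \<in> sets lebesgue" "\<And>k. E k \<subseteq> {0..1}" and dis: "disjoint_family E"
  shows "(\<lambda>N. \<Sum>k<N. \<nu> (E k)) \<longlonglongrightarrow> \<nu> (\<Union>k. E k)"
proof -
  define R where "R N = (\<Union>k\<in>{N..}. E k)" for N
  have R: "R N \<in> sets lebesgue" "R N \<subseteq> {0..1}" for N using E by (auto simp: R_def)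
  have H: "(\<Union>k<N. E k) \<in> sets lebesgue" "(\<Union>k<N. E k) \<subseteq> {0..1}" for N using E by auto
  have split: "\<nu> (\<Union>k. E k) = (\<Sum>k<N. \<nu> (E k)) + \<nu> (R N)" for N
  proof -
    have "(\<Union>k. E k) = (\<Union>k<N. E k) \<union> R N"
      unfolding R_def UN_Un[symmetric] by (rule arg_cong[where f = "\<lambda>A. \<Union>(E ` A)"]) auto
    moreover have "(\<Union>k<N. E k) \<inter> R N = {}"
    proof -
      have "E i \<inter> E j = {}" if "i < N" "N \<le> j" for i j
        using dis that by (auto simp: disjoint_family_on_def)
      then show ?thesis unfolding R_def by blast
    qed
    moreover have "\<nu> (\<Union>k<N. E k) = (\<Sum>k<N. \<nu> (E k))"
      by (rule indefinite_finite_UN[OF P bd])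
        (use E dis in \<open>auto simp: pairwise_def disjoint_family_on_def\<close>)
    ultimately show ?thesis using indefinite_Un[OF P bd H R] by simp
  qed
  have "(\<lambda>N. \<nu> (R N)) \<longlonglongrightarrow> 0"
  proof (rule LIMSEQ_I)
    fix e :: real assume e: "0 < e"
    obtain n where n: "2 * (1/2) ^ n < e / 2"
      using real_arch_pow_inv[of "e / 4" "1/2"] e by (auto simp: mult.commute)
    have meas: "(\<lambda>N. measure lebesgue (R N \<inter> snd x)) \<longlonglongrightarrow> 0" if x: "x \<in> P n" for x
    proof -
      have "(\<lambda>N. measure lebesgue (R N \<inter> snd x)) \<longlonglongrightarrow> measure lebesgue (\<Inter>N. R N \<inter> snd x)"
      proof (rule Lim_measure_decseq)
        show "range (\<lambda>N. R N \<inter> snd x) \<subseteq> sets lebesgue" using R(1) tagged_division_01D[OF P x] by auto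
        have "R (Suc N) \<subseteq> R N" for N unfolding R_def by (intro UN_mono) auto
        then show "decseq (\<lambda>N. R N \<inter> snd x)" by (intro decseq_SucI) blast
        show "emeasure lebesgue (R N \<inter> snd x) \<noteq> \<infinity>" for N
        proof -
          have "R N \<inter> snd x \<in> lmeasurable"
            by (rule lmeasurable_01) (use R tagged_division_01D[OF P x] in auto)
          then show ?thesis by (auto simp: fmeasurable_def)
        qed
      qed
      moreover have "(\<Inter>N. R N \<inter> snd x) = {}"
      proof -
        have False if y: "\<And>N. y \<in> R N" for y
        proof -
          obtain k where k: "y \<in> E k" using y[of 0] by (auto simp: R_def)
          obtain l where "l \<in> {Suc k..}" and l: "y \<in> E l" using y[of "Suc k"] unfolding R_def by (rule UN_E)
          then have "E k \<inter> E l = {}" using dis by (auto simp: disjoint_family_on_def)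
          then show False using k l by blast
        qed
        then show ?thesis by blast
      qed
      ultimately show ?thesis by (simp only: measure_empty)
    qed
    have "(\<lambda>N. step_sum g (P n) (R N)) \<longlonglongrightarrow> (\<Sum>x\<in>P n. 0 *\<^sub>R g (fst x))"
      unfolding step_sum_def case_prod_beta by (intro tendsto_sum tendsto_scaleR tendsto_const meas)
    then have "(\<lambda>N. step_sum g (P n) (R N)) \<longlonglongrightarrow> 0" by simp
    then obtain M where M: "\<And>N. M \<le> N \<Longrightarrow> norm (step_sum g (P n) (R N)) < e / 2"
      using LIMSEQ_D[of _ 0 "e / 2"] e by (metis diff_zero half_gt_zero)
    have "norm (\<nu> (R N) - 0) < e" if "M \<le> N" for N
      using M[OF that] n bd[OF R, of n N] norm_triangle_sub[of "\<nu> (R N)" "step_sum g (P n) (R N)"]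
      by (simp add: norm_minus_commute)
    then show "\<exists>M. \<forall>N\<ge>M. norm (\<nu> (R N) - 0) < e" by blast
  qed
  then have "(\<lambda>N. \<nu> (\<Union>k. E k) - \<nu> (R N)) \<longlonglongrightarrow> \<nu> (\<Union>k. E k) - 0" by (intro tendsto_intros)
  moreover have "\<nu> (\<Union>k. E k) - \<nu> (R N) = (\<Sum>k<N. \<nu> (E k))" for N using split[of N] by simp
  ultimately show ?thesis by simp
qed

text \<open>Step sums are combinations of values of \<open>g\<close> with nonnegative coefficients.
  With the range of the embedding as the cone, \<open>\<nu> E\<close> is recognised as an embedded
  set.\<close>

lemma indefinite_in_closed_cone:
  fixes \<nu> :: "real set \<Rightarrow> 'y::real_normed_vector"
  assumes P: "\<And>n. P n tagged_division_of {0..1}"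
    and bd: "\<And>n E. E \<in> sets lebesgue \<Longrightarrow> E \<subseteq> {0..1} \<Longrightarrow> norm (step_sum g (P n) E - \<nu> E) \<le> 2 * (1/2) ^ n"
    and Z: "closed Z" "0 \<in> Z" "\<And>x y. x \<in> Z \<Longrightarrow> y \<in> Z \<Longrightarrow> x + y \<in> Z" "\<And>c x. 0 \<le> c \<Longrightarrow> x \<in> Z \<Longrightarrow> c *\<^sub>R x \<in> Z"
    and g: "\<And>t. t \<in> {0..1} \<Longrightarrow> g t \<in> Z" and E: "E \<in> sets lebesgue" "E \<subseteq> {0..1}"
  shows "\<nu> E \<in> Z"
proof (rule closed_sequentially[OF Z(1) _ indefinite_LIMSEQ[OF bd E]])
  fix n
  have "(\<Sum>x\<in>Q. measure lebesgue (E \<inter> snd x) *\<^sub>R g (fst x)) \<in> Z" if "finite Q" "Q \<subseteq> P n" for Q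
    using that
  proof (induction Q rule: finite_induct)
    case (insert x Q)
    then have "fst x \<in> {0..1}"
      using tagged_division_ofD(2,3)[OF P[of n], of "fst x" "snd x"] by auto
    then show ?case using insert Z(3,4) g by simp
  qed (use Z(2) in simp)
  then show "step_sum g (P n) E \<in> Z"
    unfolding step_sum_def case_prod_beta using tagged_division_ofD(1)[OF P] by blast
qed

section \<open>Coordinates of the limit are Lebesgue integrals\<close>

text \<open>A fine Perron partition of the interval links both sides. The constant 6 collects 2 for
  the comparison with \<open>P n\<close>, 2 for the approximation of \<open>\<nu>\<close> and 2 for
  Henstock's lemma.\<close>

lemma indefinite_coord_interval:
  fixes g :: "real \<Rightarrow> ('b::metric_space \<Rightarrow>\<^sub>C real)"
  assumes pos: "\<And>n::nat. positive_gauge (\<delta> n)" and rc: "\<And>n. riemann_close g w partition_01 (\<delta> n) ((1/2) ^ n)"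
    and P: "\<And>n. P n tagged_division_of {0..1}" "\<And>n. sym_ball (\<delta> n) fine P n"
    and bd: "\<And>n E. E \<in> sets lebesgue \<Longrightarrow> E \<subseteq> {0..1} \<Longrightarrow> norm (step_sum g (P n) E - \<nu> E) \<le> 2 * (1/2) ^ n"
    and hi: "((\<lambda>t. apply_bcontfun (g t) x) has_integral apply_bcontfun w x) {0..1}"
    and ab: "{a..b} \<subseteq> {0..1}"
  shows "integral {a..b} (\<lambda>t. apply_bcontfun (g t) x) = apply_bcontfun (\<nu> {a..b}) x"
proof -
  let ?f = "\<lambda>t. apply_bcontfun (g t) x" and ?K = "{a..b}"
  have est: "\<bar>integral ?K ?f - apply_bcontfun (\<nu> ?K) x\<bar> \<le> 6 * (1/2) ^ n" for n
  proof -
    let ?e = "(1/2::real) ^ n"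
    obtain p where p: "p tagged_division_of ?K" "(\<lambda>t. if t \<in> {0..1} then sym_ball (\<delta> n) t else UNIV) fine p"
      by (rule fine_division_exists_real[OF gauge_extend_01[of "\<delta> n"]]) (use pos in \<open>simp add: positive_gauge_def\<close>)
    note pD = tagged_division_ofD[OF p(1)]
    have p01: "K \<subseteq> {0..1}" if "(t, K) \<in> p" for t K using pD(3)[OF that] ab by (rule order_trans)
    have fine: "sym_ball (\<delta> n) fine p" by (rule fine_extend_01[THEN iffD1, OF p01 pD(2) p(2)])
    have tp: "p tagged_partial_division_of {0..1}"
      using p(1) p01 unfolding tagged_division_of_def tagged_partial_division_of_def by blast
    have pU: "\<Union>(snd ` p) = ?K" using pD(6) by force
    have PU: "\<Union>(snd ` P n) = {0..1}" using tagged_division_ofD(6)[OF P(1)[of n]] by force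
    have "norm (step_sum g (P n) ?K - step_sum g p ?K) \<le> 2 * ?e"
    proof (rule step_sum_compare[OF pos rc _ P(2) tp fine])
      show "P n tagged_partial_division_of {0..1}" using P(1) unfolding tagged_division_of_def by blast
      show "?K \<subseteq> \<Union>(snd ` P n)" "?K \<subseteq> \<Union>(snd ` p)" using ab by (simp_all only: PU pU order_refl)
    qed simp
    moreover have "norm (step_sum g (P n) ?K - \<nu> ?K) \<le> 2 * ?e" using bd[OF _ ab] by simp
    ultimately have "norm (step_sum g p ?K - \<nu> ?K) \<le> 4 * ?e"
      using norm_triangle_ineq4[of "step_sum g (P n) ?K - \<nu> ?K" "step_sum g (P n) ?K - step_sum g p ?K"] by simp
    then have "\<bar>apply_bcontfun (step_sum g p ?K) x - apply_bcontfun (\<nu> ?K) x\<bar> \<le> 4 * ?e"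
      using norm_bounded[of "step_sum g p ?K - \<nu> ?K" x] by simp
    moreover have "step_sum g p ?K = gauge_sum g p"
      unfolding step_sum_def gauge_sum_def
    proof (rule sum.cong[OF refl], clarify)
      fix t K assume "(t, K) \<in> p"
      then have "?K \<inter> K = K" using pD(3) by blast
      then show "measure lebesgue (?K \<inter> K) *\<^sub>R g t = measure lebesgue K *\<^sub>R g t" by simp
    qed
    moreover have "\<bar>apply_bcontfun (gauge_sum g p) x - integral ?K ?f\<bar> \<le> 2 * ?e"
    proof -
      have "?f integrable_on ?K"
        by (rule integrable_on_subinterval[OF _ ab]) (use hi in blast)
      then have "integral ?K ?f = (\<Sum>(t, K)\<in>p. integral K ?f)"
        using integral_combine_tagged_division_topdown[of ?f a b p] p(1) by (simp add: cbox_interval)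
      then have "apply_bcontfun (gauge_sum g p) x - integral ?K ?f = (\<Sum>(t, K)\<in>p. measure lebesgue K * ?f t - integral K ?f)"
        by (simp add: apply_gauge_sum sum_subtractf case_prod_beta)
      also have "\<bar>\<dots>\<bar> \<le> (\<Sum>(t, K)\<in>p. \<bar>measure lebesgue K * ?f t - integral K ?f\<bar>)"
        using sum_abs[of "\<lambda>z. measure lebesgue (snd z) * ?f (fst z) - integral (snd z) ?f" p] by (simp add: case_prod_beta)
      also have "\<dots> \<le> 2 * ?e"
        by (rule coord_Henstock[OF hi pos riemann_close_perron[OF rc] _ tp fine]) simp
      finally show ?thesis .
    qed
    ultimately show ?thesis by simp
  qed
  have "(\<lambda>n. 6 * (1/2::real) ^ n) \<longlonglongrightarrow> 0"
    by (intro tendsto_mult_right_zero LIMSEQ_power_zero) simp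
  then have "\<bar>integral ?K ?f - apply_bcontfun (\<nu> ?K) x\<bar> \<le> 0"
    by (rule LIMSEQ_le_const) (use est in blast)
  then show ?thesis by simp
qed

text \<open>A gauge integral need not be absolute; bounded variation of the indefinite integral
  makes it so. Grouping the intervals of a division by the sign of their integrals turns each group
  into one value of the bounded set function \<open>\<nu>\<close>.\<close>

lemma indefinite_coord_integrable:
  fixes g :: "real \<Rightarrow> ('b::metric_space \<Rightarrow>\<^sub>C real)"
  assumes P: "\<And>n. P n tagged_division_of {0..1}"
    and bd: "\<And>n E. E \<in> sets lebesgue \<Longrightarrow> E \<subseteq> {0..1} \<Longrightarrow> norm (step_sum g (P n) E - \<nu> E) \<le> 2 * (1/2) ^ n"
    and int: "(\<lambda>t. apply_bcontfun (g t) x) integrable_on {0..1}"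
    and eq: "\<And>a b. {a..b} \<subseteq> {0..1} \<Longrightarrow> integral {a..b} (\<lambda>t. apply_bcontfun (g t) x) = apply_bcontfun (\<nu> {a..b}) x"
  shows "set_integrable lebesgue {0..1} (\<lambda>t. apply_bcontfun (g t) x)"
proof -
  let ?f = "\<lambda>t. apply_bcontfun (g t) x"
  obtain B where B: "\<And>E. E \<in> sets lebesgue \<Longrightarrow> E \<subseteq> {0..1} \<Longrightarrow> norm (\<nu> E) \<le> B"
    using indefinite_bounded[OF P bd] by blast
  have "?f absolutely_integrable_on cbox 0 1"
  proof (rule bounded_variation_absolutely_integrable_interval)
    show "?f integrable_on cbox 0 1" using int by (simp add: cbox_interval)
    fix d assume d: "d division_of cbox (0::real) 1"
    note dD = division_ofD[OF d]
    let ?v = "\<lambda>K. apply_bcontfun (\<nu> K) x"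
    have K: "K \<in> sets lebesgue \<and> K \<subseteq> {0..1}" "\<exists>a b. K = {a..b}" if "K \<in> d" for K
      using dD(2,4)[OF that] by (auto simp: cbox_interval)
    have part: "\<bar>\<Sum>K\<in>d'. ?v K\<bar> \<le> B" if d': "d' \<subseteq> d" for d'
    proof -
      have fin: "finite d'" using d' dD(1) finite_subset by blast
      have "\<nu> (\<Union>K\<in>d'. K) = (\<Sum>K\<in>d'. \<nu> K)"
      proof (rule indefinite_finite_UN[OF P bd fin])
        show "pairwise (\<lambda>K L. negligible (K \<inter> L)) d'"
        proof (rule pairwiseI)
          fix K L assume KL: "K \<in> d'" "L \<in> d'" "K \<noteq> L"
          then obtain a b c e where "K = {a..b}" "L = {c..e}" using K(2) d' by (meson subsetD)
          then show "negligible (K \<inter> L)" using dD(5)[of K L] KL d' negligible_Int_nonoverlap by blast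
        qed
      qed (use K d' in auto)
      moreover have "norm (\<nu> (\<Union>K\<in>d'. K)) \<le> B"
      proof (rule B)
        show "(\<Union>K\<in>d'. K) \<in> sets lebesgue" by (rule sets.finite_UN[OF fin]) (use K d' in blast)
        show "(\<Union>K\<in>d'. K) \<subseteq> {0..1}" using K d' by blast
      qed
      ultimately show ?thesis using norm_bounded[of "\<Sum>K\<in>d'. \<nu> K" x] by (simp add: apply_bcontfun_sum)
    qed
    have "(\<Sum>K\<in>d. norm (integral K ?f)) = (\<Sum>K\<in>d. \<bar>?v K\<bar>)"
    proof (rule sum.cong[OF refl])
      fix k assume k: "k \<in> d"
      then obtain a b where ab: "k = {a..b}" using K(2) by blast
      then show "norm (integral k ?f) = \<bar>?v k\<bar>" using eq[of a b] K(1)[OF k] by simp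
    qed
    also have "\<dots> = (\<Sum>K\<in>{K \<in> d. 0 \<le> ?v K}. ?v K) - (\<Sum>K\<in>{K \<in> d. ?v K < 0}. ?v K)"
    proof -
      have "d = {K \<in> d. 0 \<le> ?v K} \<union> {K \<in> d. ?v K < 0}" by auto
      then have "(\<Sum>K\<in>d. \<bar>?v K\<bar>) = (\<Sum>K\<in>{K \<in> d. 0 \<le> ?v K} \<union> {K \<in> d. ?v K < 0}. \<bar>?v K\<bar>)" by simp
      also have "\<dots> = (\<Sum>K\<in>{K \<in> d. 0 \<le> ?v K}. \<bar>?v K\<bar>) + (\<Sum>K\<in>{K \<in> d. ?v K < 0}. \<bar>?v K\<bar>)"
        by (rule sum.union_disjoint) (use dD(1) in auto)
      finally show ?thesis by (simp add: sum_negf)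
    qed
    also have "\<dots> \<le> B + B" using part[of "{K \<in> d. 0 \<le> ?v K}"] part[of "{K \<in> d. ?v K < 0}"] by auto
    finally show "(\<Sum>K\<in>d. norm (integral K ?f)) \<le> B + B" .
  qed
  then show ?thesis by (simp add: cbox_interval)
qed

text \<open>Agreement on intervals spreads to the traces of all Borel sets, since it is preserved by
  complements and countable disjoint unions. A Lebesgue set differs from an F-sigma set by a null
  set, on which both sides vanish.\<close>

lemma indefinite_coord_integral:
  fixes g :: "real \<Rightarrow> ('b::metric_space \<Rightarrow>\<^sub>C real)"
  assumes P: "\<And>n. P n tagged_division_of {0..1}"
    and bd: "\<And>n E. E \<in> sets lebesgue \<Longrightarrow> E \<subseteq> {0..1} \<Longrightarrow> norm (step_sum g (P n) E - \<nu> E) \<le> 2 * (1/2) ^ n"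
    and int: "set_integrable lebesgue {0..1} (\<lambda>t. apply_bcontfun (g t) x)"
    and eq: "\<And>a b. {a..b} \<subseteq> {0..1} \<Longrightarrow> integral {a..b} (\<lambda>t. apply_bcontfun (g t) x) = apply_bcontfun (\<nu> {a..b}) x"
    and E: "E \<in> sets lebesgue" "E \<subseteq> {0..1}"
  shows "apply_bcontfun (\<nu> E) x = (LINT t:E|lebesgue. apply_bcontfun (g t) x)"
proof -
  let ?f = "\<lambda>t. apply_bcontfun (g t) x"
  have intE: "set_integrable lebesgue A ?f" if "A \<in> sets lebesgue" "A \<subseteq> {0..1}" for A
    by (rule set_integrable_subset[OF int that])
  have box: "apply_bcontfun (\<nu> {a..b}) x = (LINT t:{a..b}|lebesgue. ?f t)" if "{a..b} \<subseteq> {0..1}" for a b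
    using eq[OF that] set_lebesgue_integral_eq_integral(2)[OF intE[OF _ that]] by simp
  have null: "apply_bcontfun (\<nu> A) x = (LINT t:A|lebesgue. ?f t)" if A: "A \<in> null_sets lebesgue" "A \<subseteq> {0..1}" for A
  proof -
    have "(LINT t:A|lebesgue. ?f t) = 0"
      unfolding set_lebesgue_integral_def
      by (rule integral_eq_zero_AE) (use AE_not_in[OF A(1)] in \<open>eventually_elim, simp\<close>)
    then show ?thesis using indefinite_null[OF P bd A] by simp
  qed
  \<comment> \<open>An equivalence, because it serves in both directions: to remove a part, for
    complements, and to add one, for null sets.\<close>
  have Un: "apply_bcontfun (\<nu> (A \<union> B)) x = (LINT t:A \<union> B|lebesgue. ?f t) \<longleftrightarrow>
      apply_bcontfun (\<nu> A) x = (LINT t:A|lebesgue. ?f t)"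
    if AB: "A \<in> sets lebesgue" "A \<subseteq> {0..1}" "B \<in> sets lebesgue" "B \<subseteq> {0..1}" "A \<inter> B = {}"
      and B: "apply_bcontfun (\<nu> B) x = (LINT t:B|lebesgue. ?f t)" for A B
  proof -
    have "\<nu> (A \<union> B) = \<nu> A + \<nu> B" by (rule indefinite_Un[OF P bd AB])
    moreover have "(LINT t:A \<union> B|lebesgue. ?f t) = (LINT t:A|lebesgue. ?f t) + (LINT t:B|lebesgue. ?f t)"
      by (rule set_integral_Un[OF AB(5) intE[OF AB(1,2)] intE[OF AB(3,4)]])
    ultimately show ?thesis using B by simp
  qed
  have borel: "apply_bcontfun (\<nu> (A \<inter> {0..1})) x = (LINT t:A \<inter> {0..1}|lebesgue. ?f t)" if "A \<in> sets borel" for A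
    using that
  proof (induction A rule: borel_set_induct)
    case empty
    show ?case using null[of "{}"] by simp
  next
    case (interval a b)
    have "{a..b} \<inter> {0..1} = {max a 0..min b 1}" by (simp add: Int_atLeastAtMost)
    moreover have "{max a 0..min b 1} \<subseteq> {0..1}" by auto
    ultimately show ?case using box[of "max a 0" "min b 1"] by (simp only:)
  next
    case (compl A)
    have Ab: "- A \<inter> {0..1} \<in> sets lebesgue" "A \<inter> {0..1} \<in> sets lebesgue"
      using compl(1) by (auto intro!: sets_completionI_sets)
    have "- A \<inter> {0..1} \<union> A \<inter> {0..1} = {0..1}" by blast
    moreover have "apply_bcontfun (\<nu> {0..1}) x = (LINT t:{0..1}|lebesgue. ?f t)" by (rule box) simp
    moreover have "apply_bcontfun (\<nu> (- A \<inter> {0..1} \<union> A \<inter> {0..1})) x = (LINT t:- A \<inter> {0..1} \<union> A \<inter> {0..1}|lebesgue. ?f t) \<longleftrightarrow>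
      apply_bcontfun (\<nu> (- A \<inter> {0..1})) x = (LINT t:- A \<inter> {0..1}|lebesgue. ?f t)"
      by (rule Un[OF Ab(1) _ Ab(2) _ _ compl(2)]) auto
    ultimately show ?case by (simp only: simp_thms)
  next
    case (union A)
    have Ab: "A i \<inter> {0..1} \<in> sets lebesgue" for i using union(2)[of i] by (auto intro!: sets_completionI_sets)
    have dis: "disjoint_family (\<lambda>i. A i \<inter> {0..1})" using union(1) unfolding disjoint_family_on_def by blast
    have "(\<lambda>N. \<Sum>k<N. \<nu> (A k \<inter> {0..1})) \<longlonglongrightarrow> \<nu> (\<Union>k. A k \<inter> {0..1})"
      by (rule indefinite_countably_additive[OF P bd Ab _ dis]) simp_all
    from tendsto_uniform_limitI[OF tendsto_bcontfun_uniform_limit[OF this]]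
    have "(\<lambda>N. apply_bcontfun (\<Sum>k<N. \<nu> (A k \<inter> {0..1})) x) \<longlonglongrightarrow> apply_bcontfun (\<nu> (\<Union>k. A k \<inter> {0..1})) x"
      by simp
    then have s: "(\<lambda>k. LINT t:A k \<inter> {0..1}|lebesgue. ?f t) sums apply_bcontfun (\<nu> (\<Union>k. A k \<inter> {0..1})) x"
      unfolding sums_def apply_bcontfun_sum union(3) .
    have "(LINT t:(\<Union>k. A k \<inter> {0..1})|lebesgue. ?f t) = (\<Sum>k. LINT t:A k \<inter> {0..1}|lebesgue. ?f t)"
    proof (rule lebesgue_integral_countable_add[OF Ab])
      show "set_integrable lebesgue (\<Union>k. A k \<inter> {0..1}) ?f" by (rule intE[OF sets.countable_UN]) (use Ab in auto)
      show "A i \<inter> {0..1} \<inter> (A j \<inter> {0..1}) = {}" if "i \<noteq> j" for i j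
        using dis that unfolding disjoint_family_on_def by blast
    qed
    with s have "apply_bcontfun (\<nu> (\<Union>k. A k \<inter> {0..1})) x = (LINT t:(\<Union>k. A k \<inter> {0..1})|lebesgue. ?f t)"
      by (simp only: sums_unique)
    moreover have "(\<Union>k. A k \<inter> {0..1}) = (\<Union>k. A k) \<inter> {0..1}" by blast
    ultimately show ?case by (simp only:)
  qed
  obtain C T where CT: "fsigma C" "T \<in> null_sets lebesgue" "C \<union> T = E" "disjnt C T"
    using lebesgue_set_almost_fsigma[OF E(1)] by blast
  have C: "C \<in> sets borel" using CT(1) by (induction rule: fsigma.induct) auto
  have sub: "C \<subseteq> {0..1}" "T \<subseteq> {0..1}" using CT(3) E(2) by auto
  have "apply_bcontfun (\<nu> C) x = (LINT t:C|lebesgue. ?f t)" using borel[OF C] sub(1) by (simp only: Int_absorb2)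
  moreover have "apply_bcontfun (\<nu> (C \<union> T)) x = (LINT t:C \<union> T|lebesgue. ?f t) \<longleftrightarrow>
      apply_bcontfun (\<nu> C) x = (LINT t:C|lebesgue. ?f t)"
  proof (rule Un[OF _ sub(1) _ sub(2) _ null[OF CT(2) sub(2)]])
    show "C \<in> sets lebesgue" using C by (intro sets_completionI_sets) simp
  qed (use CT(2,4) in \<open>auto simp: disjnt_def\<close>)
  ultimately show ?thesis by (simp only: CT(3))
qed

subsection \<open>Uniform absolute continuity of vector measures\<close>

text \<open>If \<open>\<nu>\<close> were not uniformly absolutely continuous, sets \<open>D j = E (n j) - F (n (j + 1))\<close> with \<open>\<nu> (D j)\<close>
  bounded away from zero would contradict the convergence of \<open>\<Sum>j. \<nu> (D j)\<close>; here \<open>F n\<close> is the union of the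
  \<open>E m\<close> with \<open>m \<ge> n\<close>.\<close>

lemma vector_measure_abs_continuous:
  fixes \<nu> :: "real set \<Rightarrow> 'y::real_normed_vector"
  assumes ca: "\<And>E :: nat \<Rightarrow> real set. (\<And>k. E k \<in> sets lebesgue \<and> E k \<subseteq> {0..1}) \<Longrightarrow> disjoint_family E \<Longrightarrow>
      (\<lambda>n. \<Sum>k<n. \<nu> (E k)) \<longlonglongrightarrow> \<nu> (\<Union>k. E k)"
    and null: "\<And>E. E \<in> null_sets lebesgue \<Longrightarrow> E \<subseteq> {0..1} \<Longrightarrow> \<nu> E = 0" and \<epsilon>: "0 < \<epsilon>"
  shows "\<exists>\<eta>>0. \<forall>E\<in>sets lebesgue. E \<subseteq> {0..1} \<longrightarrow> measure lebesgue E < \<eta> \<longrightarrow> norm (\<nu> E) \<le> \<epsilon>"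
proof (rule ccontr)
  assume contra: "\<not> ?thesis"
  have "\<exists>E. E \<in> sets lebesgue \<and> E \<subseteq> {0..1} \<and> measure lebesgue E < (1/2) ^ n \<and> \<epsilon> < norm (\<nu> E)" for n :: nat
  proof (rule ccontr)
    assume "\<nexists>E. E \<in> sets lebesgue \<and> E \<subseteq> {0..1} \<and> measure lebesgue E < (1/2) ^ n \<and> \<epsilon> < norm (\<nu> E)"
    then have "\<forall>E\<in>sets lebesgue. E \<subseteq> {0..1} \<longrightarrow> measure lebesgue E < (1/2) ^ n \<longrightarrow> norm (\<nu> E) \<le> \<epsilon>"
      by (meson not_le)
    moreover have "0 < (1/2::real) ^ n" by simp
    ultimately show False using contra by blast
  qed
  then obtain E where E: "\<And>n. E n \<in> sets lebesgue" "\<And>n. E n \<subseteq> {0..1}"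
    "\<And>n::nat. measure lebesgue (E n) < (1/2) ^ n" "\<And>n. \<epsilon> < norm (\<nu> (E n))" by metis
  have empty: "\<nu> {} = 0" by (rule null) auto
  have add: "\<nu> (A \<union> B) = \<nu> A + \<nu> B"
    if AB: "A \<in> sets lebesgue" "A \<subseteq> {0..1}" "B \<in> sets lebesgue" "B \<subseteq> {0..1}" "A \<inter> B = {}" for A B
  proof -
    let ?S = "\<lambda>k::nat. if k = 0 then A else if k = 1 then B else {}"
    have lim: "(\<lambda>n. \<Sum>k<n. \<nu> (?S k)) \<longlonglongrightarrow> \<nu> (\<Union>k. ?S k)"
      by (rule ca) (use AB in \<open>auto simp: disjoint_family_on_def\<close>)
    have "(\<lambda>k. \<nu> (?S k)) sums (\<Sum>k\<in>{0, 1}. \<nu> (?S k))"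
      by (rule sums_finite) (use empty in auto)
    then have "(\<lambda>n. \<Sum>k<n. \<nu> (?S k)) \<longlonglongrightarrow> \<nu> A + \<nu> B" by (simp add: sums_def)
    moreover have "(\<Union>k. ?S k) = A \<union> B" by (auto split: if_splits)
    ultimately show ?thesis using LIMSEQ_unique[OF lim] by simp
  qed
  define F where "F n = (\<Union>m\<in>{n..}. E m)" for n
  have F: "F n \<in> sets lebesgue" "F n \<subseteq> {0..1}" "F (Suc n) \<subseteq> F n" for n
    using E(1,2) by (auto simp: F_def intro: Suc_leD)
  have Fanti: "F n \<subseteq> F m" if "m \<le> n" for m n
    unfolding F_def by (rule UN_mono) (use that in auto)
  \<comment> \<open>The Borel-Cantelli argument: the measures of the \<open>E n\<close> are
    summable, with tail at most \<open>2 * (1/2) ^ n\<close>.\<close>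
  have null_F: "(\<Inter>n. F n) \<in> null_sets lebesgue"
  proof -
    have le: "emeasure lebesgue (\<Inter>n. F n) \<le> ennreal e" if e: "0 < e" for e
    proof -
      obtain n where n: "(1/2) ^ n < e / 2" using real_arch_pow_inv[of "e / 2" "1/2"] e by auto
      have "emeasure lebesgue (\<Inter>n. F n) \<le> emeasure lebesgue (\<Union>m. E (m + n))"
      proof (rule emeasure_mono)
        show "(\<Inter>n. F n) \<subseteq> (\<Union>m. E (m + n))"
        proof
          fix y assume "y \<in> (\<Inter>n. F n)"
          then have "y \<in> F n" by blast
          then obtain m where "n \<le> m" "y \<in> E m" by (auto simp: F_def)
          then have "y \<in> E ((m - n) + n)" by simp
          then show "y \<in> (\<Union>m. E (m + n))" by blast
        qed
      qed (use E(1) in auto)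
      also have "\<dots> \<le> (\<Sum>m. emeasure lebesgue (E (m + n)))"
        by (rule emeasure_subadditive_countably) (use E(1) in auto)
      also have "\<dots> \<le> (\<Sum>m. ennreal ((1/2) ^ (m + n)))"
      proof (rule suminf_le)
        fix m
        have "emeasure lebesgue (E (m + n)) = ennreal (measure lebesgue (E (m + n)))"
          by (rule emeasure_eq_measure2[OF lmeasurable_01[OF E(1,2)]])
        also have "\<dots> \<le> ennreal ((1/2) ^ (m + n))" using E(3)[of "m + n"] by (intro ennreal_leI) simp
        finally show "emeasure lebesgue (E (m + n)) \<le> ennreal ((1/2) ^ (m + n))" .
      qed auto
      also have "\<dots> = ennreal (\<Sum>m. (1/2) ^ (m + n))"
        by (rule suminf_ennreal2) (auto simp: power_add intro!: summable_mult2 summable_geometric)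
      also have "(\<Sum>m. (1/2::real) ^ (m + n)) = 2 * (1/2) ^ n"
        by (simp add: power_add suminf_mult2[symmetric] suminf_geometric summable_geometric)
      also have "ennreal (2 * (1/2) ^ n) \<le> ennreal e" using n by (intro ennreal_leI) simp
      finally show ?thesis .
    qed
    have "emeasure lebesgue (\<Inter>n. F n) \<le> 0" by (rule ennreal_le_epsilon) (simp add: le del: le_zero_eq)
    then have "emeasure lebesgue (\<Inter>n. F n) = 0" by (simp only: le_zero_eq)
    moreover have "(\<Inter>n. F n) \<in> sets lebesgue" by (rule sets.countable_INT) (use F(1) in auto)
    ultimately show ?thesis by (rule null_setsI)
  qed
  \<comment> \<open>The sets \<open>A - F m\<close> increase to \<open>A\<close> up to a null set.
    Their successive differences \<open>S k\<close> are disjoint, so countable additivity gives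
    convergence of \<open>\<nu> (A - F m)\<close> to \<open>\<nu> A\<close>.\<close>
  have tail: "(\<lambda>m. \<nu> (A \<inter> F m)) \<longlonglongrightarrow> 0" if A: "A \<in> sets lebesgue" "A \<subseteq> {0..1}" for A
  proof -
    define N where "N = A \<inter> (\<Inter>n. F n)"
    have N: "N \<in> null_sets lebesgue" "N \<subseteq> {0..1}"
      unfolding N_def using null_set_Int1[OF null_F A(1)] A(2) by (auto simp: Int_commute)
    have Ns: "N \<in> sets lebesgue" using N(1) by auto
    define S where "S k = (if k = 0 then A - F 0 else A \<inter> (F (k - 1) - F k))" for k :: nat
    have S: "S k \<in> sets lebesgue \<and> S k \<subseteq> {0..1}" for k using A F by (auto simp: S_def)
    have Un: "(\<Union>k<n. S k) = A - F (n - 1)" if "0 < n" for n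
      using that
    proof (induction n)
      case (Suc n)
      show ?case
      proof (cases n)
        case 0
        then show ?thesis by (simp add: S_def lessThan_Suc)
      next
        case (Suc l)
        have "(\<Union>k<Suc n. S k) = (\<Union>k<n. S k) \<union> S n" by (auto simp: lessThan_Suc)
        also have "\<dots> = (A - F l) \<union> (A \<inter> (F l - F n))" using Suc.IH Suc by (simp add: S_def)
        also have "\<dots> = A - F n" using F(3)[of l] Suc by auto
        finally show ?thesis by simp
      qed
    qed simp
    have dis: "disjoint_family S"
    proof -
      have "S i \<inter> S j = {}" if "i < j" for i j
      proof -
        have "S i \<subseteq> (\<Union>k<j. S k)" using that by blast
        also have "\<dots> = A - F (j - 1)" by (rule Un) (use that in simp)
        finally show ?thesis using that by (auto simp: S_def)
      qed
      then show ?thesis unfolding disjoint_family_on_def by (metis Int_commute linorder_neqE_nat)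
    qed
    have sumS: "(\<Sum>k<n. \<nu> (S k)) = \<nu> (\<Union>k<n. S k)" for n
    proof (induction n)
      case (Suc n)
      have "\<nu> ((\<Union>k<n. S k) \<union> S n) = \<nu> (\<Union>k<n. S k) + \<nu> (S n)"
      proof (rule add)
        have "S k \<inter> S n = {}" if "k < n" for k using dis that by (auto simp: disjoint_family_on_def)
        then show "(\<Union>k<n. S k) \<inter> S n = {}" by blast
        show "(\<Union>k<n. S k) \<in> sets lebesgue" by (rule sets.finite_UN) (use S in auto)
        show "(\<Union>k<n. S k) \<subseteq> {0..1}" using S by blast
      qed (use S in auto)
      moreover have "(\<Union>k<Suc n. S k) = (\<Union>k<n. S k) \<union> S n" by (auto simp: lessThan_Suc)
      ultimately show ?case using Suc by simp
    qed (simp add: empty)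
    have U: "(\<Union>k<Suc n. S k) = A - F n" for n
      using Un[OF zero_less_Suc, of n] by (simp only: diff_Suc_1)
    have "(\<Union>k. S k) = A - (\<Inter>n. F n)"
    proof -
      have "(\<Union>k. S k) = (\<Union>n. \<Union>k<Suc n. S k)" by blast
      also have "\<dots> = (\<Union>n. A - F n)" by (simp only: U)
      finally show ?thesis by blast
    qed
    then have "(\<lambda>n. \<Sum>k<n. \<nu> (S k)) \<longlonglongrightarrow> \<nu> (A - (\<Inter>n. F n))" using ca[OF S dis] by simp
    then have "(\<lambda>n. \<Sum>k<Suc n. \<nu> (S k)) \<longlonglongrightarrow> \<nu> (A - (\<Inter>n. F n))" by (rule LIMSEQ_Suc)
    then have lim: "(\<lambda>m. \<nu> (A - F m)) \<longlonglongrightarrow> \<nu> (A - (\<Inter>n. F n))"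
      by (simp only: sumS U)
    have "A = (A - (\<Inter>n. F n)) \<union> N" by (auto simp: N_def)
    moreover have "\<nu> ((A - (\<Inter>n. F n)) \<union> N) = \<nu> (A - (\<Inter>n. F n)) + \<nu> N"
      by (rule add) (use A F Ns N in \<open>auto simp: N_def\<close>)
    ultimately have A0: "\<nu> A = \<nu> (A - (\<Inter>n. F n))" using null[OF N] by simp
    have "\<nu> (A \<inter> F m) = \<nu> A - \<nu> (A - F m)" for m
    proof -
      have "\<nu> ((A \<inter> F m) \<union> (A - F m)) = \<nu> (A \<inter> F m) + \<nu> (A - F m)"
        by (rule add) (use A F in auto)
      moreover have "(A \<inter> F m) \<union> (A - F m) = A" by blast
      ultimately show ?thesis by simp
    qed
    then show ?thesis using tendsto_diff[OF tendsto_const lim, of "\<nu> A"] A0 by simp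
  qed
  \<comment> \<open>Removing a late tail from \<open>E n\<close> changes the value by less than
    \<open>\<epsilon> / 2\<close>, so more than \<open>\<epsilon> / 2\<close> remains.\<close>
  have "\<exists>m>n. \<epsilon> / 2 < norm (\<nu> (E n - F m))" for n
  proof -
    obtain m0 where m0: "\<And>m. m0 \<le> m \<Longrightarrow> norm (\<nu> (E n \<inter> F m)) < \<epsilon> / 2"
      using LIMSEQ_D[OF tail[OF E(1,2)], of "\<epsilon> / 2" n] \<epsilon> by auto
    define m where "m = max m0 (Suc n)"
    have "\<nu> ((E n \<inter> F m) \<union> (E n - F m)) = \<nu> (E n \<inter> F m) + \<nu> (E n - F m)"
      by (rule add) (use E F in auto)
    moreover have "(E n \<inter> F m) \<union> (E n - F m) = E n" by blast
    ultimately have "norm (\<nu> (E n)) \<le> norm (\<nu> (E n \<inter> F m)) + norm (\<nu> (E n - F m))"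
      using norm_triangle_ineq[of "\<nu> (E n \<inter> F m)" "\<nu> (E n - F m)"] by simp
    then have "\<epsilon> / 2 < norm (\<nu> (E n - F m))" using m0[of m] E(4)[of n] by (simp add: m_def)
    moreover have "n < m" by (simp add: m_def)
    ultimately show ?thesis by blast
  qed
  then obtain nx where nx: "\<And>n. n < nx n" "\<And>n. \<epsilon> / 2 < norm (\<nu> (E n - F (nx n)))" by metis
  define s where "s j = (nx ^^ j) 0" for j
  have s_Suc: "s (Suc j) = nx (s j)" for j by (simp add: s_def)
  have smono: "s (Suc i) \<le> s j" if "i < j" for i j
    using that
  proof (induction j)
    case (Suc j)
    then show ?case using nx(1)[of "s j"] by (cases "i = j") (auto simp: s_Suc intro: order_trans less_imp_le)
  qed simp
  define D where "D j = E (s j) - F (s (Suc j))" for j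
  have D: "D j \<in> sets lebesgue \<and> D j \<subseteq> {0..1}" for j using E F by (auto simp: D_def)
  have "disjoint_family D"
  proof -
    have "D i \<inter> D j = {}" if "i < j" for i j
    proof -
      \<comment> \<open>Disjointness: every later set lies inside the tail that has been removed
        from \<open>D i\<close>.\<close>
      have "E (s j) \<subseteq> F (s (Suc i))" unfolding F_def by (rule UN_upper) (use smono[OF that] in simp)
      then have "D j \<subseteq> F (s (Suc i))" by (auto simp: D_def)
      then show ?thesis by (auto simp: D_def)
    qed
    then show ?thesis unfolding disjoint_family_on_def by (metis Int_commute linorder_neqE_nat)
  qed
  then have "(\<lambda>n. \<Sum>k<n. \<nu> (D k)) \<longlonglongrightarrow> \<nu> (\<Union>k. D k)" by (rule ca[OF D])
  then have "(\<lambda>k. \<nu> (D k)) sums \<nu> (\<Union>k. D k)" by (simp add: sums_def)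
  then have "(\<lambda>k. \<nu> (D k)) \<longlonglongrightarrow> 0" by (rule summable_LIMSEQ_zero[OF sums_summable])
  then obtain k where "norm (\<nu> (D k)) < \<epsilon> / 2" using LIMSEQ_D[of "\<lambda>k. \<nu> (D k)" 0 "\<epsilon> / 2"] \<epsilon> by auto
  then show False using nx(2)[of "s k"] by (simp add: D_def s_Suc)
qed

subsection \<open>Set-valued integrals\<close>

text \<open>Cutting \<open>E\<close> along the sign of \<open>f\<close> gives two signed integrals,
  hence the factor 2. This turns a norm bound for the vector measure into a bound on absolute
  integrals that is uniform in the coordinates.\<close>

lemma integral_abs_le_of_indefinite:
  fixes f :: "real \<Rightarrow> real"
  assumes f: "set_integrable lebesgue {0..1} f" and E: "E \<in> sets lebesgue" "E \<subseteq> {0..1}"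
    and le: "\<And>A. A \<in> sets lebesgue \<Longrightarrow> A \<subseteq> E \<Longrightarrow> \<bar>LINT t:A|lebesgue. f t\<bar> \<le> c"
  shows "(LINT t:E|lebesgue. \<bar>f t\<bar>) \<le> 2 * c"
proof -
  have f': "(\<lambda>y. indicat_real {0..1} y * f y) \<in> borel_measurable lebesgue"
    using f unfolding set_integrable_def by (simp add: borel_measurable_integrable)
  define A where "A = E \<inter> {t \<in> space lebesgue. 0 \<le> indicat_real {0..1} t * f t}"
  have "{t \<in> space lebesgue. 0 \<le> indicat_real {0..1} t * f t} \<in> sets lebesgue" using f' by measurable
  then have A: "A \<in> sets lebesgue" "A \<subseteq> E" "E - A \<in> sets lebesgue" "E - A \<subseteq> E" using E(1) by (auto simp: A_def)
  have sub: "A \<subseteq> {0..1}" "E - A \<subseteq> {0..1}" using A(2) E(2) by auto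
  have int: "set_integrable lebesgue B f" if "B \<in> sets lebesgue" "B \<subseteq> {0..1}" for B
    by (rule set_integrable_subset[OF f that])
  have sgn: "0 \<le> f t" if "t \<in> A" for t
  proof -
    have "t \<in> {0..1}" using that sub by blast
    then show ?thesis using that by (simp add: A_def)
  qed
  have sgn': "f t \<le> 0" if "t \<in> E - A" for t
  proof -
    have "t \<in> {0..1}" using that sub by blast
    then show ?thesis using that by (auto simp: A_def)
  qed
  have "(LINT t:A \<union> (E - A)|lebesgue. \<bar>f t\<bar>) = (LINT t:A|lebesgue. \<bar>f t\<bar>) + (LINT t:E - A|lebesgue. \<bar>f t\<bar>)"
    by (rule set_integral_Un) (use int[OF A(1) sub(1)] int[OF A(3) sub(2)] set_integrable_abs in auto)
  moreover have "A \<union> (E - A) = E" using A(2) by blast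
  moreover have "(LINT t:A|lebesgue. \<bar>f t\<bar>) = (LINT t:A|lebesgue. f t)"
    by (rule set_lebesgue_integral_cong[OF A(1)]) (use sgn in auto)
  moreover have "(LINT t:E - A|lebesgue. \<bar>f t\<bar>) = (LINT t:E - A|lebesgue. - f t)"
    by (rule set_lebesgue_integral_cong[OF A(3)]) (use sgn' in auto)
  moreover have "(LINT t:E - A|lebesgue. - f t) = - (LINT t:E - A|lebesgue. f t)"
    by (simp add: set_lebesgue_integral_def)
  ultimately show ?thesis using le[OF A(1,2)] le[OF A(3,4)] by simp
qed

section \<open>Translation of the integrals through the embedding\<close>

lemma riemann_sum_radstrom:
  fixes \<Gamma> :: "real \<Rightarrow> 'a::banach set"
  assumes \<Gamma>: "\<forall>t\<in>{0..1}. \<Gamma> t \<in> cb" and P: "\<And>t I. (t, I) \<in> P \<Longrightarrow> t \<in> {0..1}"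
  shows "nbc (riemann_sum \<Gamma> P)" "radstrom (riemann_sum \<Gamma> P) = gauge_sum (\<lambda>t. radstrom (\<Gamma> t)) P"
proof -
  have n: "nbc (\<Gamma> (fst p))" if "p \<in> P" for p
  proof -
    have "fst p \<in> {0..1}" using P[of "fst p" "snd p"] that by simp
    then show ?thesis using \<Gamma> cb_nbc by blast
  qed
  show "nbc (riemann_sum \<Gamma> P)"
    unfolding riemann_sum_def case_prod_beta by (intro nbc_sum nbc_scale n)
  show "radstrom (riemann_sum \<Gamma> P) = gauge_sum (\<lambda>t. radstrom (\<Gamma> t)) P"
    unfolding riemann_sum_def gauge_sum_def case_prod_beta
    by (subst radstrom_sum) (auto intro!: nbc_scale n sum.cong radstrom_scale)
qed

text \<open>The assumption on \<open>Q\<close> ensures that tags lie in the unit interval, where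
  \<open>\<Gamma>\<close> takes values in \<open>cb\<close>. With \<open>Gd\<close> and
  \<open>Q\<close> left open, all four gauge integrals are covered.\<close>

lemma gauge_integrable_iff_riemann_close:
  fixes \<Gamma> :: "real \<Rightarrow> 'a::banach set"
  assumes \<Gamma>: "\<forall>t\<in>{0..1}. \<Gamma> t \<in> cb" and Q: "\<forall>P. Q P \<longrightarrow> partition_01 P"
  shows "gauge_integrable Gd Q \<Gamma> \<longleftrightarrow>
    (\<exists>\<Phi>\<in>cb. \<forall>\<epsilon>>0. \<exists>\<delta>. Gd \<delta> \<and> riemann_close (\<lambda>t. radstrom (\<Gamma> t)) (radstrom \<Phi>) Q \<delta> \<epsilon>)"
proof -
  have eq: "hausdorff_dist \<Phi> (riemann_sum \<Gamma> P) = dist (radstrom \<Phi>) (gauge_sum (\<lambda>t. radstrom (\<Gamma> t)) P)"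
    if "\<Phi> \<in> cb" "Q P" for \<Phi> P
  proof -
    have tag: "t \<in> {0..1}" if "(t, I) \<in> P" for t I using partition_01D(2)[OF Q[rule_format, OF \<open>Q P\<close>] that] by simp
    show ?thesis
      using hausdorff_dist_radstrom[OF cb_nbc[OF that(1)] riemann_sum_radstrom(1)[OF \<Gamma> tag]] riemann_sum_radstrom(2)[OF \<Gamma> tag]
      by simp
  qed
  have "(\<forall>P. Q P \<and> sym_ball \<delta> fine P \<longrightarrow> hausdorff_dist \<Phi> (riemann_sum \<Gamma> P) < \<epsilon>) \<longleftrightarrow>
      riemann_close (\<lambda>t. radstrom (\<Gamma> t)) (radstrom \<Phi>) Q \<delta> \<epsilon>" if "\<Phi> \<in> cb" for \<Phi> \<delta> \<epsilon>
    unfolding riemann_close_def using eq[OF that] by auto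
  then show ?thesis unfolding gauge_integrable_def sym_ball_def[abs_def] by simp
qed

lemma sets_lebesgue_on_01: "A \<in> sets (lebesgue_on {0..1::real}) \<longleftrightarrow> A \<in> sets lebesgue \<and> A \<subseteq> {0..1}"
  by (subst sets_restrict_space_iff) auto

lemma support_integrable_iff_radstrom:
  fixes \<Gamma> :: "real \<Rightarrow> 'a::banach set"
  assumes \<Gamma>: "\<forall>t\<in>{0..1}. \<Gamma> t \<in> cb"
  shows "support_integrable \<Gamma> \<longleftrightarrow> (\<forall>f. set_integrable lebesgue {0..1} (\<lambda>t. apply_bcontfun (radstrom (\<Gamma> t)) f))"
proof -
  have "set_integrable lebesgue {0..1} (\<lambda>t. support_fun f (\<Gamma> t)) \<longleftrightarrow>
      set_integrable lebesgue {0..1} (\<lambda>t. apply_bcontfun (radstrom (\<Gamma> t)) f)" for f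
  proof -
    have "set_integrable lebesgue {0..1} (\<lambda>t. support_fun f (\<Gamma> t)) \<longleftrightarrow>
        set_integrable lebesgue {0..1} (\<lambda>t. max 1 (norm f) * apply_bcontfun (radstrom (\<Gamma> t)) f)"
      by (rule set_integrable_cong) (use \<Gamma> cb_nbc nbcD support_fun_eq_radstrom in blast)+
    also have "\<dots> \<longleftrightarrow> set_integrable lebesgue {0..1} (\<lambda>t. apply_bcontfun (radstrom (\<Gamma> t)) f)"
      by (subst set_integrable_mult_right_iff) auto
    finally show ?thesis .
  qed
  then show ?thesis by (simp add: support_integrable_def)
qed

text \<open>Clipping divides both sides by the same positive number
  \<open>max 1 (norm f)\<close>.\<close>

lemma support_fun_integral_iff_radstrom:
  fixes \<Gamma> :: "real \<Rightarrow> 'a::banach set"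
  assumes \<Gamma>: "\<forall>t\<in>{0..1}. \<Gamma> t \<in> cb" and A: "A \<in> sets lebesgue" "A \<subseteq> {0..1}" and C: "C \<in> cb"
  shows "support_fun f C = (LINT t:A|lebesgue. support_fun f (\<Gamma> t)) \<longleftrightarrow>
    apply_bcontfun (radstrom C) f = (LINT t:A|lebesgue. apply_bcontfun (radstrom (\<Gamma> t)) f)"
proof -
  have eq: "support_fun f D = max 1 (norm f) * apply_bcontfun (radstrom D) f" if "D \<in> cb" for D
    using support_fun_eq_radstrom nbcD[OF cb_nbc[OF that]] by blast
  have "(LINT t:A|lebesgue. support_fun f (\<Gamma> t)) = (LINT t:A|lebesgue. max 1 (norm f) * apply_bcontfun (radstrom (\<Gamma> t)) f)"
    by (rule set_lebesgue_integral_cong[OF A(1)]) (use A(2) \<Gamma> eq in blast)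
  also have "\<dots> = max 1 (norm f) * (LINT t:A|lebesgue. apply_bcontfun (radstrom (\<Gamma> t)) f)"
    by simp
  finally show ?thesis using eq[OF C] by auto
qed

lemma h_multimeasure_iff_radstrom:
  fixes M :: "real set \<Rightarrow> 'a::banach set"
  assumes M: "\<And>A. A \<in> sets lebesgue \<Longrightarrow> A \<subseteq> {0..1} \<Longrightarrow> M A \<in> cb"
  shows "h_multimeasure M \<longleftrightarrow> (\<forall>E::nat \<Rightarrow> real set. (\<forall>k. E k \<in> sets lebesgue \<and> E k \<subseteq> {0..1}) \<and> disjoint_family E \<longrightarrow>
    (\<lambda>n. \<Sum>k<n. radstrom (M (E k))) \<longlonglongrightarrow> radstrom (M (\<Union>k. E k)))"
proof -
  have "(\<lambda>n. hausdorff_dist (\<Sum>k<n. M (E k)) (M (\<Union>k. E k))) \<longlonglongrightarrow> 0 \<longleftrightarrow>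
      (\<lambda>n. \<Sum>k<n. radstrom (M (E k))) \<longlonglongrightarrow> radstrom (M (\<Union>k. E k))"
    if E: "\<forall>k. E k \<in> sets lebesgue \<and> E k \<subseteq> {0..1}" for E :: "nat \<Rightarrow> real set"
  proof -
    have n: "nbc (M (E k))" for k using E M cb_nbc by blast
    have "nbc (M (\<Union>k. E k))" using E by (intro cb_nbc M sets.countable_UN) auto
    then have "hausdorff_dist (\<Sum>k<n. M (E k)) (M (\<Union>k. E k)) = dist (\<Sum>k<n. radstrom (M (E k))) (radstrom (M (\<Union>k. E k)))" for n
      by (simp add: hausdorff_dist_radstrom nbc_sum n radstrom_sum)
    then show ?thesis by (simp add: tendsto_dist_iff[symmetric])
  qed
  moreover have "range E \<subseteq> sets (lebesgue_on {0..1}) \<longleftrightarrow> (\<forall>k. E k \<in> sets lebesgue \<and> E k \<subseteq> {0..1})"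
    for E :: "nat \<Rightarrow> real set" unfolding image_subset_iff sets_lebesgue_on_01 by simp
  ultimately show ?thesis unfolding h_multimeasure_def using M by (simp add: sets_lebesgue_on_01 cong: conj_cong)
qed

lemma strongly_pettis_integrable_iff_radstrom:
  fixes \<Gamma> :: "real \<Rightarrow> 'a::banach set"
  assumes \<Gamma>: "\<forall>t\<in>{0..1}. \<Gamma> t \<in> cb"
  shows "strongly_pettis_integrable \<Gamma> \<longleftrightarrow>
    (\<forall>f. set_integrable lebesgue {0..1} (\<lambda>t. apply_bcontfun (radstrom (\<Gamma> t)) f)) \<and>
    (\<exists>M. (\<forall>A. A \<in> sets lebesgue \<longrightarrow> A \<subseteq> {0..1} \<longrightarrow> M A \<in> cb \<and>
        (\<forall>f. apply_bcontfun (radstrom (M A)) f = (LINT t:A|lebesgue. apply_bcontfun (radstrom (\<Gamma> t)) f))) \<and>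
      (\<forall>E::nat \<Rightarrow> real set. (\<forall>k. E k \<in> sets lebesgue \<and> E k \<subseteq> {0..1}) \<and> disjoint_family E \<longrightarrow>
        (\<lambda>n. \<Sum>k<n. radstrom (M (E k))) \<longlonglongrightarrow> radstrom (M (\<Union>k. E k))))"
    (is "_ \<longleftrightarrow> ?int \<and> (\<exists>M. ?pettis M \<and> ?ca M)")
proof -
  have pettis: "is_pettis_integral \<Gamma> M \<longleftrightarrow> ?pettis M" for M
  proof
    assume L: "is_pettis_integral \<Gamma> M"
    show "?pettis M"
    proof (intro allI impI conjI)
      fix A :: "real set" assume A: "A \<in> sets lebesgue" "A \<subseteq> {0..1}"
      then have *: "M A \<in> cb" "\<And>f. support_fun f (M A) = (LINT t:A|lebesgue. support_fun f (\<Gamma> t))"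
        using L by (auto simp: is_pettis_integral_def sets_lebesgue_on_01)
      show "M A \<in> cb" by fact
      show "apply_bcontfun (radstrom (M A)) f = (LINT t:A|lebesgue. apply_bcontfun (radstrom (\<Gamma> t)) f)" for f
        using support_fun_integral_iff_radstrom[OF \<Gamma> A *(1)] *(2) by blast
    qed
  next
    assume R: "?pettis M"
    show "is_pettis_integral \<Gamma> M"
      unfolding is_pettis_integral_def sets_lebesgue_on_01
    proof (intro ballI conjI allI)
      fix A :: "real set" assume "A \<in> sets (lebesgue_on {0..1})"
      then have A: "A \<in> sets lebesgue" "A \<subseteq> {0..1}" by (auto simp: sets_lebesgue_on_01)
      show cb: "M A \<in> cb" using R A by blast
      show "support_fun f (M A) = (LINT t:A|lebesgue. support_fun f (\<Gamma> t))" for f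
        using support_fun_integral_iff_radstrom[OF \<Gamma> A cb] R A by blast
    qed
  qed
  have "?pettis M \<and> h_multimeasure M \<longleftrightarrow> ?pettis M \<and> ?ca M" for M
  proof (rule conj_cong[OF refl])
    assume "?pettis M"
    then have "M A \<in> cb" if "A \<in> sets lebesgue" "A \<subseteq> {0..1}" for A using that by blast
    then show "h_multimeasure M \<longleftrightarrow> ?ca M" by (rule h_multimeasure_iff_radstrom)
  qed
  then have ex: "(\<exists>M. ?pettis M \<and> h_multimeasure M) \<longleftrightarrow> (\<exists>M. ?pettis M \<and> ?ca M)"
    by (simp only:)
  have "strongly_pettis_integrable \<Gamma> \<longleftrightarrow> support_integrable \<Gamma> \<and> (\<exists>M. is_pettis_integral \<Gamma> M \<and> h_multimeasure M)"
    unfolding strongly_pettis_integrable_def pettis_integrable_def by blast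
  then show ?thesis
    by (simp only: support_integrable_iff_radstrom[OF \<Gamma>] pettis ex)
qed

section \<open>The two implications\<close>

lemma mcshane_imp_strongly_pettis:
  fixes \<Gamma> :: "real \<Rightarrow> 'a::banach set"
  assumes \<Gamma>: "\<forall>t\<in>{0..1}. \<Gamma> t \<in> cb" and McS: "mcshane_integrable \<Gamma>"
  shows "strongly_pettis_integrable \<Gamma>"
proof -
  let ?g = "\<lambda>t. radstrom (\<Gamma> t)"
  have part: "\<forall>P. partition_01 P \<longrightarrow> partition_01 P" by simp
  obtain \<Phi> where \<Phi>: "\<And>\<epsilon>. 0 < \<epsilon> \<Longrightarrow> \<exists>\<delta>. positive_gauge \<delta> \<and> riemann_close ?g (radstrom \<Phi>) partition_01 \<delta> \<epsilon>"
    using McS unfolding mcshane_integrable_def gauge_integrable_iff_riemann_close[OF \<Gamma> part] by blast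
  obtain \<delta> P \<nu> where \<delta>: "\<And>n::nat. positive_gauge (\<delta> n)" "\<And>n. riemann_close ?g (radstrom \<Phi>) partition_01 (\<delta> n) ((1/2) ^ n)"
    and P: "\<And>n. P n tagged_division_of {0..1}" "\<And>n. sym_ball (\<delta> n) fine P n"
    and bd: "\<And>n E. E \<in> sets lebesgue \<Longrightarrow> E \<subseteq> {0..1} \<Longrightarrow> norm (step_sum ?g (P n) E - \<nu> E) \<le> 2 * (1/2) ^ n"
    using McShane_indefinite[OF \<Phi>] by blast
  have hi: "((\<lambda>t. apply_bcontfun (?g t) f) has_integral apply_bcontfun (radstrom \<Phi>) f) {0..1}" for f
  proof (rule coord_has_integral)
    fix \<epsilon> :: real assume "0 < \<epsilon>"
    then obtain \<delta> where "positive_gauge \<delta>" "riemann_close ?g (radstrom \<Phi>) partition_01 \<delta> \<epsilon>" using \<Phi> by blast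
    then show "\<exists>\<delta>. positive_gauge \<delta> \<and> riemann_close ?g (radstrom \<Phi>) perron_partition_01 \<delta> \<epsilon>"
      by (intro exI[of _ \<delta>] conjI riemann_close_perron)
  qed
  have eq: "integral {a..b} (\<lambda>t. apply_bcontfun (?g t) f) = apply_bcontfun (\<nu> {a..b}) f" if "{a..b} \<subseteq> {0..1}" for a b f
    by (rule indefinite_coord_interval[OF \<delta> P bd hi that])
  have int: "set_integrable lebesgue {0..1} (\<lambda>t. apply_bcontfun (?g t) f)" for f
    by (rule indefinite_coord_integrable[OF P(1) bd _ eq]) (use hi in blast)+
  have \<nu>: "apply_bcontfun (\<nu> E) f = (LINT t:E|lebesgue. apply_bcontfun (?g t) f)" if "E \<in> sets lebesgue" "E \<subseteq> {0..1}" for E f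
    by (rule indefinite_coord_integral[OF P(1) bd int eq that])
  have "\<nu> E \<in> radstrom ` cb" if E: "E \<in> sets lebesgue" "E \<subseteq> {0..1}" for E
  proof (rule indefinite_in_closed_cone[OF P(1) bd closed_radstrom_cb _ _ _ _ E])
    show "0 \<in> radstrom ` (cb :: 'a set set)"
      using radstrom_zero closure_in_cb[OF nbc_zero] radstrom_closure[OF nbc_zero] by (metis image_eqI)
    show "x + y \<in> radstrom ` cb" if "x \<in> radstrom ` cb" "y \<in> radstrom ` cb" for x y :: "('a \<Rightarrow>\<^sub>L real) \<Rightarrow>\<^sub>C real"
    proof -
      obtain A B where AB: "A \<in> cb" "B \<in> cb" "x = radstrom A" "y = radstrom B" using \<open>x \<in> _\<close> \<open>y \<in> _\<close> by blast
      note n = cb_nbc[OF AB(1)] cb_nbc[OF AB(2)]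
      \<comment> \<open>The sum itself may fail to be closed; its closure has the same image and
        lies in \<open>cb\<close>.\<close>
      have "x + y = radstrom (closure (A + B))" by (simp add: AB radstrom_closure nbc_plus n radstrom_plus)
      then show ?thesis using closure_in_cb[OF nbc_plus[OF n]] by blast
    qed
    show "c *\<^sub>R x \<in> radstrom ` cb" if "0 \<le> c" "x \<in> radstrom ` cb" for c and x :: "('a \<Rightarrow>\<^sub>L real) \<Rightarrow>\<^sub>C real"
    proof -
      obtain A where A: "A \<in> cb" "x = radstrom A" using \<open>x \<in> _\<close> by blast
      note n = cb_nbc[OF A(1)]
      have "c *\<^sub>R x = radstrom (closure ((\<lambda>x. c *\<^sub>R x) ` A))"
        by (simp add: A radstrom_closure nbc_scale n radstrom_scale \<open>0 \<le> c\<close>)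
      then show ?thesis using closure_in_cb[OF nbc_scale[OF n]] by blast
    qed
    show "radstrom (\<Gamma> t) \<in> radstrom ` cb" if "t \<in> {0..1}" for t by (rule imageI) (rule bspec[OF \<Gamma> that])
  qed
  then have "\<forall>E. \<exists>C. E \<in> sets lebesgue \<longrightarrow> E \<subseteq> {0..1} \<longrightarrow> C \<in> cb \<and> radstrom C = \<nu> E" by fastforce
  then obtain M where M: "\<And>E. E \<in> sets lebesgue \<Longrightarrow> E \<subseteq> {0..1} \<Longrightarrow> M E \<in> cb \<and> radstrom (M E) = \<nu> E"
    by metis
  have "(\<lambda>n. \<Sum>k<n. radstrom (M (E k))) \<longlonglongrightarrow> radstrom (M (\<Union>k. E k))"
    if E: "\<forall>k. E k \<in> sets lebesgue \<and> E k \<subseteq> {0..1}" and dis: "disjoint_family E" for E :: "nat \<Rightarrow> real set"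
  proof -
    have "(\<Union>k. E k) \<in> sets lebesgue" "(\<Union>k. E k) \<subseteq> {0..1}" using E by auto
    then have "radstrom (M (\<Union>k. E k)) = \<nu> (\<Union>k. E k)" using M by blast
    moreover have "radstrom (M (E k)) = \<nu> (E k)" for k using M E by blast
    moreover have "(\<lambda>n. \<Sum>k<n. \<nu> (E k)) \<longlonglongrightarrow> \<nu> (\<Union>k. E k)"
      by (rule indefinite_countably_additive[OF P(1) bd _ _ dis]) (use E in auto)
    ultimately show ?thesis by simp
  qed
  then show ?thesis
    unfolding strongly_pettis_integrable_iff_radstrom[OF \<Gamma>]
    using int M \<nu> by (intro conjI allI exI[of _ M] impI) auto
qed

lemma strongly_pettis_Henstock_imp_McShane:
  fixes \<Gamma> :: "real \<Rightarrow> 'a::banach set"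
  assumes \<Gamma>: "\<forall>t\<in>{0..1}. \<Gamma> t \<in> cb" and SP: "strongly_pettis_integrable \<Gamma>"
    and Gd: "Gd = positive_gauge \<or> Gd = measurable_gauge" and H: "gauge_integrable Gd perron_partition_01 \<Gamma>"
  shows "gauge_integrable Gd partition_01 \<Gamma>"
proof -
  let ?g = "\<lambda>t. radstrom (\<Gamma> t)"
  have part: "\<forall>P. partition_01 P \<longrightarrow> partition_01 P" by simp
  note S = SP[unfolded strongly_pettis_integrable_iff_radstrom[OF \<Gamma>]]
  have int: "\<And>f. set_integrable lebesgue {0..1} (\<lambda>t. apply_bcontfun (?g t) f)" using conjunct1[OF S] by (rule spec)
  obtain M where M: "\<forall>A. A \<in> sets lebesgue \<longrightarrow> A \<subseteq> {0..1} \<longrightarrow> M A \<in> cb \<and>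
        (\<forall>f. apply_bcontfun (radstrom (M A)) f = (LINT t:A|lebesgue. apply_bcontfun (?g t) f))"
    and ca: "\<forall>E::nat \<Rightarrow> real set. (\<forall>k. E k \<in> sets lebesgue \<and> E k \<subseteq> {0..1}) \<and> disjoint_family E \<longrightarrow>
        (\<lambda>n. \<Sum>k<n. radstrom (M (E k))) \<longlonglongrightarrow> radstrom (M (\<Union>k. E k))"
    using conjunct2[OF S] by (elim exE conjE) (rule that)
  have M: "\<And>A f. A \<in> sets lebesgue \<Longrightarrow> A \<subseteq> {0..1} \<Longrightarrow>
      apply_bcontfun (radstrom (M A)) f = (LINT t:A|lebesgue. apply_bcontfun (?g t) f)"
    using M by blast
  have ca: "\<And>E::nat \<Rightarrow> real set. (\<And>k. E k \<in> sets lebesgue \<and> E k \<subseteq> {0..1}) \<Longrightarrow> disjoint_family E \<Longrightarrow>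
        (\<lambda>n. \<Sum>k<n. radstrom (M (E k))) \<longlonglongrightarrow> radstrom (M (\<Union>k. E k))"
    using ca by blast
  \<comment> \<open>Countable additivity alone would not give this; it comes from the coordinates
    being Lebesgue integrals.\<close>
  have null: "radstrom (M E) = 0" if E: "E \<in> null_sets lebesgue" "E \<subseteq> {0..1}" for E
  proof (rule bcontfun_eqI)
    fix f
    have "(LINT t:E|lebesgue. apply_bcontfun (?g t) f) = 0"
      unfolding set_lebesgue_integral_def
      by (rule integral_eq_zero_AE) (use AE_not_in[OF E(1)] in \<open>eventually_elim, simp\<close>)
    then show "apply_bcontfun (radstrom (M E)) f = apply_bcontfun 0 f" using M[of E f] E by auto
  qed
  have AC: "\<exists>\<eta>>0. \<forall>E\<in>sets lebesgue. E \<subseteq> {0..1} \<longrightarrow> measure lebesgue E < \<eta> \<longrightarrow>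
      (\<forall>f. (LINT t:E|lebesgue. \<bar>apply_bcontfun (?g t) f\<bar>) \<le> \<epsilon>)" if \<epsilon>: "0 < \<epsilon>" for \<epsilon>
  proof -
    \<comment> \<open>Half of \<open>\<epsilon>\<close>, because passing to absolute integrals costs
      a factor 2.\<close>
    obtain \<eta> where \<eta>: "0 < \<eta>" "\<And>E. E \<in> sets lebesgue \<Longrightarrow> E \<subseteq> {0..1} \<Longrightarrow> measure lebesgue E < \<eta> \<Longrightarrow> norm (radstrom (M E)) \<le> \<epsilon> / 2"
      using vector_measure_abs_continuous[of "\<lambda>E. radstrom (M E)" "\<epsilon> / 2", OF ca null] \<epsilon> by auto
    have "(LINT t:E|lebesgue. \<bar>apply_bcontfun (?g t) f\<bar>) \<le> 2 * (\<epsilon> / 2)"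
      if E: "E \<in> sets lebesgue" "E \<subseteq> {0..1}" "measure lebesgue E < \<eta>" for E f
    proof (rule integral_abs_le_of_indefinite[OF int E(1,2)])
      fix A assume A: "A \<in> sets lebesgue" "A \<subseteq> E"
      have "measure lebesgue A \<le> measure lebesgue E"
        by (rule measure_mono_fmeasurable[OF A(2,1) lmeasurable_01[OF E(1,2)]])
      then have "norm (radstrom (M A)) \<le> \<epsilon> / 2" using \<eta>(2)[OF A(1)] A(2) E(2,3) by force
      then show "\<bar>LINT t:A|lebesgue. apply_bcontfun (?g t) f\<bar> \<le> \<epsilon> / 2"
        using norm_bounded[of "radstrom (M A)" f] M[OF A(1), of f] A(2) E(2) by auto
    qed
    then show ?thesis using \<eta>(1) by auto
  qed
  have perron: "\<forall>P. perron_partition_01 P \<longrightarrow> partition_01 P" by (simp add: perron_partition_01_def)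
  obtain \<Phi> where \<Phi>: "\<Phi> \<in> cb" "\<And>\<epsilon>. 0 < \<epsilon> \<Longrightarrow> \<exists>\<delta>. Gd \<delta> \<and> riemann_close ?g (radstrom \<Phi>) perron_partition_01 \<delta> \<epsilon>"
    using H unfolding gauge_integrable_iff_riemann_close[OF \<Gamma> perron] by blast
  have "\<exists>\<delta>. Gd \<delta> \<and> riemann_close ?g (radstrom \<Phi>) partition_01 \<delta> \<epsilon>" if "0 < \<epsilon>" for \<epsilon>
    by (rule McShane_of_Henstock[OF int AC Gd \<Phi>(2) that])
  then show ?thesis
    using \<Phi>(1) unfolding gauge_integrable_iff_riemann_close[OF \<Gamma> part] by blast
qed

lemma gauge_integrable_mono:
  assumes "gauge_integrable G Q \<Gamma>" "\<And>\<delta>. G \<delta> \<Longrightarrow> G' \<delta>" "\<And>P. Q' P \<Longrightarrow> Q P"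
  shows "gauge_integrable G' Q' \<Gamma>"
  using assms unfolding gauge_integrable_def by meson

theorem theorem4p2:
  fixes \<Gamma> :: "real \<Rightarrow> 'a::banach set"
  assumes "\<And>t. t \<in> {0..1} \<Longrightarrow> \<Gamma> t \<in> cb"
  shows "(mcshane_integrable \<Gamma> \<longleftrightarrow> strongly_pettis_integrable \<Gamma> \<and> henstock_integrable \<Gamma>) \<and>
         (birkhoff_integrable \<Gamma> \<longleftrightarrow> strongly_pettis_integrable \<Gamma> \<and> H_integrable \<Gamma>)"
proof -
  have \<Gamma>: "\<forall>t\<in>{0..1}. \<Gamma> t \<in> cb" using assms by blast
  have perron: "partition_01 P" if "perron_partition_01 P" for P using that by (simp add: perron_partition_01_def)
  \<comment> \<open>Strong Pettis integrability in the Birkhoff case is inherited from the McShane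
    case.\<close>
  have mc: "mcshane_integrable \<Gamma>" if "birkhoff_integrable \<Gamma>"
    using that unfolding birkhoff_integrable_def mcshane_integrable_def
    by (rule gauge_integrable_mono) (simp_all add: measurable_gauge_imp_positive)
  have "henstock_integrable \<Gamma>" if "mcshane_integrable \<Gamma>"
    using that unfolding henstock_integrable_def mcshane_integrable_def
    by (rule gauge_integrable_mono) (simp_all add: perron)
  moreover have "H_integrable \<Gamma>" if "birkhoff_integrable \<Gamma>"
    using that unfolding H_integrable_def birkhoff_integrable_def
    by (rule gauge_integrable_mono) (simp_all add: perron)
  moreover have "mcshane_integrable \<Gamma>" if "strongly_pettis_integrable \<Gamma>" "henstock_integrable \<Gamma>"
    using strongly_pettis_Henstock_imp_McShane[OF \<Gamma> that(1), of positive_gauge] that(2)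
    by (simp add: henstock_integrable_def mcshane_integrable_def)
  moreover have "birkhoff_integrable \<Gamma>" if "strongly_pettis_integrable \<Gamma>" "H_integrable \<Gamma>"
    using strongly_pettis_Henstock_imp_McShane[OF \<Gamma> that(1), of measurable_gauge] that(2)
    by (simp add: H_integrable_def birkhoff_integrable_def)
  ultimately show ?thesis using mcshane_imp_strongly_pettis[OF \<Gamma>] mc by blast
qed

end
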